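(* Consider the linear regression model $Y_{i}=\beta_0+\mathbf x_{i}^{\top}\boldsymbol\beta+e_{i}$, $i=1,\ldots,n$ (with $\mathbf x_i=\mathbf x_{ni}\in\mathbb R^p$, $e_i=e_{ni}$), and put $\bar{\mathbf x}_n=\frac1n\sum_{i=1}^n\mathbf x_i$. Let $$\widetilde B_n(\alpha)=\left(Y_i-(\mathbf x_i-\bar{\mathbf x}_n)^{\top}\widetilde{\boldsymbol\beta}_{nR}\right)_{n:[n\alpha]}$$ be the two-step averaged regression $\alpha$-quantile, with the R-estimator $\widetilde{\boldsymbol\beta}_{nR}$ of $\boldsymbol\beta$ generated by the score function $\varphi_\lambda(u)=\lambda-I[u<\lambda]$, $0<u<1$, with $\lambda\in(0,1)$ fixed, and let $\bar B_n(\alpha)$ be the averaged regression $\alpha$-quantile. Assume: (A1) The errors $e_{ni}$, $i=1,\ldots,n$, are independent and identically distributed; their distribution function $F$ has an absolutely continuous density $f$ and positive and finite Fisher information: $0<\mathcal I(f)=\int\left(\frac{f'(z)}{f(z)}\right)^2dF(z)<\infty$. (A2) $\lim_{n\to\infty}\mathbf Q_n=\mathbf Q$, where $\mathbf Q_n=n^{-1}\sum_{i=1}^n(\mathbf x_i-\bar{\mathbf x}_n)(\mathbf x_i-\bar{\mathbf x}_n)^\top$ and $\mathbf Q$ is a positive definite $p\times p$ matrix; moreover, $\lim_{n\to\infty}\max_{1\le i\le n}n^{-1}(\mathbf x_i-\bar{\mathbf x}_n)^\top\mathbf Q_n^{-1}(\mathbf x_i-\bar{\mathbf x}_n)=0$.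 (A3) $\max_{1\le i\le n}\|\mathbf x_{ni}-\bar{\mathbf x}_n\|=o(n^{1/4})$ as $n\to\infty$. Then, as $n\to\infty$, $$\text{(i)}\quad n^{1/2}\left[\left(\widetilde B_n(\alpha)-\beta_0-\bar{\mathbf x}_n^{\top}\boldsymbol\beta\right)-e_{n:[n\alpha]}\right]=o_p(1),$$ $$\text{(ii)}\quad n^{1/2}\left|\widetilde B_n(\alpha)-\bar B_n(\alpha)\right|=o_p(1),$$ uniformly over $\alpha\in(\varepsilon,1-\varepsilon)\subset(0,1)$, for every $\varepsilon\in(0,\tfrac12)$.
   Context: The responses $Y_1,\ldots,Y_n$ are observed; the covariates are random or nonrandom; $(\beta_0,\boldsymbol\beta^\top)^\top\in\mathbb R^{p+1}$ is an unknown parameter. For real numbers $z_1,\ldots,z_n$, $(z_i)_{n:[n\alpha]}$, also written $z_{n:[n\alpha]}$, denotes the $[n\alpha]$-th order statistic of $z_1,\ldots,z_n$; in particular $e_{n:[n\alpha]}$ is the $[n\alpha]$-th order statistic of the errors $e_{n1},\ldots,e_{nn}$. $I[\cdot]$ is the indicator. R-estimator: given a nondecreasing square-integrable function $\varphi$ on $(0,1)$, the rank scores generated by $\varphi$ are either the exact scores $A_n(i)=\mathbb E\{\varphi(U_{n:i})\}$, where $U_{n:1}\le\ldots\le U_{n:n}$ is the ordered random sample of size $n$ from the uniform $(0,1)$ distribution, or the approximate scores, which are either $A_n(i)=n\int_{(i-1)/n}^{i/n}\varphi(u)\,du$ or $A_n(i)=\varphi\left(\frac{i}{n+1}\right)$,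 $i=1,\ldots,n$. The R-estimator $\widetilde{\boldsymbol\beta}_{nR}$ generated by $\varphi$ is a minimizer over $\mathbf b\in\mathbb R^p$ of Jaeckel's measure of rank dispersion $$\mathcal D_n(\mathbf b)=\sum_{i=1}^n(Y_i-\mathbf x_i^\top\mathbf b)\,A_n\big(R_{ni}(Y_i-\mathbf x_i^\top\mathbf b)\big),$$ where $R_{ni}(Y_i-\mathbf x_i^\top\mathbf b)$ is the rank of the $i$-th residual among $Y_1-\mathbf x_1^\top\mathbf b,\ldots,Y_n-\mathbf x_n^\top\mathbf b$. The minimizer is generally not unique; any solution may be taken. Averaged regression quantile: with $\mathbf x_i^*=(1,x_{i1},\ldots,x_{ip})^\top$, the regression $\alpha$-quantile is $$\widehat{\boldsymbol\beta}_n^*(\alpha)=\arg\min_{\mathbf b\in\mathbb R^{p+1}}\sum_{i=1}^n\left[\alpha(Y_i-\mathbf x_i^{*\top}\mathbf b)^+ +(1-\alpha)(Y_i-\mathbf x_i^{*\top}\mathbf b)^-\right],$$ with $z^+=\max(z,0)$, $z^-=\max(-z,0)$, and $\bar B_n(\alpha)=\overline{\mathbf x}_n^{*\top}\widehat{\boldsymbol\beta}_n^*(\alpha)$, where $\overline{\mathbf x}_n^*=\frac1n\sum_{i=1}^n\mathbf x_i^*$.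
   Formalization: Added, since the claim fails otherwise: random covariates are independent of the errors (with (A2), (A3) almost surely); f>0 wherever 0<F<1; and, only for the scores φ(i/(n+1)), the mean covariate vector has norm O(n^{1/2}). *)

theory Defs
  imports "HOL-Probability.Probability" "HOL-Library.Landau_Symbols"
begin

text \<open>
  A sample of size \<open>n\<close> is a function on \<open>nat\<close> of which only the values at \<open>1, \<dots>, n\<close> are used.
\<close>

definition sample_mean :: "nat \<Rightarrow> (nat \<Rightarrow> 'a::real_vector) \<Rightarrow> 'a" where
  "sample_mean n x = (1 / real n) *\<^sub>R (\<Sum>i=1..n. x i)"

text \<open>The \<open>k\<close>-th smallest of \<open>z 1, \<dots>, z n\<close>; meaningful for \<open>1 \<le> k \<le> n\<close>.\<close>

definition order_stat :: "nat \<Rightarrow> (nat \<Rightarrow> real) \<Rightarrow> nat \<Rightarrow> real" where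
  "order_stat n z k = sort (map z [1..<Suc n]) ! (k - 1)"

text \<open>
  Ties are broken by the index, so that the ranks always form a permutation of \<open>1, \<dots>, n\<close>.
  The dispersion below does not depend on how ties are broken, because tied residuals are equal.
  Giving tied residuals a common maximal rank would change it exactly at the tied configurations,
  where its minima lie.
\<close>

definition sample_rank :: "nat \<Rightarrow> (nat \<Rightarrow> real) \<Rightarrow> nat \<Rightarrow> nat" where
  "sample_rank n z i = card {j \<in> {1..n}. z j < z i} + card {j \<in> {1..i}. z j = z i}"

definition exact_scores :: "(real \<Rightarrow> real) \<Rightarrow> nat \<Rightarrow> nat \<Rightarrow> real" where
  "exact_scores \<phi> n i =
     (\<integral>u. \<phi> (order_stat n u i) \<partial>(PiM {1..n} (\<lambda>_. uniform_measure lborel {0<..<1})))"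

definition integral_scores :: "(real \<Rightarrow> real) \<Rightarrow> nat \<Rightarrow> nat \<Rightarrow> real" where
  "integral_scores \<phi> n i =
     real n * (LINT u:{(real i - 1) / real n <..< real i / real n}|lborel. \<phi> u)"

definition point_scores :: "(real \<Rightarrow> real) \<Rightarrow> nat \<Rightarrow> nat \<Rightarrow> real" where
  "point_scores \<phi> n i = \<phi> (real i / (real n + 1))"

definition quantile_score :: "real \<Rightarrow> real \<Rightarrow> real" where
  "quantile_score l u = l - indicator {..<l} u"

definition rank_dispersion ::
    "(nat \<Rightarrow> nat \<Rightarrow> real) \<Rightarrow> nat \<Rightarrow> (nat \<Rightarrow> real) \<Rightarrow> (nat \<Rightarrow> 'a::real_inner) \<Rightarrow> 'a \<Rightarrow> real" where
  "rank_dispersion A n Y x b =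
     (\<Sum>i=1..n. (Y i - x i \<bullet> b) * A n (sample_rank n (\<lambda>j. Y j - x j \<bullet> b) i))"

definition two_step_arq ::
    "nat \<Rightarrow> real \<Rightarrow> (nat \<Rightarrow> real) \<Rightarrow> (nat \<Rightarrow> 'a::real_inner) \<Rightarrow> 'a \<Rightarrow> real" where
  "two_step_arq n \<alpha> Y x b =
     order_stat n (\<lambda>i. Y i - (x i - sample_mean n x) \<bullet> b) (nat \<lfloor>real n * \<alpha>\<rfloor>)"

text \<open>
  \<open>\<real>\<^bsup>p+1\<^esup>\<close> is the product space \<^typ>\<open>real \<times> 'a\<close>, the first component being the intercept; there
  \<open>(1, x) \<bullet> (b\<^sub>0, b) = b\<^sub>0 + x \<bullet> b\<close>.
\<close>

definition with_intercept :: "'a \<Rightarrow> real \<times> 'a" where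
  "with_intercept x = (1, x)"

definition rq_loss ::
    "nat \<Rightarrow> real \<Rightarrow> (nat \<Rightarrow> real) \<Rightarrow> (nat \<Rightarrow> 'a::real_inner) \<Rightarrow> real \<times> 'a \<Rightarrow> real" where
  "rq_loss n \<alpha> Y x b =
     (\<Sum>i=1..n. \<alpha> * max (Y i - with_intercept (x i) \<bullet> b) 0
             + (1 - \<alpha>) * max (- (Y i - with_intercept (x i) \<bullet> b)) 0)"

definition averaged_rq :: "nat \<Rightarrow> (nat \<Rightarrow> 'a::real_inner) \<Rightarrow> real \<times> 'a \<Rightarrow> real" where
  "averaged_rq n x b = sample_mean n (\<lambda>i. with_intercept (x i)) \<bullet> b"

definition design_cov :: "nat \<Rightarrow> (nat \<Rightarrow> real ^ 'p) \<Rightarrow> real ^ 'p ^ 'p" where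
  "design_cov n x = (1 / real n) *\<^sub>R
     (\<Sum>i=1..n. (columnvector (x i - sample_mean n x) :: real ^ 1 ^ 'p) ** rowvector (x i - sample_mean n x))"

definition max_leverage :: "nat \<Rightarrow> (nat \<Rightarrow> real ^ 'p) \<Rightarrow> real" where
  "max_leverage n x =
     Max ((\<lambda>i. (x i - sample_mean n x) \<bullet>
              (matrix_inv (design_cov n x) *v (x i - sample_mean n x)) / real n) ` {1..n})"

definition max_deviation :: "nat \<Rightarrow> (nat \<Rightarrow> real ^ 'p) \<Rightarrow> real" where
  "max_deviation n x = Max ((\<lambda>i. norm (x i - sample_mean n x)) ` {1..n})"

definition positive_definite :: "real ^ 'p ^ 'p \<Rightarrow> bool" where
  "positive_definite Q \<longleftrightarrow> transpose Q = Q \<and> (\<forall>v. v \<noteq> 0 \<longrightarrow> 0 < v \<bullet> (Q *v v))"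

definition absolutely_continuous_on :: "real \<Rightarrow> real \<Rightarrow> (real \<Rightarrow> real) \<Rightarrow> bool" where
  "absolutely_continuous_on a b f \<longleftrightarrow>
     (\<forall>\<epsilon>>0. \<exists>\<delta>>0. \<forall>I. finite I \<longrightarrow> (\<forall>(u, v)\<in>I. a \<le> u \<and> u \<le> v \<and> v \<le> b) \<longrightarrow>
        disjoint_family_on (\<lambda>(u, v). {u<..<v}) I \<longrightarrow>
        (\<Sum>(u, v)\<in>I. v - u) < \<delta> \<longrightarrow> (\<Sum>(u, v)\<in>I. \<bar>f v - f u\<bar>) < \<epsilon>)"

text \<open>
  An absolutely continuous function is differentiable almost everywhere, so the unspecified value
  of \<^const>\<open>deriv\<close> elsewhere is irrelevant; points with \<open>f z = 0\<close> are null for the integrating measure.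
\<close>

definition fisher_information :: "(real \<Rightarrow> real) \<Rightarrow> ennreal" where
  "fisher_information f =
     (\<integral>\<^sup>+z. ennreal ((deriv f z / f z)\<^sup>2) \<partial>(density lborel (\<lambda>z. ennreal (f z))))"

text \<open>The \<open>\<sigma>\<close>-algebra on \<open>space M\<close> generated by \<open>X 1, \<dots>, X n\<close>.\<close>

definition sample_events :: "'w measure \<Rightarrow> nat \<Rightarrow> (nat \<Rightarrow> 'w \<Rightarrow> 'b::topological_space) \<Rightarrow> 'w set set" where
  "sample_events M n X =
     sets (vimage_algebra (space M) (\<lambda>\<omega>. \<lambda>i\<in>{1..n}. X i \<omega>) (PiM {1..n} (\<lambda>_. borel)))"

text \<open>
  \<open>sup\<^bsub>a\<in>S\<^esub> \<bar>Z n a\<bar> = o\<^sub>p(1)\<close>. The event \<open>sup\<^bsub>a\<in>S\<^esub> \<bar>Z n a\<bar> > \<delta>\<close> is measured by outer probability, since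
  estimators that are arbitrarily selected minimizers need not be measurable in \<open>\<omega>\<close>.
\<close>

definition uniformly_op_1 :: "'w measure \<Rightarrow> 'a set \<Rightarrow> (nat \<Rightarrow> 'a \<Rightarrow> 'w \<Rightarrow> real) \<Rightarrow> bool" where
  "uniformly_op_1 M S Z \<longleftrightarrow>
     (\<forall>\<delta>>0. \<exists>B. (\<forall>n. B n \<in> sets M \<and> {\<omega> \<in> space M. \<exists>a\<in>S. \<delta> < \<bar>Z n a \<omega>\<bar>} \<subseteq> B n) \<and>
        (\<lambda>n. measure M (B n)) \<longlonglongrightarrow> 0)"

end

theory Submission
  imports Defs
begin

text \<open>
  Put \<open>d i = (1, x i - sample_mean n x)\<close>, so that the residuals of both estimators at a local parameter \<open>\<theta>\<close>
  are \<open>e i - t - d i \<bullet> \<theta> / sqrt n\<close>. Fourth moments, monotonicity and a finite grid of pairs \<open>(t, \<theta>)\<close> show that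
  the sum of \<open>(a i - F t) d i / sqrt n\<close>, with \<open>a i\<close> between the one-sided limits of the indicator of
  \<open>e i \<le> t + d i \<bullet> \<theta> / sqrt n\<close>, equals \<open>T t + f t Q\<^sub>n \<theta> + o(1)\<close> uniformly over bounded \<open>\<theta>\<close>, where \<open>T\<close> is bounded
  in probability by chaining. Hence the gradients of the two convex objective functions point outwards on a
  large sphere, which confines the slopes to a ball of radius \<open>O(1 / sqrt n)\<close>; for the rank dispersion, Abel summation
  of the scores reduces its gradient to those indicators, and this also yields the existence of a minimizer.
  Since the design in \<open>d i\<close> is centred, the first coordinate of the expansion does not involve the slope. At the
  scale \<open>sqrt n\<close> around the error quantile \<open>t\<close>, the order statistics of the errors, those of the two-step residuals and the
  averaged regression quantile therefore all solve \<open>fst (T t) + f t \<theta>\<^sub>0 = o(1)\<close>, so they differ by \<open>o(1 / sqrt n)\<close>.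
  Random covariates are handled by conditioning on them.
\<close>

subsection \<open>Fourth moments and dyadic chaining\<close>

text \<open>The exponent 1/4 in the design condition is the price of a union bound. Bracketing
  uniformly in \<open>t\<close> at precision \<open>1 / sqrt n\<close> takes
  \<open>O(sqrt n)\<close> base points. If \<open>\<gamma> sqrt n\<close> bounds the squared norms
  of the \<open>d i\<close>, the fourth-moment bound for one shifted increment is
  \<open>O(\<gamma> / sqrt n)\<close>, so the total is \<open>O(\<gamma>)\<close>, and \<gamma> is
  fixed after the radius and the tolerance. Chebyshev's inequality would leave a total that does not
  tend to 0. Randomness enters through one exceptional set per \<open>n\<close>; outside it the
  comparison is deterministic, for all quantile levels and all selected minimizers at once. This
  gives uniformity and lets the selections be arbitrary. The density is bounded below only at
  central quantiles. At extreme ranks there is no expansion, and a crude bound has to be paid for by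
  the small variation of the scores there. Point scores sum to a bounded number and not to zero, so
  the mean of the covariates survives in the gradient of the dispersion; it has to be
  \<open>O(sqrt n)\<close>, the scale of that gradient.\<close>

lemma (in prob_space) integrable_bounded:
  fixes X :: "'a \<Rightarrow> real"
  assumes "X \<in> borel_measurable M" "\<And>\<omega>. \<omega> \<in> space M \<Longrightarrow> \<bar>X \<omega>\<bar> \<le> c"
  shows "integrable M X"
  by (rule integrable_const_bound[where B = c]) (use assms in auto)

lemma (in prob_space) indep_var_expectation_power:
  fixes X Y :: "'a \<Rightarrow> real"
  assumes ind: "indep_var borel X borel Y"
    and X: "\<And>\<omega>. \<omega> \<in> space M \<Longrightarrow> \<bar>X \<omega>\<bar> \<le> c"
    and Y: "\<And>\<omega>. \<omega> \<in> space M \<Longrightarrow> \<bar>Y \<omega>\<bar> \<le> d"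
  shows "expectation (\<lambda>\<omega>. X \<omega> ^ k * Y \<omega> ^ l) = expectation (\<lambda>\<omega>. X \<omega> ^ k) * expectation (\<lambda>\<omega>. Y \<omega> ^ l)"
    and "integrable M (\<lambda>\<omega>. X \<omega> ^ k * Y \<omega> ^ l)"
proof -
  have mX: "X \<in> borel_measurable M" and mY: "Y \<in> borel_measurable M"
    using ind by (auto dest: indep_var_rv1 indep_var_rv2)
  have i: "indep_var borel (\<lambda>\<omega>. X \<omega> ^ k) borel (\<lambda>\<omega>. Y \<omega> ^ l)"
    using indep_var_compose[OF ind, of "\<lambda>x. x ^ k" borel "\<lambda>x. x ^ l" borel] by (simp add: comp_def)
  have "integrable M (\<lambda>\<omega>. X \<omega> ^ k)" "integrable M (\<lambda>\<omega>. Y \<omega> ^ l)"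
    by (intro integrable_bounded[where c = "c ^ k"] integrable_bounded[where c = "d ^ l"];
        use mX mY X Y in \<open>auto simp: power_abs intro!: power_mono\<close>)+
  with i show "expectation (\<lambda>\<omega>. X \<omega> ^ k * Y \<omega> ^ l) = expectation (\<lambda>\<omega>. X \<omega> ^ k) * expectation (\<lambda>\<omega>. Y \<omega> ^ l)"
    "integrable M (\<lambda>\<omega>. X \<omega> ^ k * Y \<omega> ^ l)"
    by (auto intro: indep_var_lebesgue_integral indep_var_integrable)
qed

text \<open>In the binomial expansions every mixed term with an odd exponent contains a first power
  of a centred factor and vanishes; only the mixed term with both exponents 2 survives.\<close>

lemma (in prob_space) moments_add_indep:
  fixes S X :: "'a \<Rightarrow> real"
  assumes ind: "indep_var borel X borel S"
    and S: "\<And>\<omega>. \<omega> \<in> space M \<Longrightarrow> \<bar>S \<omega>\<bar> \<le> c"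
    and X: "\<And>\<omega>. \<omega> \<in> space M \<Longrightarrow> \<bar>X \<omega>\<bar> \<le> d"
    and S0: "expectation S = 0" and X0: "expectation X = 0"
  shows "expectation (\<lambda>\<omega>. (X \<omega> + S \<omega>)\<^sup>2) = expectation (\<lambda>\<omega>. (S \<omega>)\<^sup>2) + expectation (\<lambda>\<omega>. (X \<omega>)\<^sup>2)"
    and "expectation (\<lambda>\<omega>. (X \<omega> + S \<omega>) ^ 4) = expectation (\<lambda>\<omega>. S \<omega> ^ 4)
           + 6 * (expectation (\<lambda>\<omega>. (S \<omega>)\<^sup>2) * expectation (\<lambda>\<omega>. (X \<omega>)\<^sup>2)) + expectation (\<lambda>\<omega>. X \<omega> ^ 4)"
proof -
  note E = indep_var_expectation_power(1)[OF ind X S]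
  note I = indep_var_expectation_power(2)[OF ind X S]
  \<comment> \<open>Exponent 0 on one factor reduces the joint integrability to that of a single
    power.\<close>
  have SI: "integrable M (\<lambda>\<omega>. S \<omega> ^ k)" for k using I[of 0 k] by simp
  have XI: "integrable M (\<lambda>\<omega>. X \<omega> ^ k)" for k using I[of k 0] by simp
  have "(\<lambda>\<omega>. (X \<omega> + S \<omega>)\<^sup>2) = (\<lambda>\<omega>. (S \<omega>)\<^sup>2 + 2 * (X \<omega> ^ 1 * S \<omega> ^ 1) + (X \<omega>)\<^sup>2)"
    by (auto simp: power2_eq_square algebra_simps)
  then show "expectation (\<lambda>\<omega>. (X \<omega> + S \<omega>)\<^sup>2) = expectation (\<lambda>\<omega>. (S \<omega>)\<^sup>2) + expectation (\<lambda>\<omega>. (X \<omega>)\<^sup>2)"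
    using I[of 1 1] SI[of 2] XI[of 2] E[of 1 1] S0 by simp
  have "(\<lambda>\<omega>. (X \<omega> + S \<omega>) ^ 4) = (\<lambda>\<omega>. S \<omega> ^ 4 + 4 * (X \<omega> ^ 1 * S \<omega> ^ 3) + 6 * (X \<omega> ^ 2 * S \<omega> ^ 2)
          + 4 * (X \<omega> ^ 3 * S \<omega> ^ 1) + X \<omega> ^ 4)"
    by (rule ext) (simp add: power4_eq_xxxx power2_eq_square power3_eq_cube; algebra)
  then show "expectation (\<lambda>\<omega>. (X \<omega> + S \<omega>) ^ 4) = expectation (\<lambda>\<omega>. S \<omega> ^ 4)
           + 6 * (expectation (\<lambda>\<omega>. (S \<omega>)\<^sup>2) * expectation (\<lambda>\<omega>. (X \<omega>)\<^sup>2)) + expectation (\<lambda>\<omega>. X \<omega> ^ 4)"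
    using I[of 3 1] I[of 2 2] I[of 1 3] SI[of 4] XI[of 4] E[of 3 1] E[of 2 2] E[of 1 3] S0 X0
    by simp
qed

text \<open>The factor 3 is what closes the induction: with \<open>s2\<close> the old variance and
  \<open>x2\<close> the new one, the surviving cross term \<open>6 * (x2 * s2)\<close> is exactly
  the mixed term of \<open>3 * (x2 + s2)^2\<close>.\<close>

lemma (in prob_space) fourth_moment_sum_indep:
  fixes X :: "'i \<Rightarrow> 'a \<Rightarrow> real"
  assumes "finite I" and "indep_vars (\<lambda>_. borel) X I"
    and "\<And>i \<omega>. i \<in> I \<Longrightarrow> \<omega> \<in> space M \<Longrightarrow> \<bar>X i \<omega>\<bar> \<le> c i"
    and "\<And>i. i \<in> I \<Longrightarrow> expectation (X i) = 0"
  shows "expectation (\<lambda>\<omega>. (\<Sum>i\<in>I. X i \<omega>) ^ 4)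
    \<le> 3 * (\<Sum>i\<in>I. expectation (\<lambda>\<omega>. (X i \<omega>)\<^sup>2))\<^sup>2 + (\<Sum>i\<in>I. expectation (\<lambda>\<omega>. X i \<omega> ^ 4))"
proof -
  \<comment> \<open>Mean and second moment are carried along because the fourth-moment step consumes
    them.\<close>
  have "expectation (\<lambda>\<omega>. \<Sum>i\<in>I. X i \<omega>) = 0 \<and>
    expectation (\<lambda>\<omega>. (\<Sum>i\<in>I. X i \<omega>)\<^sup>2) = (\<Sum>i\<in>I. expectation (\<lambda>\<omega>. (X i \<omega>)\<^sup>2)) \<and>
    expectation (\<lambda>\<omega>. (\<Sum>i\<in>I. X i \<omega>) ^ 4)
      \<le> 3 * (\<Sum>i\<in>I. expectation (\<lambda>\<omega>. (X i \<omega>)\<^sup>2))\<^sup>2 + (\<Sum>i\<in>I. expectation (\<lambda>\<omega>. X i \<omega> ^ 4))"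
    using assms
  proof (induction I rule: finite_induct)
    case empty
    then show ?case by simp
  next
    case (insert i I)
    have sub: "indep_vars (\<lambda>_. borel) X I"
      using insert.prems(1) by (rule indep_vars_subset) auto
    define S where "S = (\<lambda>\<omega>. \<Sum>j\<in>I. X j \<omega>)"
    have IH: "expectation S = 0" "expectation (\<lambda>\<omega>. (S \<omega>)\<^sup>2) = (\<Sum>i\<in>I. expectation (\<lambda>\<omega>. (X i \<omega>)\<^sup>2))"
      "expectation (\<lambda>\<omega>. S \<omega> ^ 4)
         \<le> 3 * (\<Sum>i\<in>I. expectation (\<lambda>\<omega>. (X i \<omega>)\<^sup>2))\<^sup>2 + (\<Sum>i\<in>I. expectation (\<lambda>\<omega>. X i \<omega> ^ 4))"
      using insert.IH[OF sub] insert.prems by (auto simp: S_def)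
    have X: "\<And>\<omega>. \<omega> \<in> space M \<Longrightarrow> \<bar>X i \<omega>\<bar> \<le> c i" and X0: "expectation (X i) = 0"
      using insert.prems by auto
    have ind: "indep_var borel (X i) borel S"
      using indep_vars_sum[OF insert.hyps insert.prems(1)] unfolding S_def .
    have S: "\<bar>S \<omega>\<bar> \<le> (\<Sum>j\<in>I. c j)" if "\<omega> \<in> space M" for \<omega>
      unfolding S_def using insert.prems(2) that by (intro order.trans[OF sum_abs] sum_mono) auto
    note A = moments_add_indep[OF ind S X IH(1) X0]
    have "integrable M S" "integrable M (X i)"
      using indep_var_expectation_power(2)[OF ind X S, of 1 0] indep_var_expectation_power(2)[OF ind X S, of 0 1] by simp_all
    then have E1: "expectation (\<lambda>\<omega>. X i \<omega> + S \<omega>) = 0" using IH(1) X0 by simp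
    have eq: "(\<lambda>\<omega>. \<Sum>j\<in>insert i I. X j \<omega>) = (\<lambda>\<omega>. X i \<omega> + S \<omega>)"
      using insert.hyps by (auto simp: S_def)
    have eqk: "(\<lambda>\<omega>. (\<Sum>j\<in>insert i I. X j \<omega>) ^ k) = (\<lambda>\<omega>. (X i \<omega> + S \<omega>) ^ k)" for k :: nat
      using fun_cong[OF eq] by simp
    define s2 where "s2 = (\<Sum>i\<in>I. expectation (\<lambda>\<omega>. (X i \<omega>)\<^sup>2))"
    define x2 where "x2 = expectation (\<lambda>\<omega>. (X i \<omega>)\<^sup>2)"
    have "3 * s2\<^sup>2 + 6 * (x2 * s2) \<le> 3 * (x2 + s2)\<^sup>2"
      by (simp add: power2_eq_square algebra_simps)
    then show ?case
      unfolding eq eqk unfolding sum.insert[OF insert.hyps] using IH E1 A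
      by (simp add: mult.commute flip: s2_def x2_def)
  qed
  then show ?thesis by blast
qed

text \<open>Since \<open>Z i\<close> is bounded by 1, its second moment and hence its variance are
  at most \<open>v i\<close>; the centred variable is bounded by 2, so its fourth moment is at most
  4 times its variance. For indicators of short intervals \<open>v i\<close> is small, and this is
  the gain over the trivial bound.\<close>

lemma (in prob_space) fourth_moment_weighted_sum:
  fixes Z :: "'i \<Rightarrow> 'a \<Rightarrow> real"
  assumes "finite I" and ind: "indep_vars (\<lambda>_. borel) Z I"
    and Z: "\<And>i \<omega>. i \<in> I \<Longrightarrow> \<omega> \<in> space M \<Longrightarrow> \<bar>Z i \<omega>\<bar> \<le> 1"
    and v: "\<And>i. i \<in> I \<Longrightarrow> expectation (\<lambda>\<omega>. \<bar>Z i \<omega>\<bar>) \<le> v i"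
  shows "expectation (\<lambda>\<omega>. (\<Sum>i\<in>I. w i * (Z i \<omega> - expectation (Z i))) ^ 4)
    \<le> 3 * (\<Sum>i\<in>I. (w i)\<^sup>2 * v i)\<^sup>2 + 4 * (\<Sum>i\<in>I. w i ^ 4 * v i)"
proof -
  define X where "X i \<omega> = w i * (Z i \<omega> - expectation (Z i))" for i \<omega>
  have mZ: "Z i \<in> borel_measurable M" if "i \<in> I" for i
    using ind that by (auto simp: indep_vars_def)
  have iZ: "integrable M (Z i)" if "i \<in> I" for i
    using integrable_bounded[OF mZ Z] that by auto
  have EZ: "\<bar>expectation (Z i)\<bar> \<le> 1" if "i \<in> I" for i
  proof -
    have "\<bar>expectation (Z i)\<bar> \<le> expectation (\<lambda>\<omega>. \<bar>Z i \<omega>\<bar>)" by (rule integral_abs_bound)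
    also have "\<dots> \<le> 1" using Z iZ that by (intro integral_le_const) auto
    finally show ?thesis .
  qed
  have b: "\<bar>Z i \<omega> - expectation (Z i)\<bar> \<le> 2" if "i \<in> I" "\<omega> \<in> space M" for i \<omega>
    using Z[OF that] EZ[OF that(1)] by linarith
  have 2: "0 \<le> expectation (\<lambda>\<omega>. (X i \<omega>)\<^sup>2)" "expectation (\<lambda>\<omega>. (X i \<omega>)\<^sup>2) \<le> (w i)\<^sup>2 * v i"
    "expectation (\<lambda>\<omega>. X i \<omega> ^ 4) \<le> 4 * (w i ^ 4 * v i)"
    if i: "i \<in> I" for i
  proof -
    let ?c = "\<lambda>\<omega>. Z i \<omega> - expectation (Z i)"
    note [measurable] = mZ[OF i]
    have i1: "integrable M (\<lambda>\<omega>. \<bar>Z i \<omega>\<bar>)" using iZ[OF i] by auto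
    have i2: "integrable M (\<lambda>\<omega>. (Z i \<omega>)\<^sup>2)"
      using Z[OF i] by (intro integrable_bounded[where c = 1]) (auto simp: abs_square_le_1)
    have i3: "integrable M (\<lambda>\<omega>. (?c \<omega>)\<^sup>2)"
      using power_mono[OF b[OF i], of _ 2] by (intro integrable_bounded[where c = 4]) (auto simp: power2_abs)
    have i4: "integrable M (\<lambda>\<omega>. ?c \<omega> ^ 4)"
      using power_mono[OF b[OF i], of _ 4] by (intro integrable_bounded[where c = 16]) (auto simp: power_even_abs)
    have V: "expectation (\<lambda>\<omega>. (?c \<omega>)\<^sup>2) \<le> v i"
    proof -
      have "expectation (\<lambda>\<omega>. (?c \<omega>)\<^sup>2) = expectation (\<lambda>\<omega>. (Z i \<omega>)\<^sup>2) - (expectation (Z i))\<^sup>2"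
        using variance_eq[OF iZ[OF i] i2] .
      also have "\<dots> \<le> expectation (\<lambda>\<omega>. (Z i \<omega>)\<^sup>2)" by simp
      also have "\<dots> \<le> expectation (\<lambda>\<omega>. \<bar>Z i \<omega>\<bar>)"
      proof (intro integral_mono i1 i2)
        fix \<omega> assume "\<omega> \<in> space M"
        then show "(Z i \<omega>)\<^sup>2 \<le> \<bar>Z i \<omega>\<bar>"
          using mult_left_mono[OF Z[OF i], of \<omega> "\<bar>Z i \<omega>\<bar>"] by (simp add: power2_eq_square abs_mult[symmetric])
      qed
      finally show ?thesis using v[OF i] by linarith
    qed
    show "0 \<le> expectation (\<lambda>\<omega>. (X i \<omega>)\<^sup>2)" by (intro integral_nonneg_AE) auto
    show "expectation (\<lambda>\<omega>. (X i \<omega>)\<^sup>2) \<le> (w i)\<^sup>2 * v i"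
      unfolding X_def power_mult_distrib using V by (simp add: mult_left_mono)
    have "expectation (\<lambda>\<omega>. ?c \<omega> ^ 4) \<le> expectation (\<lambda>\<omega>. 4 * (?c \<omega>)\<^sup>2)"
    proof (intro integral_mono i4 integrable_mult_right i3)
      fix \<omega> assume "\<omega> \<in> space M"
      then have "(?c \<omega>)\<^sup>2 \<le> 4" using power_mono[OF b[OF i], of \<omega> 2] by simp
      then have "(?c \<omega>)\<^sup>2 * (?c \<omega>)\<^sup>2 \<le> 4 * (?c \<omega>)\<^sup>2" by (intro mult_right_mono) auto
      then show "?c \<omega> ^ 4 \<le> 4 * (?c \<omega>)\<^sup>2" by (simp add: power4_eq_xxxx power2_eq_square)
    qed
    also have "\<dots> \<le> 4 * v i" using V by simp
    finally show "expectation (\<lambda>\<omega>. X i \<omega> ^ 4) \<le> 4 * (w i ^ 4 * v i)"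
      unfolding X_def power_mult_distrib using mult_left_mono[of "expectation (\<lambda>\<omega>. ?c \<omega> ^ 4)" "4 * v i" "w i ^ 4"] by (simp add: mult_ac)
  qed
  have "expectation (\<lambda>\<omega>. (\<Sum>i\<in>I. X i \<omega>) ^ 4)
    \<le> 3 * (\<Sum>i\<in>I. expectation (\<lambda>\<omega>. (X i \<omega>)\<^sup>2))\<^sup>2 + (\<Sum>i\<in>I. expectation (\<lambda>\<omega>. X i \<omega> ^ 4))"
  proof (rule fourth_moment_sum_indep[OF \<open>finite I\<close>, where c = "\<lambda>i. \<bar>w i\<bar> * 2"])
    show "indep_vars (\<lambda>_. borel) X I"
      unfolding X_def by (rule indep_vars_compose2[OF ind, of "\<lambda>i z. w i * (z - expectation (Z i))"]) auto
    show "\<bar>X i \<omega>\<bar> \<le> \<bar>w i\<bar> * 2" if "i \<in> I" "\<omega> \<in> space M" for i \<omega>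
      unfolding X_def abs_mult using b[OF that] by (intro mult_left_mono) auto
    show "expectation (X i) = 0" if "i \<in> I" for i
      unfolding X_def using iZ[OF that] by (simp add: prob_space)
  qed
  also have "\<dots> \<le> 3 * (\<Sum>i\<in>I. (w i)\<^sup>2 * v i)\<^sup>2 + (\<Sum>i\<in>I. 4 * (w i ^ 4 * v i))"
    using 2 by (intro add_mono mult_left_mono power_mono sum_mono sum_nonneg) auto
  finally show ?thesis unfolding X_def by (simp add: sum_distrib_left)
qed

lemma (in prob_space) fourth_moment_tail:
  fixes S :: "'a \<Rightarrow> real"
  assumes [measurable]: "S \<in> borel_measurable M" and b: "\<And>\<omega>. \<omega> \<in> space M \<Longrightarrow> \<bar>S \<omega>\<bar> \<le> c"
    and m: "expectation (\<lambda>\<omega>. S \<omega> ^ 4) \<le> m" and t: "0 < t"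
  shows "prob {\<omega> \<in> space M. t < \<bar>S \<omega>\<bar>} \<le> m / t ^ 4"
proof -
  have "prob {\<omega> \<in> space M. t < \<bar>S \<omega>\<bar>} \<le> prob {\<omega> \<in> space M. t ^ 4 \<le> S \<omega> ^ 4}"
    using t power_mono[of t "\<bar>S _\<bar>" 4] by (intro finite_measure_mono) (auto simp: power_even_abs)
  also have "\<dots> \<le> expectation (\<lambda>\<omega>. S \<omega> ^ 4) / t ^ 4"
    using t power_mono[OF b, of _ 4]
    by (intro integral_Markov_inequality_measure[of M _ "{}"] integrable_bounded[where c = "c ^ 4"])
      (auto simp: power_abs)
  also have "\<dots> \<le> m / t ^ 4" using m t by (intro divide_right_mono) auto
  finally show ?thesis .
qed

text \<open>A point of level \<open>j + 1\<close> is either a point of level \<open>j\<close> or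
  lies one increment of level \<open>j + 1\<close> to the right of one, so each level contributes at
  most one increment on the way back to 0.\<close>

lemma dyadic_increments_bound:
  fixes P :: "nat \<Rightarrow> real" and L :: "nat \<Rightarrow> real"
  assumes inc: "\<And>j m. j \<le> J \<Longrightarrow> m < 2 ^ j \<Longrightarrow> \<bar>P ((m + 1) * 2 ^ (J - j)) - P (m * 2 ^ (J - j))\<bar> \<le> L j"
    and "j \<le> J" "m \<le> 2 ^ j"
  shows "\<bar>P (m * 2 ^ (J - j)) - P 0\<bar> \<le> (\<Sum>i\<le>j. L i)"
  using assms(2,3)
proof (induction j arbitrary: m)
  case 0
  have "0 \<le> L 0" using inc[of 0 0] by simp
  then show ?case using 0 inc[of 0 0] by (cases m) auto
next
  case (Suc j)
  have "0 \<le> L (Suc j)"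
    using inc[of "Suc j" 0] Suc.prems(1) abs_ge_zero order.trans by (metis zero_less_numeral zero_less_power)
  have pw: "(2::nat) ^ (J - j) = 2 * 2 ^ (J - Suc j)"
    using Suc.prems(1) by (metis Suc_diff_le Suc_le_eq diff_Suc_Suc power_Suc Suc_diff_Suc)
  have even: "\<bar>P (2 * l * 2 ^ (J - Suc j)) - P 0\<bar> \<le> (\<Sum>i\<le>j. L i)" if "l \<le> 2 ^ j" for l
    using Suc.IH[of l] Suc.prems that pw by (simp add: mult_ac)
  show ?case
  proof (cases "even m")
    case True
    then obtain l where "m = 2 * l" by blast
    then show ?thesis using even[of l] Suc.prems \<open>0 \<le> L (Suc j)\<close> by simp
  next
    case False
    then obtain l where l: "m = 2 * l + 1" by (metis oddE)
    then show ?thesis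
      using even[of l] Suc.prems inc[OF Suc.prems(1), of "2 * l"] by simp linarith
  qed
qed

text \<open>The maximum over all \<open>2 ^ J\<close> points costs only a constant that does not
  depend on \<open>J\<close>. The square of the relative length makes this possible: it beats the
  number \<open>2 ^ j\<close> of increments of level \<open>j\<close> and leaves a factor to pay for
  shrinking thresholds.\<close>

lemma (in prob_space) dyadic_chaining:
  fixes P :: "nat \<Rightarrow> 'a \<Rightarrow> real"
  assumes [measurable]: "\<And>a. P a \<in> borel_measurable M"
    and inc: "\<And>a b t. a < b \<Longrightarrow> b \<le> 2 ^ J \<Longrightarrow> 0 < t \<Longrightarrow>
      prob {\<omega> \<in> space M. t < \<bar>P b \<omega> - P a \<omega>\<bar>} \<le> K * (real (b - a) / 2 ^ J)\<^sup>2 / t ^ 4"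
    and K: "0 \<le> K" and L: "0 < L"
  shows "prob {\<omega> \<in> space M. \<exists>a\<le>2 ^ J. L < \<bar>P a \<omega> - P 0 \<omega>\<bar>} \<le> 30000 * K / L ^ 4"
proof -
  \<comment> \<open>The levels \<open>(7/8)\<^sup>j L/8\<close> sum to at most \<open>L\<close>, while \<open>2\<^sup>j 4\<^sup>-\<^sup>j / (7/8)\<^sup>4\<^sup>j = (2048/2401)\<^sup>j\<close> is summable.\<close>
  define l where "l j = L / 8 * (7 / 8) ^ j" for j :: nat
  define D where "D j m = {\<omega> \<in> space M. l j < \<bar>P ((m + 1) * 2 ^ (J - j)) \<omega> - P (m * 2 ^ (J - j)) \<omega>\<bar>}" for j m
  have l: "0 < l j" for j using L by (simp add: l_def)
  have [measurable]: "D j m \<in> sets M" for j m unfolding D_def by measurable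
  have "(\<Sum>i\<le>j. l i) \<le> L" for j
  proof -
    have "(\<Sum>i\<le>j. l i) = L / 8 * (\<Sum>i\<le>j. (7 / 8) ^ i)" by (simp add: l_def sum_distrib_left)
    also have "\<dots> = L * (1 - (7/8) ^ Suc j)" by (subst sum_gp0) (simp add: field_simps)
    also have "\<dots> \<le> L" using L by (simp add: algebra_simps)
    finally show ?thesis .
  qed
  note suml = this
  have sub: "{\<omega> \<in> space M. \<exists>a\<le>2 ^ J. L < \<bar>P a \<omega> - P 0 \<omega>\<bar>} \<subseteq> (\<Union>j\<le>J. \<Union>m<2 ^ j. D j m)"
  proof (rule ccontr)
    assume "\<not> ?thesis"
    then obtain \<omega> a where w: "\<omega> \<in> space M" "a \<le> 2 ^ J" "L < \<bar>P a \<omega> - P 0 \<omega>\<bar>"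
      and n: "\<And>j m. j \<le> J \<Longrightarrow> m < 2 ^ j \<Longrightarrow> \<omega> \<notin> D j m" by blast
    have "\<bar>P ((m + 1) * 2 ^ (J - j)) \<omega> - P (m * 2 ^ (J - j)) \<omega>\<bar> \<le> l j" if "j \<le> J" "m < 2 ^ j" for j m
      using n[OF that] w(1) by (simp add: D_def not_less)
    from dyadic_increments_bound[of J "\<lambda>a. P a \<omega>" l, OF this order.refl w(2)] suml[of J] w(3)
    show False by simp
  qed
  have Dj: "prob (\<Union>m<2 ^ j. D j m) \<le> 4096 * K / L ^ 4 * (2048 / 2401) ^ j" if j: "j \<le> J" for j
  proof -
    have "prob (\<Union>m<2 ^ j. D j m) \<le> (\<Sum>m<2 ^ j. prob (D j m))"
      by (intro finite_measure_subadditive_finite) auto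
    also have "\<dots> \<le> (\<Sum>m<(2::nat) ^ j. K * (1 / 2 ^ j)\<^sup>2 / l j ^ 4)"
    proof (intro sum_mono)
      fix m :: nat assume m: "m \<in> {..<2 ^ j}"
      have "(m + 1) * 2 ^ (J - j) \<le> 2 ^ j * 2 ^ (J - j)" using m by (intro mult_right_mono) auto
      then have le: "(m + 1) * 2 ^ (J - j) \<le> 2 ^ J" using j by (simp flip: power_add)
      have "real ((m + 1) * 2 ^ (J - j) - m * 2 ^ (J - j)) / 2 ^ J = 2 ^ (J - j) / 2 ^ J"
        by (simp flip: diff_mult_distrib)
      also have "\<dots> = 1 / 2 ^ j" using j by (simp add: power_diff field_simps)
      finally show "prob (D j m) \<le> K * (1 / 2 ^ j)\<^sup>2 / l j ^ 4"
        unfolding D_def using inc[of "m * 2 ^ (J - j)" "(m + 1) * 2 ^ (J - j)" "l j"] le l by simp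
    qed
    also have "\<dots> = 4096 * K / L ^ 4 * (2048 / 2401) ^ j"
    proof -
      have "((7 / 8 :: real) ^ j) ^ 4 = ((7 / 8) ^ 4) ^ j"
        by (simp only: power_mult[symmetric] mult.commute)
      also have "(7 / 8 :: real) ^ 4 = 1 / (2 * (2048 / 2401))" by (simp add: power_divide)
      also have "(1 / (2 * (2048 / 2401)) :: real) ^ j = 1 / (2 * (2048 / 2401)) ^ j" by (simp only: power_divide power_one)
      also have "\<dots> = 1 / (2 ^ j * (2048 / 2401) ^ j)" by (simp only: power_mult_distrib)
      finally show ?thesis
        unfolding l_def using L by (simp add: power_mult_distrib power_divide field_simps power2_eq_square)
    qed
    finally show ?thesis .
  qed
  have "prob {\<omega> \<in> space M. \<exists>a\<le>2 ^ J. L < \<bar>P a \<omega> - P 0 \<omega>\<bar>} \<le> prob (\<Union>j\<le>J. \<Union>m<2 ^ j. D j m)"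
    using sub by (intro finite_measure_mono) auto
  also have "\<dots> \<le> (\<Sum>j\<le>J. prob (\<Union>m<2 ^ j. D j m))"
    by (intro finite_measure_subadditive_finite) auto
  also have "\<dots> \<le> (\<Sum>j\<le>J. 4096 * K / L ^ 4 * (2048 / 2401) ^ j)"
    using Dj by (intro sum_mono) auto
  also have "\<dots> = 4096 * K / L ^ 4 * (\<Sum>j\<le>J. (2048 / 2401) ^ j)" by (simp add: sum_distrib_left)
  \<comment> \<open>The geometric series is at most \<open>2401 / 353 < 7\<close>, and 4096 is
    \<open>8 ^ 4\<close> from the thresholds \<open>L / 8\<close>. The product 28672 is rounded up
    to 30000.\<close>
  also have "\<dots> \<le> 4096 * K / L ^ 4 * 7"
  proof (intro mult_left_mono)
    have *: "(1 - p) / (1 - 2048 / 2401) \<le> 7" if "0 \<le> p" for p :: real using that by simp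
    show "(\<Sum>j\<le>J. (2048 / 2401) ^ j) \<le> (7::real)"
      unfolding sum_gp0 using *[of "(2048 / 2401) ^ Suc J"] by (simp del: power_Suc)
  qed (use K L in auto)
  also have "\<dots> \<le> 30000 * K / L ^ 4" using K L by (simp add: divide_right_mono)
  finally show ?thesis .
qed

subsection \<open>Linear expansions, order statistics and ranks\<close>

text \<open>A selection between the left and right limits of the step functions, which is how ties and
  subgradients at kinks are accommodated.\<close>

definition bracket :: "nat \<Rightarrow> (nat \<Rightarrow> real) \<Rightarrow> (nat \<Rightarrow> real) \<Rightarrow> (nat \<Rightarrow> real) \<Rightarrow> bool" where
  "bracket n e s a \<longleftrightarrow> (\<forall>i\<in>{1..n}. of_bool (e i < s i) \<le> a i \<and> a i \<le> of_bool (e i \<le> s i))"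

text \<open>The expansion for one fixed sample: \<alpha> and \<phi> stand for \<open>F t\<close> and
  \<open>f t\<close>, and \<open>T\<close> depends neither on \<theta> nor on \<open>a\<close>.
  Quantifying over every bracket lets the same statement serve indicators, subgradients at kinks and
  selections by rank.\<close>

definition linear_at ::
    "nat \<Rightarrow> (nat \<Rightarrow> 'a::real_inner) \<Rightarrow> (nat \<Rightarrow> real) \<Rightarrow> real \<Rightarrow> real \<Rightarrow> real \<Rightarrow> 'a \<Rightarrow> real \<Rightarrow> real \<Rightarrow> bool" where
  "linear_at n d e \<alpha> \<phi> t T C \<tau> \<longleftrightarrow>
     (\<forall>\<theta> a. norm \<theta> \<le> C \<longrightarrow> bracket n e (\<lambda>i. t + d i \<bullet> \<theta> / sqrt n) a \<longrightarrow>
       norm ((1 / sqrt n) *\<^sub>R (\<Sum>i=1..n. (a i - \<alpha>) *\<^sub>R d i) - T - (\<phi> / n) *\<^sub>R (\<Sum>i=1..n. (d i \<bullet> \<theta>) *\<^sub>R d i)) \<le> \<tau>)"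

lemma linear_atD:
  assumes "linear_at n d e \<alpha> \<phi> t T C \<tau>" "norm \<theta> \<le> C" "bracket n e (\<lambda>i. t + d i \<bullet> \<theta> / sqrt n) a" "norm u \<le> 1"
  shows "\<bar>(\<Sum>i=1..n. (a i - \<alpha>) * (d i \<bullet> u)) / sqrt n - T \<bullet> u - \<phi> / n * (\<Sum>i=1..n. (d i \<bullet> \<theta>) * (d i \<bullet> u))\<bar> \<le> \<tau>"
proof -
  let ?v = "(1 / sqrt n) *\<^sub>R (\<Sum>i=1..n. (a i - \<alpha>) *\<^sub>R d i) - T - (\<phi> / n) *\<^sub>R (\<Sum>i=1..n. (d i \<bullet> \<theta>) *\<^sub>R d i)"
  have "\<bar>?v \<bullet> u\<bar> \<le> norm ?v * norm u" by (rule Cauchy_Schwarz_ineq2)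
  also have "\<dots> \<le> norm ?v * 1" using assms(4) by (intro mult_left_mono) auto
  also have "\<dots> \<le> \<tau>" using assms(1-3) by (simp add: linear_at_def)
  finally show ?thesis by (simp add: inner_diff_left inner_sum_left)
qed

lemma bracket_le: "bracket n e s (\<lambda>i. of_bool (e i \<le> s i))"
  by (auto simp: bracket_def)

section \<open>Order statistics and ranks expressed by counts\<close>

lemma sorted_nth_le_iff:
  fixes xs :: "'a::linorder list"
  assumes "sorted xs" "k < length xs"
  shows "xs ! k \<le> y \<longleftrightarrow> k < length (filter (\<lambda>v. v \<le> y) xs)"
  using assms
proof (induction xs arbitrary: k)
  case (Cons x xs)
  show ?case
  proof (cases "x \<le> y")
    case True
    then show ?thesis using Cons by (cases k) auto
  next
    case False
    then have "\<forall>v\<in>set (x # xs). \<not> v \<le> y" using Cons.prems(1) by auto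
    then have "filter (\<lambda>v. v \<le> y) (x # xs) = []" "\<not> (x # xs) ! k \<le> y"
      using Cons.prems(2) nth_mem[of k "x # xs"] by (auto simp: filter_empty_conv)
    then show ?thesis by simp
  qed
qed simp

text \<open>This duality turns order statistics into counts below a threshold, that is, into sums of
  the indicators which the expansion controls.\<close>

lemma order_stat_le_iff:
  assumes "1 \<le> k" "k \<le> n"
  shows "order_stat n z k \<le> y \<longleftrightarrow> k \<le> card {i\<in>{1..n}. z i \<le> y}"
proof -
  have "length (filter (\<lambda>v. v \<le> y) (sort (map z [1..<Suc n]))) = length (filter (\<lambda>i. z i \<le> y) [1..<Suc n])"
    by (simp add: filter_sort filter_map comp_def)
  also have "\<dots> = card {i\<in>{1..n}. z i \<le> y}"
    by (subst distinct_card[symmetric]) (auto intro!: arg_cong[where f = card])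
  finally show ?thesis
    unfolding order_stat_def using assms by (subst sorted_nth_le_iff) auto
qed

lemma card_eq_sum_of_bool: "finite A \<Longrightarrow> real (card {i\<in>A. P i}) = (\<Sum>i\<in>A. of_bool (P i))"
  by (simp add: sum.inter_filter[symmetric] of_bool_def)

lemma order_stat_shift: "1 \<le> k \<Longrightarrow> k \<le> n \<Longrightarrow> order_stat n (\<lambda>i. z i + c) k = order_stat n z k + c"
proof (rule antisym)
  assume k: "1 \<le> k" "k \<le> n"
  have 1: "order_stat n z k + c \<le> y \<longleftrightarrow> order_stat n (\<lambda>i. z i + c) k \<le> y" for y
  proof -
    have "order_stat n z k + c \<le> y \<longleftrightarrow> order_stat n z k \<le> y - c" by linarith
    also have "\<dots> \<longleftrightarrow> k \<le> card {i\<in>{1..n}. z i \<le> y - c}" by (rule order_stat_le_iff[OF k])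
    also have "\<dots> \<longleftrightarrow> k \<le> card {i\<in>{1..n}. z i + c \<le> y}" by (simp only: le_diff_eq)
    also have "\<dots> \<longleftrightarrow> order_stat n (\<lambda>i. z i + c) k \<le> y" by (rule order_stat_le_iff[OF k, symmetric])
    finally show ?thesis .
  qed
  show "order_stat n (\<lambda>i. z i + c) k \<le> order_stat n z k + c" using 1[of "order_stat n z k + c"] by simp
  show "order_stat n z k + c \<le> order_stat n (\<lambda>i. z i + c) k" using 1[of "order_stat n (\<lambda>i. z i + c) k"] by simp
qed

lemma order_stat_cong: "(\<And>i. i \<in> {1..n} \<Longrightarrow> z i = z' i) \<Longrightarrow> order_stat n z k = order_stat n z' k"
  unfolding order_stat_def by (intro arg_cong[where f = "\<lambda>l. sort l ! (k - 1)"] map_cong) auto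

text \<open>The rank of \<open>i\<close> is the size of the initial segment at \<open>i\<close> in
  the lexicographic order of value and index. Such segments are nested, so equal sizes force equal
  segments and hence equal indices.\<close>

lemma bij_betw_sample_rank: "bij_betw (sample_rank n z) {1..n} {1..n}"
proof -
  define below where "below i = {j\<in>{1..n}. z j < z i \<or> z j = z i \<and> j \<le> i}" for i
  have rank: "sample_rank n z i = card (below i)" if "i \<in> {1..n}" for i
  proof -
    have "below i = {j\<in>{1..n}. z j < z i} \<union> {j\<in>{1..i}. z j = z i}"
      using that by (auto simp: below_def)
    then show ?thesis unfolding sample_rank_def by (subst card_Un_disjoint[symmetric]) auto
  qed
  have fin: "finite (below i)" for i by (simp add: below_def)
  have inj: "inj_on (sample_rank n z) {1..n}"
  proof (rule inj_onI)
    fix i j assume ij: "i \<in> {1..n}" "j \<in> {1..n}" and eq: "sample_rank n z i = sample_rank n z j"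
    have *: "below i \<subseteq> below j \<or> below j \<subseteq> below i" by (auto simp: below_def)
    have "card (below i) = card (below j)" using rank ij eq by simp
    then have "below i = below j" using * fin by (metis card_subset_eq)
    moreover have "i \<in> below i" "j \<in> below j" using ij by (auto simp: below_def)
    ultimately have "i \<in> below j" "j \<in> below i" by blast+
    then show "i = j" by (auto simp: below_def)
  qed
  have "sample_rank n z i \<in> {1..n}" if "i \<in> {1..n}" for i
  proof -
    have "i \<in> below i" "below i \<subseteq> {1..n}" using that by (auto simp: below_def)
    then have "0 < card (below i)" "card (below i) \<le> card {1..n}"
      using fin[of i] by (auto simp only: card_gt_0_iff intro!: card_mono)
    then show ?thesis using rank[OF that] by simp
  qed
  then have "sample_rank n z ` {1..n} = {1..n}"
    using inj by (intro endo_inj_surj) auto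
  with inj show ?thesis by (simp add: bij_betw_def)
qed

text \<open>The two implications together say that selecting the indices of rank at most
  \<open>k\<close> is a bracket at the \<open>k\<close>-th order statistic, whatever the
  ties.\<close>

lemma sample_rank_order_stat:
  assumes "1 \<le> k" "k \<le> n" "i \<in> {1..n}"
  shows "z i < order_stat n z k \<Longrightarrow> sample_rank n z i \<le> k"
    and "sample_rank n z i \<le> k \<Longrightarrow> z i \<le> order_stat n z k"
proof -
  assume "z i < order_stat n z k"
  then have "card {j\<in>{1..n}. z j \<le> z i} < k"
    using order_stat_le_iff[OF assms(1,2), of z "z i"] by simp
  moreover have "sample_rank n z i \<le> card {j\<in>{1..n}. z j \<le> z i}"
    unfolding sample_rank_def using assms(3)
    by (subst card_Un_disjoint[symmetric]) (auto intro!: card_mono)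
  ultimately show "sample_rank n z i \<le> k" by simp
next
  assume r: "sample_rank n z i \<le> k"
  show "z i \<le> order_stat n z k"
  proof (rule ccontr)
    assume "\<not> ?thesis"
    then have "card {j\<in>{1..n}. z j \<le> order_stat n z k} \<le> card {j\<in>{1..n}. z j < z i}"
      by (intro card_mono) auto
    moreover have "k \<le> card {j\<in>{1..n}. z j \<le> order_stat n z k}"
      using order_stat_le_iff[OF assms(1,2), of z] by blast
    moreover have "1 \<le> card {j\<in>{1..i}. z j = z i}"
      using assms(3) card_mono[of "{j\<in>{1..i}. z j = z i}" "{i}"] by simp
    ultimately show False using r unfolding sample_rank_def by linarith
  qed
qed

lemma card_sample_rank_le:
  assumes "k \<le> n"
  shows "card {i\<in>{1..n}. sample_rank n z i \<le> k} = k"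
proof -
  have b: "bij_betw (sample_rank n z) {1..n} {1..n}" by (rule bij_betw_sample_rank)
  have "bij_betw (sample_rank n z) {i\<in>{1..n}. sample_rank n z i \<le> k} {1..k}"
    unfolding bij_betw_def
  proof
    show "inj_on (sample_rank n z) {i\<in>{1..n}. sample_rank n z i \<le> k}"
      using b by (rule inj_on_subset[OF bij_betw_imp_inj_on]) auto
    show "sample_rank n z ` {i\<in>{1..n}. sample_rank n z i \<le> k} = {1..k}"
    proof -
      have im: "sample_rank n z ` {1..n} = {1..n}" using b by (rule bij_betw_imp_surj_on)
      have "sample_rank n z ` {i\<in>{1..n}. sample_rank n z i \<le> k} = sample_rank n z ` {1..n} \<inter> {..k}" by blast
      also have "\<dots> = {1..k}" unfolding im using assms by auto
      finally show ?thesis .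
    qed
  qed
  from bij_betw_same_card[OF this] show ?thesis by simp
qed

subsection \<open>Order statistics of shifted samples\<close>

lemma count_linear:
  fixes c :: "nat \<Rightarrow> 'a::euclidean_space"
  assumes lin: "linear_at n (\<lambda>i. (1::real, c i)) e \<alpha> \<phi> t T C \<tau>" and c: "(\<Sum>i=1..n. c i) = 0" and n: "1 \<le> n"
    and \<theta>: "\<bar>\<theta>\<bar> + norm \<delta> \<le> C" and a: "bracket n e (\<lambda>i. t + (\<theta> + c i \<bullet> \<delta>) / sqrt n) a"
  shows "\<bar>((\<Sum>i=1..n. a i) - n * \<alpha>) / sqrt n - fst T - \<phi> * \<theta>\<bar> \<le> \<tau>"
proof -
  have "norm (\<theta>, \<delta>) \<le> C"
    using norm_triangle_ineq[of "(\<theta>, 0)" "(0, \<delta>)"] \<theta> by simp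
  then have "\<bar>(\<Sum>i=1..n. (a i - \<alpha>) * ((1::real, c i) \<bullet> (1, 0))) / sqrt n - T \<bullet> (1, 0)
    - \<phi> / n * (\<Sum>i=1..n. ((1::real, c i) \<bullet> (\<theta>, \<delta>)) * ((1::real, c i) \<bullet> (1, 0)))\<bar> \<le> \<tau>"
    using linear_atD[OF lin, of "(\<theta>, \<delta>)" a "(1, 0)"] a by (simp add: inner_real_def)
  moreover have "(\<Sum>i=1..n. c i \<bullet> \<delta>) = 0" using c by (simp flip: inner_sum_left)
  ultimately show ?thesis
    using n by (simp add: inner_prod_def inner_real_def sum_subtractf sum.distrib)
qed

text \<open>The expansion is tested against \<open>(0, u)\<close>. Centring of the design removes
  the constant \<alpha> and the intercept. Only a lower bound is kept, since the purpose is a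
  positive directional derivative.\<close>

lemma slope_linear:
  fixes c :: "nat \<Rightarrow> 'a::euclidean_space"
  assumes lin: "linear_at n (\<lambda>i. (1::real, c i)) e \<alpha> \<phi> t T C \<tau>" and c: "(\<Sum>i=1..n. c i) = 0"
    and \<theta>: "\<bar>\<theta>\<bar> + norm \<delta> \<le> C" and a: "bracket n e (\<lambda>i. t + (\<theta> + c i \<bullet> \<delta>) / sqrt n) a" and u: "norm u = 1"
  shows "- norm T - \<tau> + \<phi> / n * (\<Sum>i=1..n. (c i \<bullet> \<delta>) * (c i \<bullet> u)) \<le> (\<Sum>i=1..n. a i * (c i \<bullet> u)) / sqrt n"
proof -
  have "norm (\<theta>, \<delta>) \<le> C"
    using norm_triangle_ineq[of "(\<theta>, 0)" "(0, \<delta>)"] \<theta> by simp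
  then have "\<bar>(\<Sum>i=1..n. (a i - \<alpha>) * ((1::real, c i) \<bullet> (0, u))) / sqrt n - T \<bullet> (0, u)
    - \<phi> / n * (\<Sum>i=1..n. ((1::real, c i) \<bullet> (\<theta>, \<delta>)) * ((1::real, c i) \<bullet> (0, u)))\<bar> \<le> \<tau>"
    using linear_atD[OF lin, of "(\<theta>, \<delta>)" a "(0, u)"] a u by (simp add: inner_real_def)
  moreover have "(\<Sum>i=1..n. x * (c i \<bullet> u)) = 0" for x
    using c by (simp flip: inner_sum_left sum_distrib_left)
  moreover have "\<bar>T \<bullet> (0, u)\<bar> \<le> norm T"
    using Cauchy_Schwarz_ineq2[of T "(0, u)"] u by simp
  ultimately show ?thesis
    by (simp add: inner_prod_def sum_subtractf sum.distrib algebra_simps)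
qed

text \<open>The expansion of the count is inverted. At the local intercept
  \<open>(2 * \<tau> - fst T) / \<phi>\<close> the count exceeds \<open>n * \<alpha>\<close> by at
  least \<open>\<tau> * sqrt n > 1\<close>, at \<open>(- 2 * \<tau> - fst T) / \<phi>\<close> it
  falls short by as much, and rounding keeps \<open>k\<close> within 1 of
  \<open>n * \<alpha>\<close>; so the order statistic is caught between the two. The bound does not
  involve \<delta>, and this is why different slopes give nearly the same order statistic.\<close>

lemma order_stat_linear:
  fixes c :: "nat \<Rightarrow> 'a::euclidean_space"
  assumes lin: "linear_at n (\<lambda>i. (1::real, c i)) e \<alpha> \<phi> t T C \<tau>" and c: "(\<Sum>i=1..n. c i) = 0"
    and k: "1 \<le> k" "k \<le> n" "\<bar>k - n * \<alpha>\<bar> \<le> 1"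
    and \<phi>: "0 < \<phi>" and \<tau>: "1 < \<tau> * sqrt n"
    and C: "(norm T + 2 * \<tau>) / \<phi> + norm \<delta> \<le> C"
  shows "\<bar>fst T + \<phi> * (sqrt n * (order_stat n (\<lambda>i. e i - c i \<bullet> \<delta> / sqrt n) k - t))\<bar> \<le> 2 * \<tau>"
proof -
  define r where "r = order_stat n (\<lambda>i. e i - c i \<bullet> \<delta> / sqrt n) k"
  define N where "N \<theta> = real (card {i\<in>{1..n}. e i - c i \<bullet> \<delta> / sqrt n \<le> t + \<theta> / sqrt n})" for \<theta>
  have n: "1 \<le> n" "0 < sqrt n" using k by auto
  have "0 < \<tau>" using \<tau> n by (smt (verit) mult_nonpos_nonneg)
  have r: "r \<le> t + \<theta> / sqrt n \<longleftrightarrow> k \<le> N \<theta>" for \<theta>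
    unfolding r_def N_def using order_stat_le_iff[OF k(1,2)] by simp
  have N: "\<bar>(N \<theta> - n * \<alpha>) / sqrt n - fst T - \<phi> * \<theta>\<bar> \<le> \<tau>" if "\<bar>\<theta>\<bar> \<le> (norm T + 2 * \<tau>) / \<phi>" for \<theta>
  proof -
    have "N \<theta> = (\<Sum>i=1..n. of_bool (e i \<le> t + (\<theta> + c i \<bullet> \<delta>) / sqrt n))"
      unfolding N_def by (subst card_eq_sum_of_bool) (auto simp: diff_le_eq add_divide_distrib algebra_simps)
    then show ?thesis
      using count_linear[OF lin c n(1) _ bracket_le, of \<theta> \<delta>] that C by simp
  qed
  have T: "\<bar>fst T\<bar> \<le> norm T" using norm_fst_le[of "fst T" "snd T"] by simp
  have "r \<le> t + ((2 * \<tau> - fst T) / \<phi>) / sqrt n"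
  proof -
    have "\<bar>(2 * \<tau> - fst T) / \<phi>\<bar> \<le> (norm T + 2 * \<tau>) / \<phi>"
      using \<phi> \<open>0 < \<tau>\<close> T by (simp add: abs_divide divide_right_mono)
    from N[OF this] \<phi> have "\<tau> \<le> (N ((2 * \<tau> - fst T) / \<phi>) - n * \<alpha>) / sqrt n" by simp
    then have "\<tau> * sqrt n \<le> N ((2 * \<tau> - fst T) / \<phi>) - n * \<alpha>" using n by (simp add: pos_le_divide_eq)
    then show ?thesis unfolding r using k(3) \<tau> by linarith
  qed
  then have 1: "\<phi> * (sqrt n * (r - t)) \<le> 2 * \<tau> - fst T"
    using n \<phi> by (simp add: field_simps)
  have "\<not> r \<le> t + ((- 2 * \<tau> - fst T) / \<phi>) / sqrt n"
  proof -
    have "\<bar>(- 2 * \<tau> - fst T) / \<phi>\<bar> \<le> (norm T + 2 * \<tau>) / \<phi>"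
      using \<phi> \<open>0 < \<tau>\<close> T by (simp add: abs_divide divide_right_mono)
    from abs_le_D1[OF N[OF this]] \<phi> have "(N ((- 2 * \<tau> - fst T) / \<phi>) - n * \<alpha>) / sqrt n \<le> - \<tau>" by simp
    then have "N ((- 2 * \<tau> - fst T) / \<phi>) - n * \<alpha> \<le> - \<tau> * sqrt n" using n by (simp add: pos_divide_le_eq)
    then show ?thesis unfolding r using k(3) \<tau> by linarith
  qed
  then have 2: "- 2 * \<tau> - fst T \<le> \<phi> * (sqrt n * (r - t))"
    using n \<phi> by (simp add: field_simps)
  show ?thesis using 1 2 unfolding r_def[symmetric] by linarith
qed

subsection \<open>Regression quantiles\<close>

definition check_loss :: "real \<Rightarrow> real \<Rightarrow> real" where
  "check_loss \<alpha> r = \<alpha> * max r 0 + (1 - \<alpha>) * max (- r) 0"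

text \<open>The objective of the regression quantile in coordinates centred at the true slope and at
  the error quantile \<open>t\<close>, and magnified by \<open>sqrt n\<close>.\<close>

definition local_loss ::
    "nat \<Rightarrow> (nat \<Rightarrow> 'a::real_inner) \<Rightarrow> (nat \<Rightarrow> real) \<Rightarrow> real \<Rightarrow> real \<Rightarrow> 'a \<Rightarrow> real" where
  "local_loss n d e \<alpha> t \<theta> = (\<Sum>i=1..n. check_loss \<alpha> (e i - (t + d i \<bullet> \<theta> / sqrt n)))"

text \<open>The loss is the maximum of the lines through 0 with slopes \<alpha> and
  \<open>\<alpha> - 1\<close>. Away from 0 one of them is active; at 0 the slope
  \<open>\<alpha> - a\<close> is their convex combination with weights \<open>1 - a\<close> and
  \<open>a\<close>.\<close>

lemma check_loss_subgradient:
  assumes "of_bool (x < 0) \<le> a" "a \<le> of_bool (x \<le> 0)" "0 \<le> \<alpha>" "\<alpha> \<le> 1"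
  shows "check_loss \<alpha> x + (\<alpha> - a) * (y - x) \<le> check_loss \<alpha> y"
proof -
  have *: "\<alpha> * y \<le> check_loss \<alpha> y" "(\<alpha> - 1) * y \<le> check_loss \<alpha> y"
    using assms(3,4) mult_nonneg_nonpos[of "1 - \<alpha>" y] mult_nonneg_nonneg[of "1 - \<alpha>" y]
      mult_nonneg_nonpos[of \<alpha> y] mult_nonneg_nonneg[of \<alpha> y]
    by (auto simp: check_loss_def max_def algebra_simps)
  consider "x < 0" "a = 1" | "x > 0" "a = 0" | "x = 0" "0 \<le> a" "a \<le> 1"
    using assms(1,2) by (cases "x < 0"; cases "x = 0") auto
  then show ?thesis
  proof cases
    case 1
    then show ?thesis using * by (simp add: check_loss_def algebra_simps)
  next
    case 2
    then show ?thesis using * by (simp add: check_loss_def algebra_simps)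
  next
    case 3
    have "(\<alpha> - a) * y = (1 - a) * (\<alpha> * y) + a * ((\<alpha> - 1) * y)" by (simp add: algebra_simps)
    also have "\<dots> \<le> (1 - a) * check_loss \<alpha> y + a * check_loss \<alpha> y"
      using 3 * by (intro add_mono mult_left_mono) auto
    also have "\<dots> = check_loss \<alpha> y" by (simp add: algebra_simps)
    finally show ?thesis using 3 by (simp add: check_loss_def)
  qed
qed

lemma local_loss_subgradient:
  assumes "bracket n e (\<lambda>i. t + d i \<bullet> \<theta> / sqrt n) a" "0 \<le> \<alpha>" "\<alpha> \<le> 1"
  shows "local_loss n d e \<alpha> t \<theta> + (\<Sum>i=1..n. (a i - \<alpha>) * (d i \<bullet> (\<theta>' - \<theta>))) / sqrt n \<le> local_loss n d e \<alpha> t \<theta>'"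
  unfolding local_loss_def sum_divide_distrib sum.distrib[symmetric]
proof (intro sum_mono)
  fix i assume i: "i \<in> {1..n}"
  have "(a i - \<alpha>) * (d i \<bullet> (\<theta>' - \<theta>)) / sqrt n
    = (\<alpha> - a i) * ((e i - (t + d i \<bullet> \<theta>' / sqrt n)) - (e i - (t + d i \<bullet> \<theta> / sqrt n)))"
    by (simp add: inner_diff_right diff_divide_distrib left_diff_distrib right_diff_distrib)
  then show "check_loss \<alpha> (e i - (t + d i \<bullet> \<theta> / sqrt n)) + (a i - \<alpha>) * (d i \<bullet> (\<theta>' - \<theta>)) / sqrt n
    \<le> check_loss \<alpha> (e i - (t + d i \<bullet> \<theta>' / sqrt n))"
    using check_loss_subgradient[OF _ _ assms(2,3), of "e i - (t + d i \<bullet> \<theta> / sqrt n)" "a i" "e i - (t + d i \<bullet> \<theta>' / sqrt n)"]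
      assms(1) i by (simp add: bracket_def)
qed

lemma local_loss_minimizer_bounded:
  fixes c :: "nat \<Rightarrow> 'a::euclidean_space"
  assumes lin: "linear_at n (\<lambda>i. (1::real, c i)) e \<alpha> \<phi> t T C' \<tau>" and c: "(\<Sum>i=1..n. c i) = 0" and n: "1 \<le> n"
    and \<alpha>: "0 \<le> \<alpha>" "\<alpha> \<le> 1" and \<phi>: "0 < \<phi>" and q: "q \<le> 1"
    and Q: "\<And>v. n * q * (norm v)\<^sup>2 \<le> (\<Sum>i=1..n. (c i \<bullet> v)\<^sup>2)"
    and C: "0 < C" "C \<le> C'" "norm T + \<tau> < \<phi> * C * q"
    and min: "\<And>\<theta>'. local_loss n (\<lambda>i. (1::real, c i)) e \<alpha> t \<theta> \<le> local_loss n (\<lambda>i. (1::real, c i)) e \<alpha> t \<theta>'"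
  shows "norm \<theta> \<le> C"
proof (rule ccontr)
  assume "\<not> norm \<theta> \<le> C"
  then have big: "C < norm \<theta>" by simp
  let ?d = "\<lambda>i. (1::real, c i) :: real \<times> 'a"
  define u where "u = \<theta> /\<^sub>R norm \<theta>"
  have u: "norm u = 1" and \<theta>u: "\<theta> = norm \<theta> *\<^sub>R u" using order.strict_trans[OF C(1) big] by (auto simp: u_def)
  define a where "a i = (of_bool (e i \<le> t + ?d i \<bullet> (C *\<^sub>R u) / sqrt n) :: real)" for i
  have a: "bracket n e (\<lambda>i. t + ?d i \<bullet> (C *\<^sub>R u) / sqrt n) a"
    unfolding a_def by (rule bracket_le)
  define s where "s = (\<Sum>i=1..n. (a i - \<alpha>) * (?d i \<bullet> u)) / sqrt n"
  have "\<bar>s - T \<bullet> u - \<phi> / n * (\<Sum>i=1..n. (?d i \<bullet> (C *\<^sub>R u)) * (?d i \<bullet> u))\<bar> \<le> \<tau>"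
    unfolding s_def using linear_atD[OF lin, of "C *\<^sub>R u" a u] a u C by simp
  moreover have "\<bar>T \<bullet> u\<bar> \<le> norm T" using Cauchy_Schwarz_ineq2[of T u] u by simp
  \<comment> \<open>The quadratic form splits into an intercept part and a slope part, because the
    cross term contains the sum of the \<open>c i\<close>. The condition \<open>q \<le> 1\<close>
    takes care of the intercept part.\<close>
  moreover have "\<phi> * C * q \<le> \<phi> / n * (\<Sum>i=1..n. (?d i \<bullet> (C *\<^sub>R u)) * (?d i \<bullet> u))"
  proof -
    have "(norm u)\<^sup>2 = (fst u)\<^sup>2 + (norm (snd u))\<^sup>2" by (simp add: norm_prod_def)
    then have "n * q = n * (q * (fst u)\<^sup>2) + n * q * (norm (snd u))\<^sup>2" using u by (simp add: algebra_simps flip: distrib_left)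
    also have "\<dots> \<le> n * (1 * (fst u)\<^sup>2) + (\<Sum>i=1..n. (c i \<bullet> snd u)\<^sup>2)"
      using q Q by (intro add_mono mult_left_mono mult_right_mono) auto
    also have "\<dots> = (\<Sum>i=1..n. (fst u + c i \<bullet> snd u)\<^sup>2)"
    proof -
      have "(\<Sum>i=1..n. (fst u + c i \<bullet> snd u)\<^sup>2)
        = n * (fst u)\<^sup>2 + (\<Sum>i=1..n. (c i \<bullet> snd u)\<^sup>2) + 2 * fst u * ((\<Sum>i=1..n. c i) \<bullet> snd u)"
        by (simp add: power2_sum sum.distrib inner_sum_left sum_distrib_left)
      then show ?thesis using c by simp
    qed
    finally have "n * q \<le> (\<Sum>i=1..n. (?d i \<bullet> u)\<^sup>2)" by (simp add: inner_prod_def)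
    then have "\<phi> / n * (C * (n * q)) \<le> \<phi> / n * (C * (\<Sum>i=1..n. (?d i \<bullet> u)\<^sup>2))"
      using \<phi> C by (intro mult_left_mono) auto
    then show ?thesis using n by (simp add: power2_eq_square sum_distrib_left mult_ac)
  qed
  ultimately have "0 < s" using C by linarith
  \<comment> \<open>The supporting line at the sphere point \<open>C *\<^sub>R u\<close> rises at
    rate \<open>s > 0\<close> in the outward direction, so the loss at \<theta>, further out on the
    same ray, is strictly larger.\<close>
  have "local_loss n ?d e \<alpha> t (C *\<^sub>R u) + (\<Sum>i=1..n. (a i - \<alpha>) * (?d i \<bullet> (\<theta> - C *\<^sub>R u))) / sqrt n
    \<le> local_loss n ?d e \<alpha> t \<theta>"
    by (rule local_loss_subgradient[OF a \<alpha>])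
  moreover have "(\<Sum>i=1..n. (a i - \<alpha>) * (?d i \<bullet> (\<theta> - C *\<^sub>R u))) / sqrt n = (norm \<theta> - C) * s"
  proof -
    have "\<theta> - C *\<^sub>R u = (norm \<theta> - C) *\<^sub>R u" using \<theta>u by (metis scaleR_left_diff_distrib)
    then show ?thesis
      unfolding s_def by (simp only: inner_scaleR_right) (simp add: sum_distrib_left mult_ac)
  qed
  ultimately have "(norm \<theta> - C) * s \<le> 0" using min[of "C *\<^sub>R u"] by linarith
  then show False using \<open>0 < s\<close> big by (simp add: mult_le_0_iff)
qed

text \<open>Instead of exhibiting a bracket with vanishing gradient at the minimizer, the intercept
  gradient is evaluated at intercepts shifted by \<open>h\<close> and \<open>- h\<close>, where
  minimality determines its sign. The shift is small enough to cost at most \<tau> in the linear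
  term, and at most 1 so that the parameter stays within the radius \<open>C\<close>.\<close>

lemma local_loss_intercept:
  fixes c :: "nat \<Rightarrow> 'a::euclidean_space"
  assumes lin: "linear_at n (\<lambda>i. (1::real, c i)) e \<alpha> \<phi> t T C \<tau>" and c: "(\<Sum>i=1..n. c i) = 0" and n: "1 \<le> n"
    and \<alpha>: "0 \<le> \<alpha>" "\<alpha> \<le> 1" and \<phi>: "0 < \<phi>" and \<tau>: "0 < \<tau>"
    and C: "\<bar>fst \<theta>\<bar> + norm (snd \<theta>) + 1 \<le> C"
    and min: "\<And>\<theta>'. local_loss n (\<lambda>i. (1::real, c i)) e \<alpha> t \<theta> \<le> local_loss n (\<lambda>i. (1::real, c i)) e \<alpha> t \<theta>'"
  shows "\<bar>fst T + \<phi> * fst \<theta>\<bar> \<le> 2 * \<tau>"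
proof -
  let ?d = "\<lambda>i. (1::real, c i) :: real \<times> 'a"
  define h where "h = min 1 (\<tau> / \<phi>)"
  have h: "0 < h" "h \<le> 1" "\<phi> * h \<le> \<tau>"
    using \<phi> \<tau> by (auto simp: h_def min_def field_simps)
  define a where "a g i = (of_bool (e i \<le> t + ((fst \<theta> + g) + c i \<bullet> snd \<theta>) / sqrt n) :: real)" for g i
  have 1: "g * ((\<Sum>i=1..n. a g i) - n * \<alpha>) \<ge> 0" for g
  proof -
    have "bracket n e (\<lambda>i. t + ?d i \<bullet> (\<theta> + (g, 0)) / sqrt n) (a g)"
      unfolding a_def using bracket_le[of n e "\<lambda>i. t + ?d i \<bullet> (\<theta> + (g, 0)) / sqrt n"]
      by (simp add: inner_prod_def algebra_simps)
    from local_loss_subgradient[OF this \<alpha>, of \<theta>] min[of "\<theta> + (g, 0)"]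
    have "(\<Sum>i=1..n. (a g i - \<alpha>) * (?d i \<bullet> (\<theta> - (\<theta> + (g, 0))))) / sqrt n \<le> 0" by linarith
    moreover have "(\<Sum>i=1..n. (a g i - \<alpha>) * (?d i \<bullet> (\<theta> - (\<theta> + (g, 0))))) = - (g * ((\<Sum>i=1..n. a g i) - n * \<alpha>))"
      by (simp add: inner_prod_def sum_subtractf sum_distrib_left sum_negf algebra_simps)
    ultimately show ?thesis using n by (simp add: divide_le_0_iff zero_le_mult_iff)
  qed
  have 2: "\<bar>((\<Sum>i=1..n. a g i) - n * \<alpha>) / sqrt n - fst T - \<phi> * (fst \<theta> + g)\<bar> \<le> \<tau>" if "\<bar>g\<bar> \<le> 1" for g
    using C that unfolding a_def by (intro count_linear[OF lin c n _ bracket_le]) auto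
  have "0 \<le> ((\<Sum>i=1..n. a h i) - n * \<alpha>) / sqrt n" using 1[of h] h by (simp add: zero_le_mult_iff)
  then have u: "- \<tau> \<le> fst T + \<phi> * (fst \<theta> + h)" using abs_le_D1[OF 2[of h]] abs_le_D2[OF 2[of h]] h by simp
  have "((\<Sum>i=1..n. a (- h) i) - n * \<alpha>) / sqrt n \<le> 0"
    using 1[of "- h"] h by (simp add: mult_le_0_iff divide_le_0_iff)
  then have l: "fst T + \<phi> * (fst \<theta> + - h) \<le> \<tau>" using abs_le_D1[OF 2[of "- h"]] abs_le_D2[OF 2[of "- h"]] h by simp
  show ?thesis using u l h by (simp add: algebra_simps)
qed

subsection \<open>Rank dispersion\<close>

lemma abel_scores:
  fixes A :: "nat \<Rightarrow> real"
  assumes "j \<in> {1..n}"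
  shows "A j = A n - (\<Sum>k\<in>{1..<n}. (A (k + 1) - A k) * of_bool (j \<le> k))"
proof -
  have "(\<Sum>k\<in>{1..<n}. (A (k + 1) - A k) * of_bool (j \<le> k)) = (\<Sum>k\<in>{j..<n}. A (Suc k) - A k)"
    using assms by (intro sum.mono_neutral_cong_right) auto
  also have "\<dots> = A n - A j" using assms by (intro sum_Suc_diff') auto
  finally show ?thesis by simp
qed

text \<open>For nondecreasing scores the coefficients \<open>A (k + 1) - A k\<close> are
  nonnegative, so inequalities between sums of indicators of \<open>\<sigma> i \<le> k\<close>, one
  for each \<open>k\<close>, transfer to the scores.\<close>

lemma abel_scores_sum:
  fixes A r :: "nat \<Rightarrow> real"
  assumes "\<And>i. i \<in> {1..n} \<Longrightarrow> \<sigma> i \<in> {1..n}"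
  shows "(\<Sum>i=1..n. r i * A (\<sigma> i))
    = A n * (\<Sum>i=1..n. r i) - (\<Sum>k\<in>{1..<n}. (A (k + 1) - A k) * (\<Sum>i=1..n. r i * of_bool (\<sigma> i \<le> k)))"
proof -
  have "(\<Sum>i=1..n. r i * A (\<sigma> i))
    = (\<Sum>i=1..n. A n * r i - (\<Sum>k\<in>{1..<n}. (A (k + 1) - A k) * (r i * of_bool (\<sigma> i \<le> k))))"
  proof (intro sum.cong refl)
    fix i assume "i \<in> {1..n}"
    then have "r i * A (\<sigma> i) = r i * (A n - (\<Sum>k\<in>{1..<n}. (A (k + 1) - A k) * of_bool (\<sigma> i \<le> k)))"
      using abel_scores[OF assms, of i A] by simp
    then show "r i * A (\<sigma> i) = A n * r i - (\<Sum>k\<in>{1..<n}. (A (k + 1) - A k) * (r i * of_bool (\<sigma> i \<le> k)))"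
      by (simp add: right_diff_distrib sum_distrib_left mult_ac)
  qed
  also have "\<dots> = A n * (\<Sum>i=1..n. r i) - (\<Sum>k\<in>{1..<n}. (A (k + 1) - A k) * (\<Sum>i=1..n. r i * of_bool (\<sigma> i \<le> k)))"
    unfolding sum_subtractf sum_distrib_left by (subst (2) sum.swap) simp
  finally show ?thesis .
qed

text \<open>After subtracting the \<open>k\<close>-th order statistic from all values, the selection
  by rank takes every negative term and no positive one. Both selections have \<open>k\<close>
  members, so the subtraction cancels.\<close>

lemma sum_smallest_le:
  fixes r :: "nat \<Rightarrow> real"
  assumes k: "1 \<le> k" "k \<le> n" and B: "B \<subseteq> {1..n}" "card B = k"
  shows "(\<Sum>i=1..n. r i * of_bool (sample_rank n r i \<le> k)) \<le> (\<Sum>i=1..n. r i * of_bool (i \<in> B))"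
proof -
  define t where "t = order_stat n r k"
  have le: "(r i - t) * of_bool (sample_rank n r i \<le> k) \<le> (r i - t) * of_bool (i \<in> B)" if "i \<in> {1..n}" for i
    using sample_rank_order_stat[OF k that, of r] unfolding t_def[symmetric]
    by (cases "r i < t"; cases "r i = t") auto
  have "(\<Sum>i=1..n. (r i - t) * of_bool (sample_rank n r i \<le> k)) \<le> (\<Sum>i=1..n. (r i - t) * of_bool (i \<in> B))"
    using le by (rule sum_mono)
  moreover have "(\<Sum>i=1..n. of_bool (sample_rank n r i \<le> k)) = real k"
    using card_eq_sum_of_bool[of "{1..n}" "\<lambda>i. sample_rank n r i \<le> k"] card_sample_rank_le[OF k(2), of r] by simp
  moreover have "(\<Sum>i=1..n. of_bool (i \<in> B)) = real k"
  proof -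
    have "{i\<in>{1..n}. i \<in> B} = B" using B by auto
    then show ?thesis using card_eq_sum_of_bool[of "{1..n}" "\<lambda>i. i \<in> B"] B by simp
  qed
  ultimately show ?thesis
    by (simp add: left_diff_distrib sum_subtractf flip: sum_distrib_left)
qed

text \<open>The rearrangement inequality. After summation by parts it reduces to comparing, for each
  \<open>k\<close>, the \<open>k\<close> smallest values with the \<open>k\<close> values that
  \<sigma> puts first.\<close>

lemma rank_rearrangement:
  fixes r A :: "nat \<Rightarrow> real"
  assumes \<sigma>: "bij_betw \<sigma> {1..n} {1..n}" and A: "\<And>k. 1 \<le> k \<Longrightarrow> k < n \<Longrightarrow> A k \<le> A (k + 1)"
  shows "(\<Sum>i=1..n. r i * A (\<sigma> i)) \<le> (\<Sum>i=1..n. r i * A (sample_rank n r i))"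
proof -
  have \<sigma>': "\<sigma> i \<in> {1..n}" if "i \<in> {1..n}" for i using \<sigma> that by (rule bij_betw_apply)
  have r': "sample_rank n r i \<in> {1..n}" if "i \<in> {1..n}" for i
    using bij_betw_sample_rank that by (rule bij_betw_apply)
  have "(\<Sum>i=1..n. r i * of_bool (sample_rank n r i \<le> k)) \<le> (\<Sum>i=1..n. r i * of_bool (\<sigma> i \<le> k))"
    if "k \<in> {1..<n}" for k
  proof -
    have "bij_betw \<sigma> {i\<in>{1..n}. \<sigma> i \<le> k} {1..k}"
    proof (rule bij_betw_subset[OF \<sigma>])
      have "\<sigma> ` {i\<in>{1..n}. \<sigma> i \<le> k} = \<sigma> ` {1..n} \<inter> {..k}" by blast
      then show "\<sigma> ` {i\<in>{1..n}. \<sigma> i \<le> k} = {1..k}"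
        using bij_betw_imp_surj_on[OF \<sigma>] that by auto
    qed auto
    from bij_betw_same_card[OF this] have "card {i\<in>{1..n}. \<sigma> i \<le> k} = k" by simp
    then have "(\<Sum>i=1..n. r i * of_bool (sample_rank n r i \<le> k)) \<le> (\<Sum>i=1..n. r i * of_bool (i \<in> {i\<in>{1..n}. \<sigma> i \<le> k}))"
      using that by (intro sum_smallest_le) auto
    also have "\<dots> = (\<Sum>i=1..n. r i * of_bool (\<sigma> i \<le> k))" by (intro sum.cong) auto
    finally show ?thesis .
  qed
  note * = this
  have "(\<Sum>k\<in>{1..<n}. (A (k + 1) - A k) * (\<Sum>i=1..n. r i * of_bool (sample_rank n r i \<le> k)))
    \<le> (\<Sum>k\<in>{1..<n}. (A (k + 1) - A k) * (\<Sum>i=1..n. r i * of_bool (\<sigma> i \<le> k)))"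
  proof (rule sum_mono)
    fix k assume "k \<in> {1..<n}"
    then show "(A (k + 1) - A k) * (\<Sum>i=1..n. r i * of_bool (sample_rank n r i \<le> k))
      \<le> (A (k + 1) - A k) * (\<Sum>i=1..n. r i * of_bool (\<sigma> i \<le> k))"
      using A * by (intro mult_left_mono) auto
  qed
  then show ?thesis
    using abel_scores_sum[OF \<sigma>', where r = r and A = A] abel_scores_sum[OF r', where r = r and A = A] by simp
qed

text \<open>By the rearrangement inequality the dispersion is a maximum, over all assignments of
  ranks, of affine functions of \<open>b\<close>; freezing the ranks found at \<open>b\<close> gives
  a supporting affine function there.\<close>

lemma rank_dispersion_subgradient:
  assumes A: "\<And>k. 1 \<le> k \<Longrightarrow> k < n \<Longrightarrow> A n k \<le> A n (k + 1)"
  shows "rank_dispersion A n Y x b - (\<Sum>i=1..n. A n (sample_rank n (\<lambda>j. Y j - x j \<bullet> b) i) *\<^sub>R x i) \<bullet> (b' - b)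
    \<le> rank_dispersion A n Y x b'"
proof -
  have "rank_dispersion A n Y x b - (\<Sum>i=1..n. A n (sample_rank n (\<lambda>j. Y j - x j \<bullet> b) i) *\<^sub>R x i) \<bullet> (b' - b)
    = (\<Sum>i=1..n. (Y i - x i \<bullet> b') * A n (sample_rank n (\<lambda>j. Y j - x j \<bullet> b) i))"
    unfolding rank_dispersion_def inner_sum_left sum_subtractf[symmetric]
    by (intro sum.cong refl) (simp add: inner_diff_right algebra_simps)
  also have "\<dots> \<le> rank_dispersion A n Y x b'"
    unfolding rank_dispersion_def using A by (intro rank_rearrangement bij_betw_sample_rank) auto
  finally show ?thesis .
qed

text \<open>The subgradients are bounded by one constant \<open>K\<close>, because only finitely
  many score values occur; the two supporting inequalities then give a Lipschitz bound.\<close>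

lemma continuous_on_rank_dispersion:
  fixes x :: "nat \<Rightarrow> 'a::euclidean_space"
  assumes A: "\<And>k. 1 \<le> k \<Longrightarrow> k < n \<Longrightarrow> A n k \<le> A n (k + 1)"
  shows "continuous_on S (rank_dispersion A n Y x)"
proof -
  define K where "K = (\<Sum>i=1..n. (\<Sum>k=1..n. \<bar>A n k\<bar>) * norm (x i))"
  have grad: "norm (\<Sum>i=1..n. A n (sample_rank n z i) *\<^sub>R x i) \<le> K" for z
    unfolding K_def
  proof (intro order.trans[OF norm_sum] sum_mono)
    fix i assume "i \<in> {1..n}"
    then have "sample_rank n z i \<in> {1..n}" using bij_betw_apply[OF bij_betw_sample_rank] by blast
    then have "\<bar>A n (sample_rank n z i)\<bar> \<le> (\<Sum>k=1..n. \<bar>A n k\<bar>)"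
      by (intro member_le_sum[of _ _ "\<lambda>k. \<bar>A n k\<bar>"]) auto
    then show "norm (A n (sample_rank n z i) *\<^sub>R x i) \<le> (\<Sum>k=1..n. \<bar>A n k\<bar>) * norm (x i)"
      by (simp add: mult_right_mono)
  qed
  have le: "rank_dispersion A n Y x b - rank_dispersion A n Y x b' \<le> K * norm (b' - b)" for b b'
  proof -
    let ?g = "\<Sum>i=1..n. A n (sample_rank n (\<lambda>j. Y j - x j \<bullet> b) i) *\<^sub>R x i"
    have "?g \<bullet> (b' - b) \<le> norm ?g * norm (b' - b)" by (rule norm_cauchy_schwarz)
    also have "\<dots> \<le> K * norm (b' - b)" by (intro mult_right_mono grad) auto
    finally show ?thesis using rank_dispersion_subgradient[of n A Y x b b', OF A] by simp
  qed
  have "K-lipschitz_on S (rank_dispersion A n Y x)"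
  proof (rule lipschitz_onI)
    fix b b' assume "b \<in> S" "b' \<in> S"
    show "dist (rank_dispersion A n Y x b) (rank_dispersion A n Y x b') \<le> K * dist b b'"
      using le[of b b'] le[of b' b] by (simp add: dist_real_def dist_norm norm_minus_commute)
  qed (auto simp: K_def intro!: sum_nonneg)
  then show ?thesis by (rule lipschitz_on_continuous_on)
qed

lemma sample_rank_shift:
  assumes "\<And>i. i \<in> {1..n} \<Longrightarrow> z' i = z i + c" "i \<in> {1..n}"
  shows "sample_rank n z' i = sample_rank n z i"
proof -
  have "{j\<in>{1..n}. z' j < z' i} = {j\<in>{1..n}. z j < z i}" "{j\<in>{1..i}. z' j = z' i} = {j\<in>{1..i}. z j = z i}"
    using assms by auto
  then show ?thesis by (simp add: sample_rank_def)
qed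

text \<open>The directional derivative of the dispersion is positive on a sphere, hence, by convexity, all
  minimizers lie inside it.\<close>

lemma rank_gradient_positive:
  fixes c x :: "nat \<Rightarrow> 'a::euclidean_space" and A :: "nat \<Rightarrow> nat \<Rightarrow> real" and lo hi :: nat
  assumes lin: "\<And>k::nat. lo \<le> k \<Longrightarrow> k < hi \<Longrightarrow> \<exists>\<phi> t T. linear_at n (\<lambda>i. (1::real, c i)) e (k / n) \<phi> t T C' \<tau>
        \<and> norm T \<le> C0 \<and> \<phi>0 \<le> \<phi>"
    and x: "\<And>i. i \<in> {1..n} \<Longrightarrow> x i = xm + c i" and c: "(\<Sum>i=1..n. c i) = 0"
    and lohi: "(1::nat) \<le> lo" "lo \<le> hi" "hi \<le> n" and \<phi>0: "0 < \<phi>0" and \<tau>: "1 < \<tau> * sqrt n" "0 < \<tau>" and C0: "0 \<le> C0"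
    and q: "0 \<le> q" and Q: "\<And>v. n * q * (norm v)\<^sup>2 \<le> (\<Sum>i=1..n. (c i \<bullet> v)\<^sup>2)"
    and B: "(\<Sum>i=1..n. norm (c i)) \<le> n * B" "0 \<le> B"
    and A: "\<And>k. 1 \<le> k \<Longrightarrow> k < n \<Longrightarrow> A n k \<le> A n (k + 1)"
    and A1: "1 / 2 \<le> A n hi - A n lo" and A2: "sqrt n * ((A n lo - A n 1) + (A n n - A n hi)) \<le> 1"
    and A3: "norm xm * \<bar>\<Sum>i=1..n. A n i\<bar> \<le> m * sqrt n"
    and C: "0 \<le> C" "C + (C0 + 2 * \<tau>) / \<phi>0 \<le> C'" and big: "2 * (m + B) + C0 + \<tau> < \<phi>0 * C * q"
    and u: "norm u = 1"
  shows "0 < - (\<Sum>i=1..n. A n (sample_rank n (\<lambda>j. e j - c j \<bullet> (C *\<^sub>R u) / sqrt n) i) *\<^sub>R x i) \<bullet> u"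
proof -
  define z where "z j = e j - c j \<bullet> (C *\<^sub>R u) / sqrt n" for j
  define R where "R = sample_rank n z"
  define G where "G k = (\<Sum>i=1..n. (c i \<bullet> u) * of_bool (R i \<le> k)) / sqrt n" for k
  define g where "g = \<phi>0 * C * q - C0 - \<tau>"
  have n: "1 \<le> n" "0 < sqrt n" using lohi by auto
  have R: "R i \<in> {1..n}" if "i \<in> {1..n}" for i
    unfolding R_def using bij_betw_sample_rank that by (rule bij_betw_apply)
  have cu: "(\<Sum>i=1..n. c i \<bullet> u) = 0" using c by (simp flip: inner_sum_left)
  have inc: "0 \<le> A n (k + 1) - A n k" if "k \<in> {1..<n}" for k using A that by simp
  have good: "g \<le> G k" if k: "lo \<le> k" "k < hi" for k
  proof -
    from lin[OF k] obtain \<phi> t T where l: "linear_at n (\<lambda>i. (1::real, c i)) e (k / n) \<phi> t T C' \<tau>"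
      and T: "norm T \<le> C0" and \<phi>: "\<phi>0 \<le> \<phi>" by blast
    have k1: "1 \<le> k" "k \<le> n" using k lohi by auto
    \<comment> \<open>The \<open>k\<close>-th order statistic of the shifted errors, written as a
      local intercept. It depends on the data but stays in a fixed interval, so the expansion, being
      uniform in the parameter, may be applied at this very point.\<close>
    define \<theta> where "\<theta> = sqrt n * (order_stat n z k - t)"
    have le: "(norm T + 2 * \<tau>) / \<phi> \<le> (C0 + 2 * \<tau>) / \<phi>0"
      using T \<phi> \<phi>0 \<tau> C0 by (intro frac_le) auto
    have "\<bar>fst T + \<phi> * \<theta>\<bar> \<le> 2 * \<tau>"
      unfolding \<theta>_def z_def
      using order_stat_linear[OF l c k1 _ _ \<tau>(1), of "C *\<^sub>R u"] n \<phi> \<phi>0 C u le by simp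
    then have "\<bar>\<phi> * \<theta>\<bar> \<le> norm T + 2 * \<tau>" using norm_fst_le[of "fst T" "snd T"] by simp
    then have "\<bar>\<theta>\<bar> \<le> (norm T + 2 * \<tau>) / \<phi>" using \<phi> \<phi>0 by (simp add: pos_le_divide_eq abs_mult mult.commute)
    then have \<theta>: "\<bar>\<theta>\<bar> + norm (C *\<^sub>R u) \<le> C'" using le C u by simp
    have t: "t + (\<theta> + c i \<bullet> (C *\<^sub>R u)) / sqrt n = order_stat n z k + c i \<bullet> (C *\<^sub>R u) / sqrt n" for i
      unfolding \<theta>_def using n by (simp add: add_divide_distrib)
    have "bracket n e (\<lambda>i. t + (\<theta> + c i \<bullet> (C *\<^sub>R u)) / sqrt n) (\<lambda>i. of_bool (R i \<le> k))"
      unfolding bracket_def t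
    proof
      fix i assume i: "i \<in> {1..n}"
      show "of_bool (e i < order_stat n z k + c i \<bullet> (C *\<^sub>R u) / sqrt n) \<le> (of_bool (R i \<le> k) :: real)
        \<and> (of_bool (R i \<le> k) :: real) \<le> of_bool (e i \<le> order_stat n z k + c i \<bullet> (C *\<^sub>R u) / sqrt n)"
        using sample_rank_order_stat[OF k1 i, of z] unfolding R_def[symmetric] by (auto simp: z_def)
    qed
    from slope_linear[OF l c \<theta> this u]
    have "- norm T - \<tau> + \<phi> / n * (\<Sum>i=1..n. (c i \<bullet> (C *\<^sub>R u)) * (c i \<bullet> u)) \<le> G k"
      by (simp add: G_def mult.commute)
    moreover have "\<phi>0 * C * q \<le> \<phi> / n * (\<Sum>i=1..n. (c i \<bullet> (C *\<^sub>R u)) * (c i \<bullet> u))"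
    proof -
      have "\<phi>0 * C * q \<le> \<phi> * C * q" using \<phi> C q by (intro mult_right_mono) auto
      also have "\<dots> = \<phi> / n * (C * (n * q * (norm u)\<^sup>2))" using n u by simp
      also have "\<dots> \<le> \<phi> / n * (C * (\<Sum>i=1..n. (c i \<bullet> u)\<^sup>2))"
        using Q[of u] \<phi> \<phi>0 C by (intro mult_left_mono) auto
      also have "\<dots> = \<phi> / n * (\<Sum>i=1..n. (c i \<bullet> (C *\<^sub>R u)) * (c i \<bullet> u))"
        by (simp add: sum_distrib_left power2_eq_square mult_ac)
      finally show ?thesis .
    qed
    ultimately show ?thesis using T by (simp add: g_def)
  qed
  \<comment> \<open>At extreme ranks no expansion is available. This trivial bound of order
    \<open>sqrt n\<close> is affordable because the scores vary there by at most
    \<open>1 / sqrt n\<close> in total, by \<open>A2\<close>.\<close>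
  have bad: "- (sqrt n * B) \<le> G k" for k
  proof -
    have "\<bar>\<Sum>i=1..n. (c i \<bullet> u) * of_bool (R i \<le> k)\<bar> \<le> (\<Sum>i=1..n. norm (c i))"
    proof (intro order.trans[OF sum_abs] sum_mono)
      fix i
      show "\<bar>(c i \<bullet> u) * of_bool (R i \<le> k)\<bar> \<le> norm (c i)"
        using Cauchy_Schwarz_ineq2[of "c i" u] u by (auto simp: abs_mult)
    qed
    also have "\<dots> \<le> sqrt n * B * sqrt n" using B by (simp add: mult_ac flip: mult.assoc)
    finally show ?thesis unfolding G_def using n by (simp add: pos_le_divide_eq)
  qed
  have tele: "(\<Sum>k\<in>{i..<j}. A n (k + 1) - A n k) = A n j - A n i" if "i \<le> j" for i j
    using sum_Suc_diff'[OF that, of "A n"] by simp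
  have split: "(\<Sum>k\<in>{1..<n}. h k) = (\<Sum>k\<in>{1..<lo}. h k) + (\<Sum>k\<in>{lo..<hi}. h k) + (\<Sum>k\<in>{hi..<n}. h k)" for h :: "nat \<Rightarrow> real"
    using lohi by (simp add: sum.atLeastLessThan_concat)
  have "(A n lo - A n 1) * (- (sqrt n * B)) + (A n hi - A n lo) * g + (A n n - A n hi) * (- (sqrt n * B))
    \<le> (\<Sum>k\<in>{1..<n}. (A n (k + 1) - A n k) * G k)"
    unfolding split[of "\<lambda>k. (A n (k + 1) - A n k) * G k"]
    unfolding tele[OF lohi(1), symmetric] tele[OF lohi(2), symmetric] tele[OF lohi(3), symmetric] sum_distrib_right
    using lohi good bad inc by (intro add_mono sum_mono mult_left_mono) auto
  \<comment> \<open>Replacing the score rise by 1/2 needs \<open>g \<ge> 0\<close>; this follows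
    from \<open>big\<close>, since \<open>A3\<close> forces \<open>m\<close> to be
    nonnegative.\<close>
  moreover have "(A n hi - A n lo) * g \<ge> 1 / 2 * g"
    using A1 big A3 B n order.trans[OF _ A3, of 0] by (intro mult_right_mono) (auto simp: g_def zero_le_mult_iff)
  moreover have "(sqrt n * ((A n lo - A n 1) + (A n n - A n hi))) * B \<le> 1 * B"
    using A2 B by (intro mult_right_mono) auto
  ultimately have S: "1 / 2 * g - B \<le> (\<Sum>k\<in>{1..<n}. (A n (k + 1) - A n k) * G k)"
    by (simp add: algebra_simps)
  \<comment> \<open>The mean \<open>xm\<close> multiplies the sum of all scores, which is the same
    for every ranking. This is the drift that scores with nonzero sum leave behind.\<close>
  have "- (\<Sum>i=1..n. A n (R i) *\<^sub>R x i) \<bullet> u = - (xm \<bullet> u) * (\<Sum>i=1..n. A n (R i)) - (\<Sum>i=1..n. (c i \<bullet> u) * A n (R i))"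
    using x by (simp add: inner_sum_left inner_add_left sum.distrib sum_negf sum_distrib_left algebra_simps)
  also have "(\<Sum>i=1..n. A n (R i)) = (\<Sum>i=1..n. A n i)"
    unfolding R_def by (rule sum.reindex_bij_betw[OF bij_betw_sample_rank])
  also have "(\<Sum>i=1..n. (c i \<bullet> u) * A n (R i)) = - sqrt n * (\<Sum>k\<in>{1..<n}. (A n (k + 1) - A n k) * G k)"
  proof -
    have G: "(\<Sum>i=1..n. (c i \<bullet> u) * of_bool (R i \<le> k)) = sqrt n * G k" for k
      using n by (simp add: G_def)
    show ?thesis
      using abel_scores_sum[where \<sigma> = R and r = "\<lambda>i. c i \<bullet> u" and A = "A n", OF R] unfolding cu G
      by (simp only: sum_distrib_left mult_zero_right diff_0 sum_negf mult_minus_left) (simp add: mult_ac)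
  qed
  finally have "- (\<Sum>i=1..n. A n (R i) *\<^sub>R x i) \<bullet> u
    = - (xm \<bullet> u) * (\<Sum>i=1..n. A n i) + sqrt n * (\<Sum>k\<in>{1..<n}. (A n (k + 1) - A n k) * G k)" by simp
  moreover have "\<bar>(xm \<bullet> u) * (\<Sum>i=1..n. A n i)\<bar> \<le> m * sqrt n"
    using A3 mult_right_mono[OF Cauchy_Schwarz_ineq2[of xm u], of "\<bar>\<Sum>i=1..n. A n i\<bar>"] u by (simp add: abs_mult)
  moreover have "m * sqrt n < sqrt n * (\<Sum>k\<in>{1..<n}. (A n (k + 1) - A n k) * G k)"
  proof -
    have "m < (\<Sum>k\<in>{1..<n}. (A n (k + 1) - A n k) * G k)" 
    proof -
      have "m < s" if "1 / 2 * (p - C0 - \<tau>) - B \<le> s" "2 * (m + B) + C0 + \<tau> < p" for p s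
        using that by argo
      from this[OF S[unfolded g_def] big] show ?thesis .
    qed
    then show ?thesis using n by (simp only: mult.commute[of m] mult_less_cancel_left_pos)
  qed
  ultimately show ?thesis unfolding R_def z_def by simp
qed

text \<open>A point outside the ball is beaten by the point where its ray from \<beta> crosses the
  sphere. Hence a minimizer over the compact ball is a global one, and existence and confinement
  come together.\<close>

lemma rank_minimizer_bounded:
  fixes x :: "nat \<Rightarrow> 'a::euclidean_space" and A :: "nat \<Rightarrow> nat \<Rightarrow> real"
  assumes A: "\<And>k. 1 \<le> k \<Longrightarrow> k < n \<Longrightarrow> A n k \<le> A n (k + 1)"
    and r: "0 \<le> r"
    and pos: "\<And>u. norm u = 1 \<Longrightarrow>
      0 < - (\<Sum>i=1..n. A n (sample_rank n (\<lambda>j. Y j - x j \<bullet> (\<beta> + r *\<^sub>R u)) i) *\<^sub>R x i) \<bullet> u"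
  shows "\<exists>b. is_arg_min (rank_dispersion A n Y x) (\<lambda>_. True) b"
    and "is_arg_min (rank_dispersion A n Y x) (\<lambda>_. True) b \<Longrightarrow> norm (b - \<beta>) \<le> r"
proof -
  let ?D = "rank_dispersion A n Y x"
  have out: "\<exists>b'. norm (b' - \<beta>) \<le> r \<and> ?D b' < ?D b" if "r < norm (b - \<beta>)" for b
  proof -
    define u where "u = (b - \<beta>) /\<^sub>R norm (b - \<beta>)"
    have nz: "0 < norm (b - \<beta>)" using r that by linarith
    then have u: "norm u = 1" "b - \<beta> = norm (b - \<beta>) *\<^sub>R u" by (auto simp: u_def)
    let ?b = "\<beta> + r *\<^sub>R u"
    let ?g = "\<Sum>i=1..n. A n (sample_rank n (\<lambda>j. Y j - x j \<bullet> ?b) i) *\<^sub>R x i"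
    have "b - ?b = (norm (b - \<beta>) - r) *\<^sub>R u" using u(2) by (simp add: scaleR_left_diff_distrib diff_diff_eq[symmetric])
    then have "- (?g \<bullet> (b - ?b)) = (norm (b - \<beta>) - r) * (- ?g \<bullet> u)" by simp
    moreover have "0 < (norm (b - \<beta>) - r) * (- ?g \<bullet> u)" using pos[OF u(1)] that by (intro mult_pos_pos) auto
    ultimately have "?D ?b < ?D b" using rank_dispersion_subgradient[of n A Y x ?b b, OF A] by simp
    moreover have "norm (?b - \<beta>) \<le> r" using u r by simp
    ultimately show ?thesis by blast
  qed
  have "\<exists>b\<in>cball \<beta> r. \<forall>b'\<in>cball \<beta> r. ?D b \<le> ?D b'"
    using r by (intro continuous_attains_inf continuous_on_rank_dispersion A) auto
  then obtain b0 where b: "\<And>b'. norm (b' - \<beta>) \<le> r \<Longrightarrow> ?D b0 \<le> ?D b'"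
    unfolding mem_cball dist_norm norm_minus_commute[of \<beta>] Bex_def Ball_def by blast
  have "?D b0 \<le> ?D b'" for b'
  proof (cases "norm (b' - \<beta>) \<le> r")
    case False
    then show ?thesis using out[of b'] b by force
  qed (use b in auto)
  then show "\<exists>b. is_arg_min ?D (\<lambda>_. True) b" by (auto simp: is_arg_min_def not_less)
  show "is_arg_min ?D (\<lambda>_. True) b \<Longrightarrow> norm (b - \<beta>) \<le> r"
    using out[of b] by (auto simp: is_arg_min_def not_le[symmetric])
qed

subsection \<open>Rank scores\<close>

text \<open>The strict form of the duality is the weak one at the largest sample value below
  \<open>y\<close>. It matches the strict inequality in \<open>quantile_score\<close>.\<close>

lemma order_stat_less_iff:
  assumes "1 \<le> k" "k \<le> n"
  shows "order_stat n z k < y \<longleftrightarrow> k \<le> card {i\<in>{1..n}. z i < y}"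
proof
  assume "order_stat n z k < y"
  moreover have "k \<le> card {i\<in>{1..n}. z i \<le> order_stat n z k}"
    using order_stat_le_iff[OF assms, of z] by blast
  ultimately show "k \<le> card {i\<in>{1..n}. z i < y}"
    by (elim order.trans) (auto intro!: card_mono)
next
  assume k: "k \<le> card {i\<in>{1..n}. z i < y}"
  define w where "w = Max (z ` {i\<in>{1..n}. z i < y})"
  have ne: "{i\<in>{1..n}. z i < y} \<noteq> {}" using k assms by (metis One_nat_def card.empty not_one_le_zero order.trans)
  have "w < y" unfolding w_def using ne by (subst Max_less_iff) auto
  have "card {i\<in>{1..n}. z i < y} \<le> card {i\<in>{1..n}. z i \<le> w}"
    unfolding w_def by (intro card_mono) auto
  then have "order_stat n z k \<le> w" using k order_stat_le_iff[OF assms, of z w] by linarith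
  then show "order_stat n z k < y" using \<open>w < y\<close> by linarith
qed

lemma indep_vars_PiM_coordinates:
  assumes N: "\<And>i. i \<in> I \<Longrightarrow> prob_space (N i)" and I: "I \<noteq> {}"
  shows "prob_space.indep_vars (PiM I N) N (\<lambda>i \<omega>. \<omega> i) I"
proof -
  interpret P: prob_space "PiM I N" by (rule prob_space_PiM[OF N])
  have "distr (PiM I N) (PiM I N) (\<lambda>x. \<lambda>i\<in>I. x i) = distr (PiM I N) (PiM I N) (\<lambda>x. x)"
    by (rule distr_cong) (auto simp: space_PiM PiE_def extensional_restrict)
  also have "\<dots> = PiM I N" by (rule distr_id)
  also have "\<dots> = PiM I (\<lambda>i. distr (PiM I N) (N i) (\<lambda>\<omega>. \<omega> i))"
    by (rule PiM_cong) (simp_all add: distr_PiM_component N)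
  finally show ?thesis by (subst P.indep_vars_iff_distr_eq_PiM'[OF I]) auto
qed

text \<open>All but \<open>O(n\<^sup>-\<^sup>1\<^sup>/\<^sup>2)\<close> of the total variation of the scores lies at ranks \<open>k\<close> with \<open>k / n\<close> away from \<open>0\<close> and \<open>1\<close>.
  The exact scores need this slack: they are spread out like a binomial distribution function.\<close>

definition central_scores :: "nat \<Rightarrow> real \<Rightarrow> (nat \<Rightarrow> real) \<Rightarrow> bool" where
  "central_scores n \<eta> a \<longleftrightarrow> (\<forall>k. 1 \<le> k \<longrightarrow> k < n \<longrightarrow> a k \<le> a (k + 1)) \<and>
     (\<exists>lo hi. 1 \<le> lo \<and> lo \<le> hi \<and> hi \<le> n \<and> n * \<eta> \<le> lo \<and> hi \<le> n * (1 - \<eta>) \<and>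
        1 / 2 \<le> a hi - a lo \<and> sqrt n * ((a lo - a 1) + (a n - a hi)) \<le> 1)"

text \<open>Scores of this kind climb from \<open>l - 1\<close> to \<open>l\<close> around rank
  \<open>n * l\<close>. The ranks \<open>lo\<close> and \<open>hi\<close> lie about
  \<open>n * \<eta>\<close> to either side, and the choice of \<eta> keeps \<open>l - \<eta>\<close>
  and \<open>l + \<eta>\<close> between \<eta> and \<open>1 - \<eta>\<close>. A loss of at most 1/4
  on each side leaves a rise of at least 1/2.\<close>

lemma central_scoresI:
  fixes a :: "nat \<Rightarrow> real"
  assumes l: "0 < l" "l < 1" and \<eta>: "\<eta> = min l (1 - l) / 2" and n: "1 \<le> n * \<eta>"
    and mono: "\<And>k. 1 \<le> k \<Longrightarrow> k < n \<Longrightarrow> a k \<le> a (k + 1)"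
    and b: "\<And>k. 1 \<le> k \<Longrightarrow> k \<le> n \<Longrightarrow> l - 1 \<le> a k" "\<And>k. 1 \<le> k \<Longrightarrow> k \<le> n \<Longrightarrow> a k \<le> l"
    and low: "\<And>k. 1 \<le> k \<Longrightarrow> k \<le> n \<Longrightarrow> k < n * (l - \<eta>) + 1 \<Longrightarrow> sqrt n * (a k - (l - 1)) \<le> 1 / 4"
    and high: "\<And>k. 1 \<le> k \<Longrightarrow> k \<le> n \<Longrightarrow> n * (l + \<eta>) - 1 < k \<Longrightarrow> sqrt n * (l - a k) \<le> 1 / 4"
  shows "central_scores n \<eta> a"
proof -
  define lo where "lo = nat \<lceil>n * (l - \<eta>)\<rceil>"
  define hi where "hi = nat \<lfloor>n * (l + \<eta>)\<rfloor>"
  have e: "\<eta> \<le> l - \<eta>" "l + \<eta> \<le> 1 - \<eta>" "0 < \<eta>" using l \<eta> by (auto simp: min_def split: if_splits)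
  have n1: "1 \<le> n" using n by (cases n) auto
  have mono_n: "n * x \<le> n * y" if "x \<le> y" for x y :: real using that by (intro mult_left_mono) auto
  have p: "1 \<le> n * (l - \<eta>)" using mono_n[OF e(1)] n by linarith
  have lo: "n * (l - \<eta>) \<le> lo" "lo < n * (l - \<eta>) + 1"
    unfolding lo_def using p by linarith+
  have q: "n * (l - \<eta>) + 2 * (n * \<eta>) = n * (l + \<eta>)" by (simp add: algebra_simps)
  have hi: "hi \<le> n * (l + \<eta>)" "n * (l + \<eta>) - 1 < hi"
    unfolding hi_def using p q n by linarith+
  have "hi \<le> n * (1 - \<eta>)" using hi mono_n[OF e(2)] by linarith
  then have "hi \<le> n" using e n1 by (smt (verit) mult_left_le of_nat_0_le_iff of_nat_le_iff)
  have lohi: "1 \<le> lo" "lo \<le> hi" using lo hi p q n by linarith+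
  then have k: "1 \<le> hi" "lo \<le> n" using \<open>hi \<le> n\<close> by auto
  have s: "1 \<le> sqrt n" using n1 by simp
  have L: "sqrt n * (a lo - (l - 1)) \<le> 1 / 4" using low[of lo] lohi k lo by auto
  have H: "sqrt n * (l - a hi) \<le> 1 / 4" using high[of hi] lohi k hi \<open>hi \<le> n\<close> by auto
  have L': "a lo - (l - 1) \<le> 1 / 4"
    using mult_right_mono[OF s, of "a lo - (l - 1)"] b(1)[of lo] lohi k L by simp
  have H': "l - a hi \<le> 1 / 4"
    using mult_right_mono[OF s, of "l - a hi"] b(2)[of hi] k \<open>hi \<le> n\<close> H by simp
  have "sqrt n * ((a lo - a 1) + (a n - a hi)) \<le> sqrt n * ((a lo - (l - 1)) + (l - a hi))"
    using b(1)[of 1] b(2)[of n] n1 by (intro mult_left_mono) auto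
  also have "\<dots> \<le> 1" using L H unfolding distrib_left by linarith
  finally have "sqrt n * ((a lo - a 1) + (a n - a hi)) \<le> 1" .
  moreover have "n * \<eta> \<le> lo" using mono_n[OF e(1)] lo by linarith
  ultimately show ?thesis
    unfolding central_scores_def using mono lohi \<open>hi \<le> n\<close> \<open>hi \<le> n * (1 - \<eta>)\<close> L' H'
    by (intro conjI allI impI exI[of _ lo] exI[of _ hi]) auto
qed

lemma eventually_real_ge: "\<forall>\<^sub>F n in sequentially. c \<le> real n"
  using filterlim_real_sequentially by (simp add: filterlim_at_top)

lemma point_scores_central:
  assumes l: "0 < l" "l < 1" and \<eta>: "\<eta> = min l (1 - l) / 2"
  shows "\<forall>\<^sub>F n in sequentially. central_scores n \<eta> (point_scores (quantile_score l) n)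
    \<and> \<bar>\<Sum>i=1..n. point_scores (quantile_score l) n i\<bar> \<le> 1"
  using eventually_real_ge[of "2 / \<eta>"]
proof eventually_elim
  case (elim n)
  have e: "0 < \<eta>" "\<eta> < 1" using l \<eta> by (auto simp: min_def split: if_splits)
  then have n: "2 \<le> n * \<eta>" using elim by (simp add: pos_divide_le_eq)
  have a: "point_scores (quantile_score l) n k = l - of_bool (k < l * (real n + 1))" for k
    by (simp add: point_scores_def quantile_score_def indicator_def pos_divide_less_eq of_bool_def)
  have "central_scores n \<eta> (point_scores (quantile_score l) n)"
  proof (rule central_scoresI[OF l \<eta>])
    show "point_scores (quantile_score l) n k \<le> point_scores (quantile_score l) n (k + 1)" for k
      unfolding a by auto
    show "sqrt n * (point_scores (quantile_score l) n k - (l - 1)) \<le> 1 / 4" if "k < n * (l - \<eta>) + 1" for k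
      using that n l unfolding a by (auto simp: algebra_simps)
    show "sqrt n * (l - point_scores (quantile_score l) n k) \<le> 1 / 4" if "n * (l + \<eta>) - 1 < k" for k
      using that n l unfolding a by (auto simp: algebra_simps)
  qed (use n a in auto)
  moreover have "\<bar>\<Sum>i=1..n. point_scores (quantile_score l) n i\<bar> \<le> 1"
  proof -
    \<comment> \<open>The number of ranks with score \<open>l - 1\<close>; the ceiling is lowered by
      one because the inequality in the score is strict. The sum of the scores is the rounding error
      \<open>n * l - m\<close>.\<close>
    define m where "m = nat (\<lceil>l * (real n + 1)\<rceil> - 1)"
    have "0 < l * (real n + 1)" "l * (real n + 1) < real n + 1" using l by auto
    then have m: "m < l * (real n + 1)" "l * (real n + 1) \<le> m + 1" "m \<le> n"
      unfolding m_def by linarith+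
    then have "{i\<in>{1..n}. real i < l * (real n + 1)} = {1..m}" by auto
    then have "(\<Sum>i=1..n. of_bool (real i < l * (real n + 1))) = real m"
      using card_eq_sum_of_bool[of "{1..n}" "\<lambda>i. real i < l * (real n + 1)"] by simp
    then have "(\<Sum>i=1..n. point_scores (quantile_score l) n i) = n * l - m"
      unfolding a by (simp add: sum_subtractf)
    then show ?thesis using m l by (simp add: algebra_simps abs_le_iff)
  qed
  ultimately show ?case by blast
qed

lemma integral_scores_eq:
  assumes i: "1 \<le> i" "1 \<le> n"
  shows "integral_scores (quantile_score l) n i = l - n * (min (i / n) l - min ((real i - 1) / n) l)"
proof -
  define a b where "a = (real i - 1) / n" and "b = i / n"
  have ab: "a \<le> b" "b - a = 1 / n" using i by (auto simp: a_def b_def field_simps)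
  have 1: "{a<..<b} \<inter> {..<l} = {a<..<min b l}" by auto
  have "(LINT u:{a<..<b}|lborel. quantile_score l u)
    = (\<integral>u. l * indicator {a<..<b} u - indicator ({a<..<b} \<inter> {..<l}) u \<partial>lborel)"
    unfolding set_lebesgue_integral_def quantile_score_def
    by (intro Bochner_Integration.integral_cong) (auto simp: indicator_def)
  also have "\<dots> = l * (b - a) - (min b l - min a l)"
  proof -
    have "integrable lborel (indicat_real {a<..<c})" for c by (cases "a \<le> c") auto
    then show ?thesis
      unfolding 1 using ab by (subst Bochner_Integration.integral_diff) (auto simp: min_def)
  qed
  finally have eq: "(LINT u:{a<..<b}|lborel. quantile_score l u) = l * (b - a) - (min b l - min a l)" .
  show ?thesis
    unfolding integral_scores_def a_def[symmetric] b_def[symmetric] eq ab(2)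
    using i by (simp add: right_diff_distrib)
qed

text \<open>Only the cell containing \<open>l\<close> can have an intermediate score. The sum
  telescopes to \<open>n\<close> times the integral of the score function over the unit interval,
  which is 0.\<close>

lemma integral_scores_central:
  assumes l: "0 < l" "l < 1" and \<eta>: "\<eta> = min l (1 - l) / 2"
  shows "\<forall>\<^sub>F n in sequentially. central_scores n \<eta> (integral_scores (quantile_score l) n)
    \<and> (\<Sum>i=1..n. integral_scores (quantile_score l) n i) = 0"
  using eventually_real_ge[of "2 / \<eta>"]
proof eventually_elim
  case (elim n)
  have e: "0 < \<eta>" "\<eta> < 1" using l \<eta> by (auto simp: min_def split: if_splits)
  then have n: "2 \<le> n * \<eta>" using elim by (simp add: pos_divide_le_eq)
  then have n1: "1 \<le> n" by (cases n) auto
  let ?a = "integral_scores (quantile_score l) n"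
  note a = integral_scores_eq[OF _ n1, of _ l]
  have lo: "?a k = l - 1" if "1 \<le> k" "k \<le> n * l" for k
  proof -
    have "k / n \<le> l" "(real k - 1) / n \<le> l" using that n1 by (auto simp: field_simps)
    then show ?thesis using a[OF that(1)] n1 by (simp add: min_absorb1 diff_divide_distrib algebra_simps)
  qed
  have hi: "?a k = l" if "1 \<le> k" "n * l + 1 \<le> k" for k
  proof -
    have "l \<le> k / n" "l \<le> (real k - 1) / n" using that n1 by (auto simp: field_simps)
    then show ?thesis using a[OF that(1)] n1 by (simp add: min_absorb2)
  qed
  have b: "l - 1 \<le> ?a k" "?a k \<le> l" if "1 \<le> k" for k
  proof -
    have "min (k / n) l - min ((real k - 1) / n) l \<le> 1 / n" "0 \<le> min (k / n) l - min ((real k - 1) / n) l"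
    proof -
      have "min x l - min y l \<le> x - y \<and> 0 \<le> min x l - min y l" if "y \<le> x" for x y :: real
        using that by linarith
      moreover have "(real k - 1) / n \<le> k / n" by (intro divide_right_mono) auto
      moreover have "k / n - (real k - 1) / n = 1 / n" by (simp flip: diff_divide_distrib)
      ultimately show "min (k / n) l - min ((real k - 1) / n) l \<le> 1 / n" "0 \<le> min (k / n) l - min ((real k - 1) / n) l"
        by metis+
    qed
    then show "l - 1 \<le> ?a k" "?a k \<le> l"
      unfolding a[OF that] using mult_left_mono[of "min (k / n) l - min ((real k - 1) / n) l" "1 / n" n] n1 by auto
  qed
  have "central_scores n \<eta> ?a"
  proof (rule central_scoresI[OF l \<eta>])
    show "?a k \<le> ?a (k + 1)" if "1 \<le> k" for k
      using lo[OF that] hi[of "k + 1"] b[of k] b[of "k + 1"] that by (cases "k \<le> n * l") auto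
    show "sqrt n * (?a k - (l - 1)) \<le> 1 / 4" if "1 \<le> k" "k < n * (l - \<eta>) + 1" for k
      using lo[OF that(1)] that n by (simp add: algebra_simps)
    show "sqrt n * (l - ?a k) \<le> 1 / 4" if "1 \<le> k" "n * (l + \<eta>) - 1 < k" for k
      using hi[OF that(1)] that n by (simp add: algebra_simps)
  qed (use n b in auto)
  moreover have "(\<Sum>i=1..n. ?a i) = 0"
  proof -
    have "(\<Sum>i=1..n. ?a i) = (\<Sum>i=1..n. l - n * (min (real i / n) l - min (real (i - 1) / n) l))"
      by (intro sum.cong refl) (simp add: a of_nat_diff)
    also have "\<dots> = n * l - n * (\<Sum>i\<in>{1..n}. min (real i / n) l - min (real (i - 1) / n) l)"
      by (simp add: sum_subtractf flip: sum_distrib_left)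
    also have "(\<Sum>i\<in>{1..n}. min (real i / n) l - min (real (i - 1) / n) l) = l"
      using sum_telescope''[of 0 n "\<lambda>i. min (real i / n) l"] n1 l by (simp add: sum.atLeast1_atMost_eq)
    finally show ?thesis by simp
  qed
  ultimately show ?case by blast
qed

text \<open>The \<open>k\<close>-th uniform order statistic is below \<open>l\<close> exactly when
  at least \<open>k\<close> of the variables are, so the exact score is \<open>l\<close> minus the
  upper tail at \<open>k\<close> of a binomial variable \<open>N\<close>. Monotonicity in
  \<open>k\<close> is then clear, the tails sum to the mean \<open>n * l\<close>, and concentration
  of \<open>N\<close> makes the scores almost constant away from rank \<open>n * l\<close>.\<close>

lemma exact_scores_central:
  assumes l: "0 < l" "l < 1" and \<eta>: "\<eta> = min l (1 - l) / 2"
  shows "\<forall>\<^sub>F n in sequentially. central_scores n \<eta> (exact_scores (quantile_score l) n)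
    \<and> (\<Sum>i=1..n. exact_scores (quantile_score l) n i) = 0"
  using eventually_real_ge[of "4 / \<eta>"] eventually_real_ge[of "1000 / \<eta> ^ 4"]
proof eventually_elim
  case (elim n)
  have e: "0 < \<eta>" "\<eta> < 1" using l \<eta> by (auto simp: min_def split: if_splits)
  then have n: "4 \<le> n * \<eta>" using elim(1) by (simp add: pos_divide_le_eq)
  then have n1: "1 \<le> n" by (cases n) auto
  define U where "U = (uniform_measure lborel {0<..<1} :: real measure)"
  define P where "P = PiM {1..n} (\<lambda>_. U)"
  have U: "prob_space U" unfolding U_def by (rule prob_space_uniform_measure) auto
  have setsU [measurable_cong]: "sets U = sets borel" by (simp add: U_def)
  interpret P: prob_space P unfolding P_def by (rule prob_space_PiM[OF U])
  let ?a = "exact_scores (quantile_score l) n"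
  define Z where "Z i u = (of_bool (u i < l) :: real)" for i and u :: "nat \<Rightarrow> real"
  define N where "N u = (\<Sum>i=1..n. Z i u)" for u
  have Nc: "N u = card {i\<in>{1..n}. u i < l}" for u
    unfolding N_def Z_def by (rule card_eq_sum_of_bool[symmetric]) simp
  have [measurable]: "Z i \<in> borel_measurable P" if "i \<in> {1..n}" for i
    unfolding Z_def of_bool_def P_def using that by measurable
  have [measurable]: "N \<in> borel_measurable P" unfolding N_def by measurable
  have "P.indep_vars (\<lambda>_. U) (\<lambda>i u. u i) {1..n}"
    unfolding P_def using indep_vars_PiM_coordinates[of "{1..n}" "\<lambda>_. U"] U n1 by simp
  from P.indep_vars_compose2[OF this, of "\<lambda>_ z. of_bool (z < l)" "\<lambda>_. borel"]
  have indep: "P.indep_vars (\<lambda>_. borel) Z {1..n}"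
    unfolding Z_def by (simp add: of_bool_def)
  have EZ: "P.expectation (Z i) = l" if "i \<in> {1..n}" for i
  proof -
    have "P.expectation (Z i) = (\<integral>z. of_bool (z < l) \<partial>distr P U (\<lambda>u. u i))"
      unfolding Z_def P_def using that by (subst integral_distr) (auto simp: of_bool_def)
    also have "distr P U (\<lambda>u. u i) = U" unfolding P_def using that U by (intro distr_PiM_component) auto
    also have "(\<integral>z. of_bool (z < l) \<partial>U) = (\<integral>z. indicator {..<l} z \<partial>U)"
      by (intro Bochner_Integration.integral_cong) (auto simp: indicator_def)
    also have "\<dots> = measure U {..<l}" by (simp add: U_def)
    also have "\<dots> = l"
    proof -
      have "{0<..<1} \<inter> {..<l} = {0<..<l}" using l by auto
      then show ?thesis unfolding U_def using l by simp
    qed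
    finally show ?thesis .
  qed
  have ZI: "integrable P (Z i)" if "i \<in> {1..n}" for i
    using that by (intro P.integrable_bounded[where c = 1]) (auto simp: Z_def)
  have EN: "P.expectation N = n * l"
    unfolding N_def using ZI EZ by (subst Bochner_Integration.integral_sum) auto
  have mN [measurable]: "{u \<in> space P. k \<le> N u} \<in> sets P" for k by measurable
  have iN: "integrable P (indicat_real {u \<in> space P. k \<le> N u})" for k
    by (intro P.integrable_bounded[where c = 1]) (auto simp: indicator_def)
  have a: "?a k = l - P.prob {u \<in> space P. k \<le> N u}" if k: "1 \<le> k" "k \<le> n" for k
  proof -
    have "?a k = P.expectation (\<lambda>u. l - indicator {u \<in> space P. k \<le> N u} u)"
      unfolding exact_scores_def P_def[symmetric, unfolded U_def] quantile_score_def
      by (intro Bochner_Integration.integral_cong) (auto simp: indicator_def Nc order_stat_less_iff[OF k])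
    also have "\<dots> = l - P.prob {u \<in> space P. k \<le> N u}"
      using iN by (subst Bochner_Integration.integral_diff) (auto simp: P.prob_space)
    finally show ?thesis .
  qed
  have sum0: "(\<Sum>k=1..n. ?a k) = 0"
  proof -
    have "(\<Sum>k=1..n. P.prob {u \<in> space P. k \<le> N u}) = (\<Sum>k=1..n. P.expectation (\<lambda>u. indicator {u \<in> space P. k \<le> N u} u))"
      by simp
    also have "\<dots> = P.expectation (\<lambda>u. \<Sum>k=1..n. indicator {u \<in> space P. k \<le> N u} u)"
      using iN by (subst Bochner_Integration.integral_sum) auto
    also have "\<dots> = P.expectation N"
    proof (intro Bochner_Integration.integral_cong refl)
      fix u assume u: "u \<in> space P"
      let ?c = "card {i\<in>{1..n}. u i < l}"
      have "?c \<le> card {1..n}" by (intro card_mono) auto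
      then have "{k\<in>{1..n}. k \<le> ?c} = {1..?c}" by auto
      then have "(\<Sum>k=1..n. of_bool (k \<le> ?c)) = real ?c"
        using card_eq_sum_of_bool[of "{1..n}" "\<lambda>k. k \<le> ?c"] by simp
      then show "(\<Sum>k=1..n. indicator {u \<in> space P. k \<le> N u} u) = N u"
        using u by (simp add: Nc indicator_def of_bool_def)
    qed
    finally show ?thesis using a EN by (simp add: sum_subtractf)
  qed
  have tail: "P.prob {u \<in> space P. n * \<eta> / 2 < \<bar>N u - n * l\<bar>} \<le> 1 / (4 * n)"
  proof -
    have eq: "(\<Sum>i=1..n. 1 * (Z i u - P.expectation (Z i))) = N u - n * l" for u
      using EZ by (simp add: N_def sum_subtractf)
    have "P.expectation (\<lambda>u. (\<Sum>i=1..n. 1 * (Z i u - P.expectation (Z i))) ^ 4)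
      \<le> 3 * (\<Sum>i=1..n. 1\<^sup>2 * 1)\<^sup>2 + 4 * (\<Sum>i=1..n. 1 ^ 4 * 1)"
    proof (intro P.fourth_moment_weighted_sum indep)
      fix i assume i: "i \<in> {1..n}"
      have "(\<lambda>u. \<bar>Z i u\<bar>) = Z i" by (auto simp: Z_def)
      then show "P.expectation (\<lambda>u. \<bar>Z i u\<bar>) \<le> 1" using EZ[OF i] l by simp
    qed (auto simp: Z_def)
    also have "\<dots> = 3 * (real n)\<^sup>2 + 4 * n" by simp
    also have "\<dots> \<le> 7 * (real n)\<^sup>2" using n1 by (simp add: power2_eq_square)
    finally have E4: "P.expectation (\<lambda>u. (N u - n * l) ^ 4) \<le> 7 * (real n)\<^sup>2" unfolding eq .
    have "N u \<le> n" "0 \<le> N u" for u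
    proof -
      have "card {i\<in>{1..n}. u i < l} \<le> card {1..n}" by (intro card_mono) auto
      then show "N u \<le> n" "0 \<le> N u" unfolding Nc by simp_all
    qed
    then have bd: "\<bar>N u - n * l\<bar> \<le> n + n * l" for u
      using l n1 by (smt (verit) mult_nonneg_nonneg of_nat_0_le_iff)
    have "P.prob {u \<in> space P. n * \<eta> / 2 < \<bar>N u - n * l\<bar>} \<le> 7 * (real n)\<^sup>2 / (n * \<eta> / 2) ^ 4"
      using bd E4 n by (intro P.fourth_moment_tail) auto
    \<comment> \<open>Here 112 is \<open>7 * 2 ^ 4\<close>. The next step needs \<open>n\<close> to
      be at least \<open>448 / \<eta> ^ 4\<close>, which the assumed
      \<open>1000 / \<eta> ^ 4\<close> covers.\<close>
    also have "\<dots> = 112 / \<eta> ^ 4 / n / n"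
      using n1 e by (simp add: power_divide power_mult_distrib field_simps power2_eq_square power4_eq_xxxx)
    also have "\<dots> \<le> n / 4 / n / n"
    proof (intro divide_right_mono)
      show "112 / \<eta> ^ 4 \<le> n / 4" using elim(2) by (simp add: divide_right_mono)
    qed auto
    also have "\<dots> = 1 / (4 * n)" using n1 by simp
    finally show ?thesis .
  qed
  have "sqrt n \<le> n" using n1 by (intro real_le_lsqrt) (auto simp: power2_eq_square)
  then have sn: "sqrt n * (1 / (4 * n)) \<le> 1 / 4" using n1 by (simp add: field_simps)
  have "central_scores n \<eta> ?a"
  proof (rule central_scoresI[OF l \<eta>])
    show "?a k \<le> ?a (k + 1)" if "1 \<le> k" "k < n" for k
      using a[of k] a[of "k + 1"] that by (auto intro!: P.finite_measure_mono)
    show "sqrt n * (?a k - (l - 1)) \<le> 1 / 4" if k: "1 \<le> k" "k \<le> n" "k < n * (l - \<eta>) + 1" for k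
    proof -
      have "?a k - (l - 1) = P.prob {u \<in> space P. \<not> k \<le> N u}"
        using a[OF k(1,2)] P.prob_neg[of "\<lambda>u. k \<le> N u"] by simp
      also have "\<dots> \<le> P.prob {u \<in> space P. n * \<eta> / 2 < \<bar>N u - n * l\<bar>}"
      proof (intro P.finite_measure_mono subsetI)
        fix u assume "u \<in> {u \<in> space P. \<not> k \<le> N u}"
        then have u: "u \<in> space P" "N u < k" by auto
        then have "N u \<le> real k - 1" unfolding Nc by simp
        then have "N u < n * l - n * \<eta>" using k(3) by (simp add: algebra_simps)
        then have "n * \<eta> / 2 < \<bar>N u - n * l\<bar>" using n by linarith
        then show "u \<in> {u \<in> space P. n * \<eta> / 2 < \<bar>N u - n * l\<bar>}" using u by simp
      qed auto
      also note tail
      finally have "sqrt n * (?a k - (l - 1)) \<le> sqrt n * (1 / (4 * n))" by (intro mult_left_mono) auto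
      then show ?thesis using sn by linarith
    qed
    show "sqrt n * (l - ?a k) \<le> 1 / 4" if k: "1 \<le> k" "k \<le> n" "n * (l + \<eta>) - 1 < k" for k
    proof -
      have "l - ?a k = P.prob {u \<in> space P. k \<le> N u}" using a[OF k(1,2)] by simp
      also have "\<dots> \<le> P.prob {u \<in> space P. n * \<eta> / 2 < \<bar>N u - n * l\<bar>}"
      proof (intro P.finite_measure_mono subsetI)
        fix u assume u: "u \<in> {u \<in> space P. k \<le> N u}"
        then have "n * l + n * \<eta> - 1 < N u" using k(3) by (simp add: algebra_simps)
        then have "n * \<eta> / 2 < \<bar>N u - n * l\<bar>" using n by linarith
        then show "u \<in> {u \<in> space P. n * \<eta> / 2 < \<bar>N u - n * l\<bar>}" using u by simp
      qed auto
      also note tail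
      finally have "sqrt n * (l - ?a k) \<le> sqrt n * (1 / (4 * n))" by (intro mult_left_mono) auto
      then show ?thesis using sn by linarith
    qed
    show "1 \<le> n * \<eta>" using n by simp
    show "l - 1 \<le> ?a k" "?a k \<le> l" if "1 \<le> k" "k \<le> n" for k
      unfolding a[OF that] using P.prob_le_1 by auto
  qed
  then show ?case using sum0 by blast
qed

subsection \<open>Asymptotic linearity\<close>

text \<open>The mean value inequality is applied to \<open>F x - f t * x\<close>, whose derivative
  is uniformly small near \<open>t\<close> by uniform continuity of \<open>f\<close>. One unit of
  room at both ends allows \<open>s\<close> to leave the interval of base points.\<close>

lemma derivative_uniform_linearization:
  fixes F f :: "real \<Rightarrow> real"
  assumes F: "\<And>t. (F has_real_derivative f t) (at t)" and f: "continuous_on UNIV f" and \<omega>: "0 < \<omega>"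
  shows "\<exists>\<kappa>>0. \<forall>t\<in>{a..b}. \<forall>s. \<bar>s - t\<bar> \<le> \<kappa> \<longrightarrow> \<bar>F s - F t - f t * (s - t)\<bar> \<le> \<omega> * \<bar>s - t\<bar>"
proof -
  have "uniformly_continuous_on {a - 1..b + 1} f"
    using f by (intro compact_uniformly_continuous) (auto intro: continuous_on_subset)
  then obtain \<kappa> where \<kappa>: "0 < \<kappa>"
    "\<And>s t. s \<in> {a - 1..b + 1} \<Longrightarrow> t \<in> {a - 1..b + 1} \<Longrightarrow> \<bar>s - t\<bar> < \<kappa> \<Longrightarrow> \<bar>f s - f t\<bar> < \<omega>"
    using \<omega> unfolding uniformly_continuous_on_def dist_real_def by metis
  define \<kappa>' where "\<kappa>' = min 1 (\<kappa> / 2)"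
  have "\<bar>F s - F t - f t * (s - t)\<bar> \<le> \<omega> * \<bar>s - t\<bar>" if t: "t \<in> {a..b}" and s: "\<bar>s - t\<bar> \<le> \<kappa>'" for s t
  proof (cases "s = t")
    case False
    define G where "G x = F x - f t * x" for x
    have G: "(G has_real_derivative f x - f t) (at x)" for x
      unfolding G_def using F by (auto intro!: derivative_eq_intros)
    have D: "\<bar>f x - f t\<bar> \<le> \<omega>" if "min s t \<le> x" "x \<le> max s t" for x
      using \<kappa>(2)[of x t] t s that \<kappa>(1) unfolding \<kappa>'_def by (auto simp: min_def max_def split: if_splits)
    have "norm (G s - G t) \<le> \<omega> * norm (s - t)"
    proof (rule field_differentiable_bound[of "{min s t..max s t}" G "\<lambda>x. f x - f t"])
      fix x assume "x \<in> {min s t..max s t}"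
      then show "(G has_field_derivative f x - f t) (at x within {min s t..max s t})" "norm (f x - f t) \<le> \<omega>"
        using D G by (auto intro: has_field_derivative_at_within)
    qed auto
    then show ?thesis by (simp add: G_def right_diff_distrib algebra_simps)
  qed auto
  moreover have "0 < \<kappa>'" using \<kappa>(1) by (simp add: \<kappa>'_def)
  ultimately show ?thesis by blast
qed

lemma derivative_lipschitz_compact:
  fixes F f :: "real \<Rightarrow> real"
  assumes F: "\<And>t. (F has_real_derivative f t) (at t)" and f: "continuous_on UNIV f"
  shows "\<exists>L>0. (\<forall>t\<in>{a..b}. \<bar>f t\<bar> \<le> L) \<and> (\<forall>s\<in>{a..b}. \<forall>t\<in>{a..b}. \<bar>F s - F t\<bar> \<le> L * \<bar>s - t\<bar>)"
proof -
  have "bounded (f ` {a..b})"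
    using f by (intro compact_imp_bounded compact_continuous_image) (auto intro: continuous_on_subset)
  then obtain L where L: "0 < L" "\<And>t. t \<in> {a..b} \<Longrightarrow> \<bar>f t\<bar> \<le> L"
    unfolding bounded_pos by auto
  have "norm (F s - F t) \<le> L * norm (s - t)" if "s \<in> {a..b}" "t \<in> {a..b}" for s t
    by (rule field_differentiable_bound[of "{a..b}" F f])
      (use that L F in \<open>auto intro: has_field_derivative_at_within\<close>)
  then show ?thesis using L by auto
qed

section \<open>Weighted empirical processes and their control on a finite grid\<close>

definition emp :: "nat \<Rightarrow> (real \<Rightarrow> real) \<Rightarrow> (nat \<Rightarrow> real) \<Rightarrow> (nat \<Rightarrow> real) \<Rightarrow> (nat \<Rightarrow> real) \<Rightarrow> real" where
  "emp n F w s e = (\<Sum>i=1..n. w i * (of_bool (e i \<le> s i) - F (s i))) / sqrt n"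

text \<open>Bracketing by monotonicity needs nonnegative weights, so each coordinate of the
  \<open>d i\<close> is split into its positive part (\<open>\<sigma> = 1\<close>) and its negative
  part (\<open>\<sigma> = - 1\<close>).\<close>

definition part_weight :: "real \<Rightarrow> 'a::real_inner \<Rightarrow> (nat \<Rightarrow> 'a) \<Rightarrow> nat \<Rightarrow> real" where
  "part_weight \<sigma> b d i = max (\<sigma> * (d i \<bullet> b)) 0"

text \<open>The margin \<open>2 \<rho>\<close> absorbs both the mesh of the grid of base points and the radius of the net of parameters.\<close>

definition shifted :: "nat \<Rightarrow> real \<Rightarrow> real \<Rightarrow> (nat \<Rightarrow> 'a::real_inner) \<Rightarrow> 'a \<Rightarrow> real \<Rightarrow> nat \<Rightarrow> real" where
  "shifted n \<rho> z d \<theta> \<nu> i = z + (d i \<bullet> \<theta> + \<nu> * (2 * \<rho> * norm (d i))) / sqrt n"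

definition dyadic :: "real \<Rightarrow> real \<Rightarrow> nat \<Rightarrow> nat \<Rightarrow> real" where
  "dyadic a b J j = a + (b - a) * (j / 2 ^ J)"

lemma dyadic_mem:
  assumes "a < b" "j \<le> 2 ^ J"
  shows "dyadic a b J j \<in> {a..b}"
proof -
  have "real j \<le> 2 ^ J" using assms(2) by (metis of_nat_le_iff of_nat_numeral of_nat_power)
  then have "(b - a) * (real j / 2 ^ J) \<le> (b - a) * 1" using assms(1) by (intro mult_left_mono) auto
  then show ?thesis using assms(1) by (simp add: dyadic_def)
qed

text \<open>For finite \<Theta> these are finitely many inequalities, so the event is measurable
  jointly in the design and the errors. That is what later permits conditioning on the
  design.\<close>

definition grid_good ::
    "nat \<Rightarrow> (real \<Rightarrow> real) \<Rightarrow> (nat \<Rightarrow> real) \<Rightarrow> nat \<Rightarrow> real \<Rightarrow> 'a::euclidean_space set \<Rightarrow> real \<Rightarrow> real \<Rightarrow>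
      (nat \<Rightarrow> 'a) \<Rightarrow> (nat \<Rightarrow> real) \<Rightarrow> bool" where
  "grid_good n F z m \<rho> \<Theta> C0 \<tau> d e \<longleftrightarrow> (\<forall>b\<in>Basis. \<forall>\<sigma>\<in>{1, -1}. \<forall>j\<in>{..m}.
     \<bar>emp n F (part_weight \<sigma> b d) (\<lambda>_. z j) e\<bar> \<le> C0 \<and>
     (\<forall>\<theta>\<in>\<Theta>. \<forall>\<nu>\<in>{1, -1}. \<bar>emp n F (part_weight \<sigma> b d) (shifted n \<rho> (z j) d \<theta> \<nu>) e
        - emp n F (part_weight \<sigma> b d) (\<lambda>_. z j) e\<bar> \<le> \<tau>))"

lemma part_weight_bounds:
  assumes "b \<in> Basis" "\<sigma> \<in> {1, -1}"
  shows "0 \<le> part_weight \<sigma> b d i" "part_weight \<sigma> b d i \<le> norm (d i)"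
  using Basis_le_norm[OF assms(1), of "d i"] assms(2) by (auto simp: part_weight_def abs_le_iff)

lemma part_weight_diff: "part_weight 1 b d i - part_weight (- 1) b d i = d i \<bullet> b"
  by (simp add: part_weight_def max_def)

lemma measurable_grid_good:
  fixes \<Theta> :: "'a::euclidean_space set"
  assumes [measurable]: "F \<in> borel_measurable borel" and fin: "finite \<Theta>"
  shows "{p \<in> space (PiM {1..n} (\<lambda>_. borel) \<Otimes>\<^sub>M PiM {1..n} (\<lambda>_. borel)). grid_good n F z m \<rho> \<Theta> C0 \<tau> (fst p) (snd p)}
    \<in> sets (PiM {1..n} (\<lambda>_. borel :: 'a measure) \<Otimes>\<^sub>M PiM {1..n} (\<lambda>_. borel))"
proof -
  let ?P = "PiM {1..n} (\<lambda>_. borel :: 'a measure) \<Otimes>\<^sub>M PiM {1..n} (\<lambda>_. borel :: real measure)"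
  have d [measurable]: "(\<lambda>p. fst p i) \<in> borel_measurable ?P" "(\<lambda>p. snd p i) \<in> borel_measurable ?P" if "i \<in> {1..n}" for i
    using that by measurable
  have w [measurable]: "(\<lambda>p. part_weight \<sigma> b (fst p) i) \<in> borel_measurable ?P" if "i \<in> {1..n}" for i \<sigma> and b :: 'a
    unfolding part_weight_def using that by measurable
  have s [measurable]: "(\<lambda>p. shifted n \<rho> y (fst p) \<theta> \<nu> i) \<in> borel_measurable ?P" if "i \<in> {1..n}" for i y \<theta> \<nu>
    unfolding shifted_def using that by measurable
  have 1 [measurable]: "(\<lambda>p. emp n F (part_weight \<sigma> b (fst p)) (\<lambda>_. y) (snd p)) \<in> borel_measurable ?P" for \<sigma> b y
    unfolding emp_def of_bool_def by measurable
  have 2 [measurable]: "(\<lambda>p. emp n F (part_weight \<sigma> b (fst p)) (shifted n \<rho> y (fst p) \<theta> \<nu>) (snd p)) \<in> borel_measurable ?P"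
    for \<sigma> b y \<theta> \<nu>
    unfolding emp_def of_bool_def by measurable
  have [simp]: "finite (Basis :: 'a set)" "finite {1, -1 :: real}" by auto
  note fin [simp]
  show ?thesis unfolding grid_good_def by measurable
qed

text \<open>Monotonicity in the thresholds reduces all shifts to the finitely many of the grid.\<close>

lemma emp_bracket_bound:
  fixes d :: "nat \<Rightarrow> 'a::euclidean_space" and w :: "nat \<Rightarrow> real" and \<rho> B C C0 L \<kappa> \<tau> \<omega> :: real
  assumes n: "1 \<le> n"
    and w: "\<And>i. i \<in> {1..n} \<Longrightarrow> 0 \<le> w i" "\<And>i. i \<in> {1..n} \<Longrightarrow> w i \<le> norm (d i)"
    and d: "\<And>i. i \<in> {1..n} \<Longrightarrow> 1 \<le> norm (d i)" "(\<Sum>i=1..n. (norm (d i))\<^sup>2) \<le> n * B"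
    and \<kappa>: "\<And>i. i \<in> {1..n} \<Longrightarrow> (C + 4 * \<rho>) * norm (d i) / sqrt n \<le> \<kappa>"
    and lin: "\<And>s. \<bar>s - t\<bar> \<le> \<kappa> \<Longrightarrow> \<bar>F s - F t - f t * (s - t)\<bar> \<le> \<omega> * \<bar>s - t\<bar>"
    and f: "0 \<le> f t" "f t \<le> L" and \<omega>: "0 \<le> \<omega>" and \<rho>: "0 < \<rho>"
    and z: "z \<le> t" "t \<le> z + \<rho> / sqrt n" and \<theta>: "norm \<theta> \<le> C" "norm (\<theta> - \<theta>') \<le> \<rho>"
    and near: "\<And>\<nu>. \<nu> \<in> {1, -1} \<Longrightarrow> \<bar>emp n F w (shifted n \<rho> z d \<theta>' \<nu>) e - E\<bar> \<le> \<tau>"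
    and a: "bracket n e (\<lambda>i. t + d i \<bullet> \<theta> / sqrt n) a"
  shows "\<bar>(\<Sum>i=1..n. w i * (a i - F t)) / sqrt n - E - f t / n * (\<Sum>i=1..n. w i * (d i \<bullet> \<theta>))\<bar>
    \<le> \<tau> + (4 * \<rho> * L + \<omega> * (C + 4 * \<rho>)) * B"
proof -
  have sn: "0 < sqrt n" "sqrt n * sqrt n = n" using n by auto
  define s where "s \<nu> i = shifted n \<rho> z d \<theta>' \<nu> i" for \<nu> i
  \<comment> \<open>The net error is at most \<open>\<rho> * norm (d i)\<close>, and so is the mesh
    offset because \<open>1 \<le> norm (d i)\<close>. The margin is twice that quantity, which
    encloses the true threshold; the strict inequality on the lower side fits the left limit in
    \<open>bracket\<close>.\<close>
  have sd: "\<bar>s \<nu> i - t - d i \<bullet> \<theta> / sqrt n\<bar> \<le> 4 * \<rho> * norm (d i) / sqrt n"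
    and upper: "t + d i \<bullet> \<theta> / sqrt n \<le> s 1 i" and lower: "s (- 1) i < t + d i \<bullet> \<theta> / sqrt n"
    if i: "i \<in> {1..n}" and \<nu>: "\<nu> \<in> {1, -1}" for i \<nu>
  proof -
    have "\<bar>d i \<bullet> (\<theta> - \<theta>')\<bar> \<le> norm (d i) * norm (\<theta> - \<theta>')" by (rule Cauchy_Schwarz_ineq2)
    also have "\<dots> \<le> norm (d i) * \<rho>" using \<theta>(2) by (intro mult_left_mono) auto
    finally have 1: "\<bar>d i \<bullet> \<theta>' - d i \<bullet> \<theta>\<bar> \<le> \<rho> * norm (d i)" by (simp add: inner_diff_right mult.commute abs_minus_commute)
    define h where "h = sqrt n * (t - z)"
    have h: "0 \<le> h" "h \<le> \<rho>" "t = z + h / sqrt n" using z sn by (auto simp: h_def field_simps)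
    have 2: "\<rho> \<le> \<rho> * norm (d i)" using \<rho> d(1)[OF i] by simp
    have 3: "s \<nu> i - t - d i \<bullet> \<theta> / sqrt n = (d i \<bullet> \<theta>' - d i \<bullet> \<theta> + \<nu> * (2 * \<rho> * norm (d i)) - h) / sqrt n" for \<nu>
      unfolding s_def shifted_def h(3) by (simp add: diff_divide_distrib add_divide_distrib)
    have "\<bar>d i \<bullet> \<theta>' - d i \<bullet> \<theta> + \<nu> * (2 * \<rho> * norm (d i)) - h\<bar> \<le> 4 * \<rho> * norm (d i)"
      using 1 2 h \<nu> by auto
    then show "\<bar>s \<nu> i - t - d i \<bullet> \<theta> / sqrt n\<bar> \<le> 4 * \<rho> * norm (d i) / sqrt n"
      unfolding 3 abs_divide using sn by (simp add: divide_right_mono)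
    have "0 \<le> s 1 i - t - d i \<bullet> \<theta> / sqrt n"
      unfolding 3 using 1 2 h sn by (intro divide_nonneg_pos) auto
    then show "t + d i \<bullet> \<theta> / sqrt n \<le> s 1 i" by simp
    have "0 < \<rho> * norm (d i)" using \<rho> 2 by linarith
    then have "s (- 1) i - t - d i \<bullet> \<theta> / sqrt n < 0"
      unfolding 3 using 1 2 h sn by (intro divide_neg_pos) auto
    then show "s (- 1) i < t + d i \<bullet> \<theta> / sqrt n" by simp
  qed
  have C: "0 \<le> C" using \<theta>(1) norm_ge_zero[of \<theta>] by linarith
  have bias: "\<bar>F (s \<nu> i) - F t - f t * (d i \<bullet> \<theta> / sqrt n)\<bar> \<le> (4 * \<rho> * L + \<omega> * (C + 4 * \<rho>)) * norm (d i) / sqrt n"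
    if i: "i \<in> {1..n}" and \<nu>: "\<nu> \<in> {1, -1}" for i \<nu>
  proof -
    have "\<bar>d i \<bullet> \<theta>\<bar> \<le> C * norm (d i)"
      using Cauchy_Schwarz_ineq2[of "d i" \<theta>] mult_left_mono[OF \<theta>(1), of "norm (d i)"] by (simp add: mult.commute)
    then have "\<bar>d i \<bullet> \<theta> / sqrt n\<bar> \<le> C * norm (d i) / sqrt n"
      using sn by (simp add: abs_divide divide_right_mono)
    then have st: "\<bar>s \<nu> i - t\<bar> \<le> (C + 4 * \<rho>) * norm (d i) / sqrt n"
      using sd[OF that] unfolding distrib_right add_divide_distrib by linarith
    then have "\<bar>F (s \<nu> i) - F t - f t * (s \<nu> i - t)\<bar> \<le> \<omega> * \<bar>s \<nu> i - t\<bar>"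
      using \<kappa>[OF i] by (intro lin) auto
    also have "\<dots> \<le> \<omega> * ((C + 4 * \<rho>) * norm (d i) / sqrt n)" using st \<omega> by (intro mult_left_mono)
    finally have 1: "\<bar>F (s \<nu> i) - F t - f t * (s \<nu> i - t)\<bar> \<le> \<omega> * ((C + 4 * \<rho>) * norm (d i) / sqrt n)" .
    have "\<bar>f t * (s \<nu> i - t - d i \<bullet> \<theta> / sqrt n)\<bar> \<le> L * (4 * \<rho> * norm (d i) / sqrt n)"
      unfolding abs_mult using f sd[OF that] by (intro mult_mono) auto
    moreover have "F (s \<nu> i) - F t - f t * (d i \<bullet> \<theta> / sqrt n)
      = (F (s \<nu> i) - F t - f t * (s \<nu> i - t)) + f t * (s \<nu> i - t - d i \<bullet> \<theta> / sqrt n)"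
      by (simp add: right_diff_distrib)
    moreover have "\<omega> * ((C + 4 * \<rho>) * norm (d i) / sqrt n) + L * (4 * \<rho> * norm (d i) / sqrt n)
      = (4 * \<rho> * L + \<omega> * (C + 4 * \<rho>)) * norm (d i) / sqrt n"
      by (simp add: add_divide_distrib algebra_simps)
    ultimately show ?thesis using 1 by linarith
  qed
  define Q where "Q = f t / n * (\<Sum>i=1..n. w i * (d i \<bullet> \<theta>))"
  have total: "\<bar>(\<Sum>i=1..n. w i * (F (s \<nu> i) - F t)) / sqrt n - Q\<bar> \<le> (4 * \<rho> * L + \<omega> * (C + 4 * \<rho>)) * B"
    if \<nu>: "\<nu> \<in> {1, -1}" for \<nu>
  proof -
    let ?c = "4 * \<rho> * L + \<omega> * (C + 4 * \<rho>)"
    have c: "0 \<le> ?c" using f \<omega> \<rho> C by (intro add_nonneg_nonneg mult_nonneg_nonneg) auto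
    have "f t / n = f t / sqrt n / sqrt n" using sn by (simp add: field_simps)
    then have "(\<Sum>i=1..n. w i * (F (s \<nu> i) - F t)) / sqrt n - Q
      = (\<Sum>i=1..n. w i * (F (s \<nu> i) - F t - f t * (d i \<bullet> \<theta> / sqrt n))) / sqrt n"
      unfolding Q_def by (simp add: sum_divide_distrib sum_distrib_left right_diff_distrib diff_divide_distrib sum_subtractf mult_ac)
    also have "\<bar>\<dots>\<bar> \<le> (\<Sum>i=1..n. ?c * (norm (d i))\<^sup>2 / sqrt n) / sqrt n"
      unfolding abs_divide
    proof (intro frac_le order.trans[OF sum_abs] sum_mono)
      fix i assume i: "i \<in> {1..n}"
      have "\<bar>w i * (F (s \<nu> i) - F t - f t * (d i \<bullet> \<theta> / sqrt n))\<bar> \<le> norm (d i) * (?c * norm (d i) / sqrt n)"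
        unfolding abs_mult using w[OF i] bias[OF i \<nu>] by (intro mult_mono) auto
      then show "\<bar>w i * (F (s \<nu> i) - F t - f t * (d i \<bullet> \<theta> / sqrt n))\<bar> \<le> ?c * (norm (d i))\<^sup>2 / sqrt n"
        by (simp add: power2_eq_square mult_ac)
    qed (use sn c in \<open>auto intro!: sum_nonneg\<close>)
    also have "\<dots> = ?c * (\<Sum>i=1..n. (norm (d i))\<^sup>2) / n"
      using sn by (simp add: sum_distrib_left flip: sum_divide_distrib)
    also have "\<dots> \<le> ?c * (n * B) / n" using d(2) c by (intro divide_right_mono mult_left_mono) auto
    finally show ?thesis using n by simp
  qed
  \<comment> \<open>Each bracketing sum is the process at its thresholds plus a bias. By
    \<open>total\<close> both biases have the same linear term up to a small error, so the sandwich
    closes.\<close>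
  have split: "(\<Sum>i=1..n. w i * (of_bool (e i \<le> s \<nu> i) - F t)) / sqrt n
    = emp n F w (s \<nu>) e + (\<Sum>i=1..n. w i * (F (s \<nu> i) - F t)) / sqrt n" for \<nu>
    by (simp add: emp_def add_divide_distrib[symmetric] sum.distrib[symmetric] distrib_left[symmetric])
  have "(\<Sum>i=1..n. w i * (a i - F t)) / sqrt n \<le> (\<Sum>i=1..n. w i * (of_bool (e i \<le> s 1 i) - F t)) / sqrt n"
  proof (intro divide_right_mono sum_mono mult_left_mono diff_right_mono)
    fix i assume i: "i \<in> {1..n}"
    have "a i \<le> of_bool (e i \<le> t + d i \<bullet> \<theta> / sqrt n)" using a i by (simp add: bracket_def)
    also have "\<dots> \<le> of_bool (e i \<le> s 1 i)" using upper[OF i] by force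
    finally show "a i \<le> of_bool (e i \<le> s 1 i)" .
  qed (use w sn in auto)
  moreover have "(\<Sum>i=1..n. w i * (of_bool (e i \<le> s (- 1) i) - F t)) / sqrt n \<le> (\<Sum>i=1..n. w i * (a i - F t)) / sqrt n"
  proof (intro divide_right_mono sum_mono mult_left_mono diff_right_mono)
    fix i assume i: "i \<in> {1..n}"
    have "of_bool (e i \<le> s (- 1) i) \<le> (of_bool (e i < t + d i \<bullet> \<theta> / sqrt n) :: real)" using lower[OF i] by force
    also have "\<dots> \<le> a i" using a i by (simp add: bracket_def)
    finally show "of_bool (e i \<le> s (- 1) i) \<le> a i" .
  qed (use w sn in auto)
  moreover have "\<bar>emp n F w (s 1) e - E\<bar> \<le> \<tau>" "\<bar>emp n F w (s (- 1)) e - E\<bar> \<le> \<tau>"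
    using near[of 1] near[of "- 1"] by (simp_all add: s_def[abs_def])
  ultimately show ?thesis
    using split[of 1] split[of "- 1"] total[of 1] total[of "- 1"] unfolding Q_def[symmetric]
    by (simp only: abs_le_iff insert_iff simp_thms) argo
qed

text \<open>\<open>T\<close> collects, coordinate by coordinate, the process at the grid point just
  left of \<open>t\<close>, as the difference of the two part weights. The factor 2 in the error
  counts these two parts, and the dimension comes from bounding the norm by the sum of the
  coordinates.\<close>

lemma grid_good_linear_at:
  fixes d :: "nat \<Rightarrow> 'a::euclidean_space" and \<rho> B C C0 L \<kappa> \<tau> \<omega> :: real
  assumes n: "1 \<le> n" and z: "a0 < b0" "(b0 - a0) / 2 ^ J \<le> \<rho> / sqrt n"
    and d: "\<And>i. i \<in> {1..n} \<Longrightarrow> 1 \<le> norm (d i)" "(\<Sum>i=1..n. (norm (d i))\<^sup>2) \<le> n * B"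
    and \<kappa>: "\<And>i. i \<in> {1..n} \<Longrightarrow> (C + 4 * \<rho>) * norm (d i) / sqrt n \<le> \<kappa>"
    and lin: "\<And>s. \<bar>s - t\<bar> \<le> \<kappa> \<Longrightarrow> \<bar>F s - F t - f t * (s - t)\<bar> \<le> \<omega> * \<bar>s - t\<bar>"
    and f: "0 \<le> f t" "f t \<le> L" and \<omega>: "0 \<le> \<omega>" and \<rho>: "0 < \<rho>"
    and net: "\<And>\<theta>. norm \<theta> \<le> C \<Longrightarrow> \<exists>\<theta>'\<in>\<Theta>. norm (\<theta> - \<theta>') \<le> \<rho>"
    and good: "grid_good n F (dyadic a0 b0 J) (2 ^ J) \<rho> \<Theta> C0 \<tau> d e"
    and t: "a0 \<le> t" "t < b0"
  shows "\<exists>T. norm T \<le> 2 * DIM('a) * C0 \<and>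
    linear_at n d e (F t) (f t) t T C (DIM('a) * (2 * (\<tau> + (4 * \<rho> * L + \<omega> * (C + 4 * \<rho>)) * B)))"
proof -
  \<comment> \<open>The index of the grid point obtained by rounding \<open>t\<close> down.\<close>
  define j where "j = nat \<lfloor>(t - a0) * 2 ^ J / (b0 - a0)\<rfloor>"
  have p: "(0::real) < 2 ^ J" by simp
  have x: "0 \<le> (t - a0) * 2 ^ J / (b0 - a0)" "(t - a0) * 2 ^ J / (b0 - a0) < 2 ^ J"
    using t z by (auto simp: field_simps)
  have j: "real j \<le> (t - a0) * 2 ^ J / (b0 - a0)" "(t - a0) * 2 ^ J / (b0 - a0) < real j + 1"
    unfolding j_def using x(1) by linarith+
  have "real j < 2 ^ J" using j(1) x(2) by linarith
  then have jJ: "j \<le> 2 ^ J" by (metis less_imp_le of_nat_less_iff of_nat_numeral of_nat_power)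
  define y where "y = dyadic a0 b0 J j"
  have "real j * (b0 - a0) / 2 ^ J \<le> t - a0"
    using j(1) z p by (simp add: pos_le_divide_eq pos_divide_le_eq)
  moreover have "t - a0 \<le> (real j + 1) * (b0 - a0) / 2 ^ J"
    using j(2) z p by (simp add: pos_divide_less_eq pos_le_divide_eq less_imp_le)
  moreover have "(real j + 1) * (b0 - a0) / 2 ^ J = real j * (b0 - a0) / 2 ^ J + (b0 - a0) / 2 ^ J"
    by (simp only: distrib_right mult_1 add_divide_distrib)
  moreover have "y = a0 + real j * (b0 - a0) / 2 ^ J"
    by (simp add: y_def dyadic_def)
  ultimately have y: "y \<le> t" "t \<le> y + \<rho> / sqrt n"
    using z(2) by linarith+
  let ?w = "\<lambda>\<sigma> b. part_weight \<sigma> b d"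
  define E where "E \<sigma> b = emp n F (?w \<sigma> b) (\<lambda>_. y) e" for \<sigma> b
  define T where "T = (\<Sum>b\<in>Basis. (E 1 b - E (- 1) b) *\<^sub>R b)"
  have E: "\<bar>E \<sigma> b\<bar> \<le> C0" if "b \<in> Basis" "\<sigma> \<in> {1, -1}" for \<sigma> b
    using good jJ that unfolding grid_good_def E_def y_def by auto
  let ?\<delta> = "\<tau> + (4 * \<rho> * L + \<omega> * (C + 4 * \<rho>)) * B"
  have main: "\<bar>(\<Sum>i=1..n. ?w \<sigma> b i * (a i - F t)) / sqrt n - E \<sigma> b - f t / n * (\<Sum>i=1..n. ?w \<sigma> b i * (d i \<bullet> \<theta>))\<bar> \<le> ?\<delta>"
    if b: "b \<in> Basis" "\<sigma> \<in> {1, -1}" and \<theta>: "norm \<theta> \<le> C" and a: "bracket n e (\<lambda>i. t + d i \<bullet> \<theta> / sqrt n) a" for \<sigma> b \<theta> a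
  proof -
    obtain \<theta>' where \<theta>': "\<theta>' \<in> \<Theta>" "norm (\<theta> - \<theta>') \<le> \<rho>" using net[OF \<theta>] by blast
    have "\<bar>emp n F (?w \<sigma> b) (shifted n \<rho> y d \<theta>' \<nu>) e - E \<sigma> b\<bar> \<le> \<tau>" if "\<nu> \<in> {1, -1}" for \<nu>
      using good jJ b \<theta>'(1) that unfolding grid_good_def E_def y_def by blast
    note near = this
    have pw: "\<And>i. i \<in> {1..n} \<Longrightarrow> 0 \<le> ?w \<sigma> b i" "\<And>i. i \<in> {1..n} \<Longrightarrow> ?w \<sigma> b i \<le> norm (d i)"
      using part_weight_bounds[OF b] by auto
    show ?thesis
      by (rule emp_bracket_bound[where n = n and w = "?w \<sigma> b" and d = d and B = B and C = C and \<rho> = \<rho>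
          and \<kappa> = \<kappa> and t = t and F = F and f = f and \<omega> = \<omega> and L = L and z = y and \<theta> = \<theta> and \<theta>' = \<theta>'
          and e = e and E = "E \<sigma> b" and \<tau> = \<tau> and a = a])
        (fact n pw d \<kappa> lin f \<omega> \<rho> y \<theta> \<theta>'(2) near a)+
  qed
  have "norm T \<le> (\<Sum>b\<in>(Basis :: 'a set). 2 * C0)"
    unfolding T_def
  proof (rule order.trans[OF norm_sum], rule sum_mono)
    fix b :: 'a assume b: "b \<in> Basis"
    show "norm ((E 1 b - E (- 1) b) *\<^sub>R b) \<le> 2 * C0" using E[OF b, of 1] E[OF b, of "- 1"] b by simp
  qed
  then have "norm T \<le> 2 * DIM('a) * C0" by (simp add: mult_ac)
  moreover have "linear_at n d e (F t) (f t) t T C (DIM('a) * (2 * ?\<delta>))"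
    unfolding linear_at_def
  proof (intro allI impI)
    fix \<theta> a assume \<theta>: "norm \<theta> \<le> C" and a: "bracket n e (\<lambda>i. t + d i \<bullet> \<theta> / sqrt n) a"
    let ?v = "(1 / sqrt n) *\<^sub>R (\<Sum>i=1..n. (a i - F t) *\<^sub>R d i) - T - (f t / n) *\<^sub>R (\<Sum>i=1..n. (d i \<bullet> \<theta>) *\<^sub>R d i)"
    have "norm ?v \<le> (\<Sum>b\<in>Basis. \<bar>?v \<bullet> b\<bar>)" by (rule norm_le_l1)
    also have "\<dots> \<le> (\<Sum>b\<in>(Basis :: 'a set). 2 * ?\<delta>)"
    proof (intro sum_mono)
      fix b :: 'a assume b: "b \<in> Basis"
      have "T \<bullet> b = E 1 b - E (- 1) b"
        unfolding T_def using b by (simp add: inner_sum_left inner_Basis if_distrib sum.delta cong: if_cong)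
      then have "?v \<bullet> b = (\<Sum>i=1..n. (a i - F t) * (d i \<bullet> b)) / sqrt n - (E 1 b - E (- 1) b)
        - f t / n * (\<Sum>i=1..n. (d i \<bullet> \<theta>) * (d i \<bullet> b))"
        by (simp add: inner_diff_left inner_sum_left)
      also have "\<dots> = ((\<Sum>i=1..n. ?w 1 b i * (a i - F t)) / sqrt n - E 1 b - f t / n * (\<Sum>i=1..n. ?w 1 b i * (d i \<bullet> \<theta>)))
        - ((\<Sum>i=1..n. ?w (- 1) b i * (a i - F t)) / sqrt n - E (- 1) b - f t / n * (\<Sum>i=1..n. ?w (- 1) b i * (d i \<bullet> \<theta>)))"
        unfolding part_weight_diff[of b d, symmetric]
        by (simp add: right_diff_distrib left_diff_distrib sum_subtractf diff_divide_distrib mult_ac)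
      finally show "\<bar>?v \<bullet> b\<bar> \<le> 2 * ?\<delta>"
        using main[OF b _ \<theta> a, of 1] main[OF b _ \<theta> a, of "- 1"] by (simp only: insert_iff simp_thms abs_le_iff) argo
    qed
    also have "\<dots> = DIM('a) * (2 * ?\<delta>)" by simp
    finally show "norm ?v \<le> DIM('a) * (2 * ?\<delta>)" .
  qed
  ultimately show ?thesis by blast
qed

section \<open>Probability that the grid event fails\<close>

lemma (in prob_space) emp_diff_tail:
  fixes X :: "nat \<Rightarrow> 'a \<Rightarrow> real" and w s s' :: "nat \<Rightarrow> real"
  assumes ind: "indep_vars (\<lambda>_. borel) X {1..n}"
    and F: "\<And>i s. i \<in> {1..n} \<Longrightarrow> prob {\<omega> \<in> space M. X i \<omega> \<le> s} = F s"
    and t: "0 < t" and n: "1 \<le> n"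
  shows "prob {\<omega> \<in> space M. t < \<bar>emp n F w s (\<lambda>i. X i \<omega>) - emp n F w s' (\<lambda>i. X i \<omega>)\<bar>}
    \<le> (3 * (\<Sum>i=1..n. (w i)\<^sup>2 * \<bar>F (s i) - F (s' i)\<bar>)\<^sup>2 + 4 * (\<Sum>i=1..n. w i ^ 4 * \<bar>F (s i) - F (s' i)\<bar>)) / n\<^sup>2 / t ^ 4"
    (is "_ \<le> ?m / n\<^sup>2 / t ^ 4")
    and "prob {\<omega> \<in> space M. t < \<bar>emp n F w s (\<lambda>i. X i \<omega>)\<bar>}
    \<le> (3 * (\<Sum>i=1..n. (w i)\<^sup>2)\<^sup>2 + 4 * (\<Sum>i=1..n. w i ^ 4)) / n\<^sup>2 / t ^ 4"
proof -
  have mX [measurable]: "X i \<in> borel_measurable M" if "i \<in> {1..n}" for i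
    using ind that by (auto simp: indep_vars_def)
  define I where "I i s \<omega> = (of_bool (X i \<omega> \<le> s) :: real)" for i s \<omega>
  have mI [measurable]: "I i s \<in> borel_measurable M" if "i \<in> {1..n}" for i s
    unfolding I_def of_bool_def using that by measurable
  have iI: "integrable M (I i s)" if "i \<in> {1..n}" for i s
    using that by (intro integrable_bounded[where c = 1]) (auto simp: I_def)
  have EI: "expectation (I i s) = F s" if i: "i \<in> {1..n}" for i s
  proof -
    have m: "{\<omega> \<in> space M. X i \<omega> \<le> s} \<in> events" using i by measurable
    have "expectation (I i s) = expectation (indicator {\<omega> \<in> space M. X i \<omega> \<le> s})"
      by (intro Bochner_Integration.integral_cong) (auto simp: I_def indicator_def)
    then show ?thesis using F[OF i, of s] m by simp
  qed
  have sn: "0 < sqrt n" "sqrt n ^ 4 = (real n)\<^sup>2"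
    using n by (simp_all add: power4_eq_xxxx power2_eq_square)
  have gen: "prob {\<omega> \<in> space M. t < \<bar>(\<Sum>i=1..n. w i * (Z i \<omega> - expectation (Z i))) / sqrt n\<bar>}
    \<le> (3 * (\<Sum>i=1..n. (w i)\<^sup>2 * v i)\<^sup>2 + 4 * (\<Sum>i=1..n. w i ^ 4 * v i)) / n\<^sup>2 / t ^ 4"
    if indZ: "indep_vars (\<lambda>_. borel) Z {1..n}" and Z: "\<And>i \<omega>. \<bar>Z i \<omega>\<bar> \<le> 1"
      and v: "\<And>i. i \<in> {1..n} \<Longrightarrow> expectation (\<lambda>\<omega>. \<bar>Z i \<omega>\<bar>) \<le> v i" for Z and v :: "nat \<Rightarrow> real"
  proof -
    have mZ [measurable]: "Z i \<in> borel_measurable M" if "i \<in> {1..n}" for i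
      using indZ that by (auto simp: indep_vars_def)
    let ?S = "\<lambda>\<omega>. \<Sum>i=1..n. w i * (Z i \<omega> - expectation (Z i))"
    have "\<bar>?S \<omega>\<bar> \<le> (\<Sum>i=1..n. \<bar>w i\<bar> * (1 + \<bar>expectation (Z i)\<bar>))" for \<omega>
    proof (intro order.trans[OF sum_abs] sum_mono)
      fix i
      show "\<bar>w i * (Z i \<omega> - expectation (Z i))\<bar> \<le> \<bar>w i\<bar> * (1 + \<bar>expectation (Z i)\<bar>)"
        unfolding abs_mult using Z[of i \<omega>] by (intro mult_left_mono) auto
    qed
    moreover have "{\<omega> \<in> space M. t < \<bar>?S \<omega> / sqrt n\<bar>} = {\<omega> \<in> space M. t * sqrt n < \<bar>?S \<omega>\<bar>}"
      using sn by (auto simp: abs_divide pos_less_divide_eq)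
    ultimately have "prob {\<omega> \<in> space M. t < \<bar>?S \<omega> / sqrt n\<bar>}
      \<le> (3 * (\<Sum>i=1..n. (w i)\<^sup>2 * v i)\<^sup>2 + 4 * (\<Sum>i=1..n. w i ^ 4 * v i)) / (t * sqrt n) ^ 4"
      using fourth_moment_weighted_sum[of "{1..n}" Z v w] indZ Z v t sn
      by (simp only:) (intro fourth_moment_tail, auto)
    also have "(t * sqrt n) ^ 4 = n\<^sup>2 * t ^ 4" unfolding power_mult_distrib sn by simp
    finally show ?thesis by simp
  qed
  have indI: "indep_vars (\<lambda>_. borel) (\<lambda>i. I i (s i)) {1..n}" for s
    unfolding I_def by (rule indep_vars_compose2[OF ind, of "\<lambda>i z. of_bool (z \<le> s i)"]) (simp add: of_bool_def)
  have 1: "emp n F w s (\<lambda>i. X i \<omega>) = (\<Sum>i=1..n. w i * (I i (s i) \<omega> - expectation (I i (s i)))) / sqrt n" for \<omega>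
    unfolding emp_def using EI by (simp add: I_def)
  show "prob {\<omega> \<in> space M. t < \<bar>emp n F w s (\<lambda>i. X i \<omega>)\<bar>}
    \<le> (3 * (\<Sum>i=1..n. (w i)\<^sup>2)\<^sup>2 + 4 * (\<Sum>i=1..n. w i ^ 4)) / n\<^sup>2 / t ^ 4"
  proof -
    have "expectation (\<lambda>\<omega>. \<bar>I i (s i) \<omega>\<bar>) \<le> 1" if i: "i \<in> {1..n}" for i
    proof -
      have "(\<lambda>\<omega>. \<bar>I i (s i) \<omega>\<bar>) = I i (s i)" by (auto simp: I_def)
      then show ?thesis using EI[OF i] F[OF i, of "s i"] prob_le_1 by metis
    qed
    then show ?thesis unfolding 1 using gen[OF indI, of s "\<lambda>_. 1"] by (simp add: I_def)
  qed
  define Z where "Z i \<omega> = I i (s i) \<omega> - I i (s' i) \<omega>" for i \<omega>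
  have indZ: "indep_vars (\<lambda>_. borel) Z {1..n}"
    unfolding Z_def I_def
    by (rule indep_vars_compose2[OF ind, of "\<lambda>i z. of_bool (z \<le> s i) - of_bool (z \<le> s' i)"]) (simp add: of_bool_def)
  have EZ: "expectation (Z i) = F (s i) - F (s' i)" if "i \<in> {1..n}" for i
    unfolding Z_def using iI EI that by simp
  have v: "expectation (\<lambda>\<omega>. \<bar>Z i \<omega>\<bar>) \<le> \<bar>F (s i) - F (s' i)\<bar>" if i: "i \<in> {1..n}" for i
  proof -
    \<comment> \<open>The half-lines are nested, so the difference of indicators has one sign and
      its absolute mean is the increment of \<open>F\<close>.\<close>
    have "(\<lambda>\<omega>. \<bar>Z i \<omega>\<bar>) = Z i \<or> (\<lambda>\<omega>. \<bar>Z i \<omega>\<bar>) = (\<lambda>\<omega>. - Z i \<omega>)"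
      by (cases "s i \<le> s' i") (auto simp: Z_def I_def fun_eq_iff)
    then show ?thesis using EZ[OF i] by auto
  qed
  have Z1: "\<bar>Z i \<omega>\<bar> \<le> 1" for i \<omega> by (auto simp: Z_def I_def)
  have "emp n F w s (\<lambda>i. X i \<omega>) - emp n F w s' (\<lambda>i. X i \<omega>) = (\<Sum>i=1..n. w i * (Z i \<omega> - expectation (Z i))) / sqrt n" for \<omega>
  proof -
    have "emp n F w s (\<lambda>i. X i \<omega>) - emp n F w s' (\<lambda>i. X i \<omega>) = (\<Sum>i=1..n. w i * (Z i \<omega> - (F (s i) - F (s' i)))) / sqrt n"
      by (simp add: emp_def Z_def I_def diff_divide_distrib right_diff_distrib sum_subtractf)
    also have "\<dots> = (\<Sum>i=1..n. w i * (Z i \<omega> - expectation (Z i))) / sqrt n" using EZ by simp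
    finally show ?thesis .
  qed
  then show "prob {\<omega> \<in> space M. t < \<bar>emp n F w s (\<lambda>i. X i \<omega>) - emp n F w s' (\<lambda>i. X i \<omega>)\<bar>} \<le> ?m / n\<^sup>2 / t ^ 4"
    using gen[OF indZ Z1 v] by (simp only:)
qed

lemma (in finite_measure) measure_UN_le_const:
  fixes c :: real
  assumes "finite I" "\<And>i. i \<in> I \<Longrightarrow> A i \<in> sets M" "\<And>i. i \<in> I \<Longrightarrow> measure M (A i) \<le> c"
  shows "measure M (\<Union>i\<in>I. A i) \<le> card I * c"
proof -
  have "measure M (\<Union>i\<in>I. A i) \<le> (\<Sum>i\<in>I. measure M (A i))"
    using assms by (intro finite_measure_subadditive_finite) auto
  also have "\<dots> \<le> card I * c" using sum_bounded_above[of I "\<lambda>i. measure M (A i)" c] assms(3) by simp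
  finally show ?thesis .
qed

text \<open>All weights are at most \<open>h\<close> with \<open>h^2 = \<gamma> * sqrt n\<close>,
  and the increments of \<open>F\<close> are at most \<open>m * h / sqrt n\<close>. The squared
  variance term is then proportional to \<open>h^2 / n\<close>, that is, to
  \<open>\<gamma> / sqrt n\<close>; the fourth-power term is proportional to
  \<open>\<gamma> * h / n\<close> and is no larger in order because
  \<open>h \<le> sqrt n\<close>.\<close>

lemma (in prob_space) emp_shift_tail:
  fixes X :: "nat \<Rightarrow> 'a \<Rightarrow> real" and w s :: "nat \<Rightarrow> real" and z m B \<gamma> :: real and \<delta> :: "nat \<Rightarrow> real"
  assumes ind: "indep_vars (\<lambda>_. borel) X {1..n}"
    and F: "\<And>i s. i \<in> {1..n} \<Longrightarrow> prob {\<omega> \<in> space M. X i \<omega> \<le> s} = F s"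
    and t: "0 < t" and n: "1 \<le> n"
    and w: "\<And>i. i \<in> {1..n} \<Longrightarrow> 0 \<le> w i" "\<And>i. i \<in> {1..n} \<Longrightarrow> w i \<le> \<delta> i"
    and \<delta>: "\<And>i. i \<in> {1..n} \<Longrightarrow> (\<delta> i)\<^sup>2 \<le> \<gamma> * sqrt n" "(\<Sum>i=1..n. (\<delta> i)\<^sup>2) \<le> n * B"
    and \<gamma>: "0 < \<gamma>" "\<gamma> \<le> 1" and m: "0 \<le> m"
    and s: "\<And>i. i \<in> {1..n} \<Longrightarrow> \<bar>F (s i) - F z\<bar> \<le> m * \<delta> i / sqrt n"
  shows "prob {\<omega> \<in> space M. t < \<bar>emp n F w s (\<lambda>i. X i \<omega>) - emp n F w (\<lambda>_. z) (\<lambda>i. X i \<omega>)\<bar>}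
    \<le> \<gamma> * (3 * m\<^sup>2 * B\<^sup>2 + 4 * m * B) / sqrt n / t ^ 4"
proof -
  define h where "h = sqrt (\<gamma> * sqrt n)"
  have sn: "1 \<le> sqrt n" "sqrt n * sqrt n = n" using n by auto
  have h: "0 \<le> h" "h\<^sup>2 = \<gamma> * sqrt n" using \<gamma> by (auto simp: h_def)
  have "h\<^sup>2 \<le> 1 * sqrt n" unfolding h(2) using \<gamma> sn by (intro mult_right_mono) auto
  also have "\<dots> \<le> sqrt n * sqrt n" using sn by (intro mult_right_mono) auto
  finally have "h\<^sup>2 \<le> (sqrt n)\<^sup>2" by (simp only: power2_eq_square)
  then have hs: "h \<le> sqrt n" by (rule power2_le_imp_le) simp
  have \<delta>h: "0 \<le> \<delta> i" "\<delta> i \<le> h" "0 \<le> w i" "w i \<le> \<delta> i" if "i \<in> {1..n}" for i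
    using w[OF that] \<delta>(1)[OF that] power2_le_imp_le[of "\<delta> i" h] h by auto
  have "0 \<le> (\<Sum>i=1..n. (\<delta> i)\<^sup>2)" by (intro sum_nonneg) auto
  then have B: "0 \<le> n * B" using \<delta>(2) by linarith
  have S2: "(\<Sum>i=1..n. (w i)\<^sup>2 * \<bar>F (s i) - F z\<bar>) \<le> m * h / sqrt n * (n * B)"
  proof -
    have "(\<Sum>i=1..n. (w i)\<^sup>2 * \<bar>F (s i) - F z\<bar>) \<le> (\<Sum>i=1..n. (\<delta> i)\<^sup>2 * (m * h / sqrt n))"
    proof (intro sum_mono mult_mono)
      fix i assume i: "i \<in> {1..n}"
      show "(w i)\<^sup>2 \<le> (\<delta> i)\<^sup>2" using \<delta>h[OF i] by (intro power_mono) auto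
      have "m * \<delta> i / sqrt n \<le> m * h / sqrt n" using \<delta>h[OF i] m sn by (intro divide_right_mono mult_left_mono) auto
      then show "\<bar>F (s i) - F z\<bar> \<le> m * h / sqrt n" using s[OF i] by linarith
    qed auto
    also have "\<dots> = m * h / sqrt n * (\<Sum>i=1..n. (\<delta> i)\<^sup>2)" by (simp add: sum_distrib_left mult_ac)
    also have "\<dots> \<le> m * h / sqrt n * (n * B)" using \<delta>(2) m h sn by (intro mult_left_mono) auto
    finally show ?thesis .
  qed
  have S4: "(\<Sum>i=1..n. w i ^ 4 * \<bar>F (s i) - F z\<bar>) \<le> h\<^sup>2 * (m * h / sqrt n * (n * B))"
  proof -
    have "(\<Sum>i=1..n. w i ^ 4 * \<bar>F (s i) - F z\<bar>) \<le> (\<Sum>i=1..n. h\<^sup>2 * ((w i)\<^sup>2 * \<bar>F (s i) - F z\<bar>))"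
    proof (intro sum_mono)
      fix i assume i: "i \<in> {1..n}"
      have "(w i)\<^sup>2 \<le> h\<^sup>2" using \<delta>h[OF i] by (intro power_mono) auto
      then have "(w i)\<^sup>2 * ((w i)\<^sup>2 * \<bar>F (s i) - F z\<bar>) \<le> h\<^sup>2 * ((w i)\<^sup>2 * \<bar>F (s i) - F z\<bar>)"
        by (intro mult_right_mono) auto
      then show "w i ^ 4 * \<bar>F (s i) - F z\<bar> \<le> h\<^sup>2 * ((w i)\<^sup>2 * \<bar>F (s i) - F z\<bar>)"
        by (simp add: power4_eq_xxxx power2_eq_square mult_ac)
    qed
    also have "\<dots> \<le> h\<^sup>2 * (m * h / sqrt n * (n * B))" unfolding sum_distrib_left[symmetric] using S2 by (intro mult_left_mono) auto
    finally show ?thesis .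
  qed
  have e2: "(m * h / sqrt n * (n * B))\<^sup>2 / n\<^sup>2 = \<gamma> * (m\<^sup>2 * B\<^sup>2) / sqrt n"
  proof -
    have "(m * h / sqrt n * (n * B))\<^sup>2 / n\<^sup>2 = m\<^sup>2 * B\<^sup>2 * h\<^sup>2 / (sqrt n * sqrt n)"
      using n by (simp add: power_mult_distrib power_divide power2_eq_square[of "sqrt n"] del: real_sqrt_mult_self)
    also have "\<dots> = \<gamma> * (m\<^sup>2 * B\<^sup>2) / sqrt n"
    proof -
      have "a * (\<gamma> * q) / (q * q) = \<gamma> * a / q" if "q \<noteq> 0" for a q :: real using that by simp
      from this[of "sqrt n" "m\<^sup>2 * B\<^sup>2"] show ?thesis unfolding h(2) using n by simp
    qed
    finally show ?thesis .
  qed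
  have e4: "h\<^sup>2 * (m * h / sqrt n * (n * B)) / n\<^sup>2 \<le> \<gamma> * (m * B) / sqrt n"
  proof -
    have "h\<^sup>2 * (m * h / sqrt n * (n * B)) / n\<^sup>2 = \<gamma> * (m * B) * h / n"
    proof -
      have "h\<^sup>2 * (m * h / sqrt n * (n * B)) = \<gamma> * (m * B) * h * n" unfolding h(2) using n by simp
      then show ?thesis using n by (simp add: power2_eq_square[of "real n"])
    qed
    also have "\<dots> \<le> \<gamma> * (m * B) * sqrt n / n"
      using hs \<gamma> m B n by (intro divide_right_mono mult_left_mono) (auto simp: zero_le_mult_iff)
    also have "\<dots> = \<gamma> * (m * B) / sqrt n" using sn n by (simp add: field_simps)
    finally show ?thesis .
  qed
  have "prob {\<omega> \<in> space M. t < \<bar>emp n F w s (\<lambda>i. X i \<omega>) - emp n F w (\<lambda>_. z) (\<lambda>i. X i \<omega>)\<bar>}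
    \<le> (3 * (\<Sum>i=1..n. (w i)\<^sup>2 * \<bar>F (s i) - F z\<bar>)\<^sup>2 + 4 * (\<Sum>i=1..n. w i ^ 4 * \<bar>F (s i) - F z\<bar>)) / n\<^sup>2 / t ^ 4"
    by (rule emp_diff_tail(1)[OF ind F t n])
  also have "\<dots> \<le> (3 * (m * h / sqrt n * (n * B))\<^sup>2 + 4 * (h\<^sup>2 * (m * h / sqrt n * (n * B)))) / n\<^sup>2 / t ^ 4"
    using S2 S4 t by (intro divide_right_mono add_mono mult_left_mono power_mono sum_nonneg) auto
  also have "\<dots> = (3 * ((m * h / sqrt n * (n * B))\<^sup>2 / n\<^sup>2) + 4 * (h\<^sup>2 * (m * h / sqrt n * (n * B)) / n\<^sup>2)) / t ^ 4"
    by (simp add: add_divide_distrib)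
  also have "\<dots> \<le> (3 * (\<gamma> * (m\<^sup>2 * B\<^sup>2) / sqrt n) + 4 * (\<gamma> * (m * B) / sqrt n)) / t ^ 4"
    unfolding e2 using e4 t by (intro divide_right_mono add_mono) auto
  also have "\<dots> = \<gamma> * (3 * m\<^sup>2 * B\<^sup>2 + 4 * m * B) / sqrt n / t ^ 4"
    by (simp add: add_divide_distrib distrib_left mult_ac)
  finally show ?thesis .
qed

text \<open>The bound is free of \<open>n\<close>, \<open>J\<close>, \<gamma> and \<rho>, which is
  why \<open>C0\<close> can be chosen before the radius and the net. Half of \<open>C0\<close> is
  spent on the left end point and half on the chained increments.\<close>

lemma (in prob_space) emp_chaining:
  fixes X :: "nat \<Rightarrow> 'a \<Rightarrow> real" and w :: "nat \<Rightarrow> real" and a0 b0 B \<gamma> \<rho> L :: real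
  assumes ind: "indep_vars (\<lambda>_. borel) X {1..n}"
    and F: "\<And>i s. i \<in> {1..n} \<Longrightarrow> prob {\<omega> \<in> space M. X i \<omega> \<le> s} = F s"
    and n: "1 \<le> n"
    and w: "\<And>i. i \<in> {1..n} \<Longrightarrow> (w i)\<^sup>2 \<le> \<gamma> * sqrt n" "(\<Sum>i=1..n. (w i)\<^sup>2) \<le> n * B"
    and \<gamma>: "0 < \<gamma>" "\<gamma> \<le> 1" "\<gamma> \<le> \<rho>" and ab: "a0 < b0"
    and L: "0 < L" "\<And>s t. s \<in> {a0..b0} \<Longrightarrow> t \<in> {a0..b0} \<Longrightarrow> \<bar>F s - F t\<bar> \<le> L * \<bar>s - t\<bar>"
    and J: "2 ^ J \<le> 2 * ((b0 - a0) * sqrt n / \<rho>)" and C0: "0 < C0"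
  shows "prob {\<omega> \<in> space M. \<exists>j\<le>2 ^ J. C0 < \<bar>emp n F w (\<lambda>_. dyadic a0 b0 J j) (\<lambda>i. X i \<omega>)\<bar>}
    \<le> (30000 * ((3 * L\<^sup>2 * B\<^sup>2 + 8 * L * B) * (b0 - a0)\<^sup>2) + (3 * B\<^sup>2 + 4 * B)) / (C0 / 2) ^ 4"
proof -
  have mX [measurable]: "X i \<in> borel_measurable M" if "i \<in> {1..n}" for i
    using ind that by (auto simp: indep_vars_def)
  define P where "P j \<omega> = emp n F w (\<lambda>_. dyadic a0 b0 J j) (\<lambda>i. X i \<omega>)" for j \<omega>
  have mP [measurable]: "P j \<in> borel_measurable M" for j
    unfolding P_def emp_def of_bool_def by measurable
  have sn: "1 \<le> sqrt n" "sqrt n * sqrt n = n" using n by auto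
  have "0 \<le> (\<Sum>i=1..n. (w i)\<^sup>2)" by (intro sum_nonneg) auto
  then have "0 \<le> n * B" using w(2) by linarith
  then have B: "0 \<le> B" using n by (simp add: zero_le_mult_iff)
  have W4: "(\<Sum>i=1..n. w i ^ 4) \<le> \<gamma> * sqrt n * (n * B)"
  proof -
    have "(\<Sum>i=1..n. w i ^ 4) \<le> (\<Sum>i=1..n. (\<gamma> * sqrt n) * (w i)\<^sup>2)"
    proof (intro sum_mono)
      fix i assume "i \<in> {1..n}"
      from mult_right_mono[OF w(1)[OF this], of "(w i)\<^sup>2"]
      show "w i ^ 4 \<le> (\<gamma> * sqrt n) * (w i)\<^sup>2" by (simp add: power4_eq_xxxx power2_eq_square)
    qed
    also have "\<dots> \<le> \<gamma> * sqrt n * (n * B)" unfolding sum_distrib_left[symmetric] using w(2) \<gamma> by (intro mult_left_mono) auto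
    finally show ?thesis .
  qed
  have dy: "dyadic a0 b0 J j \<in> {a0..b0}" if "j \<le> 2 ^ J" for j
    by (rule dyadic_mem[OF ab that])
  let ?K = "(3 * L\<^sup>2 * B\<^sup>2 + 8 * L * B) * (b0 - a0)\<^sup>2"
  have inc: "prob {\<omega> \<in> space M. t < \<bar>P j \<omega> - P i \<omega>\<bar>} \<le> ?K * (real (j - i) / 2 ^ J)\<^sup>2 / t ^ 4"
    if ij: "i < j" "j \<le> 2 ^ J" and t: "0 < t" for i j t
  proof -
    define \<Delta> where "\<Delta> = (b0 - a0) * (real (j - i) / 2 ^ J)"
    define v where "v = \<bar>F (dyadic a0 b0 J j) - F (dyadic a0 b0 J i)\<bar>"
    have "dyadic a0 b0 J j - dyadic a0 b0 J i = \<Delta>"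
      using ij by (simp add: dyadic_def \<Delta>_def of_nat_diff diff_divide_distrib right_diff_distrib)
    moreover have \<Delta>: "0 \<le> \<Delta>" using ab by (simp add: \<Delta>_def)
    ultimately have v: "0 \<le> v" "v \<le> L * \<Delta>"
      unfolding v_def using L(2)[of "dyadic a0 b0 J j" "dyadic a0 b0 J i"] dy[of i] dy[of j] ij by auto
    \<comment> \<open>The fourth powers contribute a term that is only linear in \<Delta>, with a
      factor \<open>\<gamma> / sqrt n\<close>. No increment is shorter than the mesh, so
      \<open>1 / sqrt n\<close> can be traded for a second factor \<Delta>; the resulting
      \<open>\<gamma> / \<rho>\<close> is at most 1. This produces the square that chaining
      requires.\<close>
    have s: "1 / sqrt n \<le> 2 * \<Delta> / \<rho>"
    proof -
      have "1 * (\<rho> * 2 ^ J) \<le> real (j - i) * (2 * ((b0 - a0) * sqrt n))"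
      proof (rule mult_mono)
        show "\<rho> * 2 ^ J \<le> 2 * ((b0 - a0) * sqrt n)" using J \<gamma> by (simp add: pos_le_divide_eq mult.commute)
      qed (use \<gamma> ij in auto)
      then show ?thesis unfolding \<Delta>_def using \<gamma> sn by (simp add: field_simps)
    qed
    have A: "(\<Sum>i=1..n. (w i)\<^sup>2) * v \<le> n * B * (L * \<Delta>)"
      by (rule mult_mono) (use v w(2) B in auto)
    have A': "(\<Sum>i=1..n. w i ^ 4) * v \<le> \<gamma> * sqrt n * (n * B) * (L * \<Delta>)"
      by (rule mult_mono) (use v W4 B \<gamma> in auto)
    have A0: "0 \<le> (\<Sum>i=1..n. (w i)\<^sup>2) * v" using v by (intro mult_nonneg_nonneg sum_nonneg) auto
    have "(3 * (\<Sum>i=1..n. (w i)\<^sup>2 * v)\<^sup>2 + 4 * (\<Sum>i=1..n. w i ^ 4 * v)) / n\<^sup>2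
      \<le> (3 * (n * B * (L * \<Delta>))\<^sup>2 + 4 * (\<gamma> * sqrt n * (n * B) * (L * \<Delta>))) / n\<^sup>2"
      unfolding sum_distrib_right[symmetric]
      by (intro divide_right_mono add_mono mult_left_mono power_mono A A' A0) auto
    also have "\<dots> = 3 * B\<^sup>2 * L\<^sup>2 * \<Delta>\<^sup>2 + 4 * \<gamma> * B * L * \<Delta> * (1 / sqrt n)"
    proof -
      have "(3 * (q * q * B * (L * \<Delta>))\<^sup>2 + 4 * (\<gamma> * q * (q * q * B) * (L * \<Delta>))) / (q * q)\<^sup>2
        = 3 * B\<^sup>2 * L\<^sup>2 * \<Delta>\<^sup>2 + 4 * \<gamma> * B * L * \<Delta> * (1 / q)" if "q \<noteq> 0" for q :: real
        using that by (simp add: add_divide_distrib power2_eq_square)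
      from this[of "sqrt n"] n show ?thesis unfolding sn(2) by simp
    qed
    also have "\<dots> \<le> 3 * B\<^sup>2 * L\<^sup>2 * \<Delta>\<^sup>2 + 4 * \<gamma> * B * L * \<Delta> * (2 * \<Delta> / \<rho>)"
      using s \<gamma> B L \<Delta> by (intro add_left_mono mult_left_mono) auto
    also have "\<dots> = 3 * B\<^sup>2 * L\<^sup>2 * \<Delta>\<^sup>2 + \<gamma> / \<rho> * (8 * B * L * \<Delta>\<^sup>2)"
      by (simp add: power2_eq_square)
    also have "\<dots> \<le> 3 * B\<^sup>2 * L\<^sup>2 * \<Delta>\<^sup>2 + 1 * (8 * B * L * \<Delta>\<^sup>2)"
      using \<gamma> B L by (intro add_left_mono mult_right_mono) auto
    also have "\<dots> = ?K * (real (j - i) / 2 ^ J)\<^sup>2"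
      unfolding \<Delta>_def by algebra
    finally have "(3 * (\<Sum>i=1..n. (w i)\<^sup>2 * v)\<^sup>2 + 4 * (\<Sum>i=1..n. w i ^ 4 * v)) / n\<^sup>2 / t ^ 4
      \<le> ?K * (real (j - i) / 2 ^ J)\<^sup>2 / t ^ 4" using t by (intro divide_right_mono) auto
    then show ?thesis
      unfolding P_def using emp_diff_tail(1)[OF ind F t n, of w "\<lambda>_. dyadic a0 b0 J j" "\<lambda>_. dyadic a0 b0 J i"]
      unfolding v_def by linarith
  qed
  have K: "0 \<le> ?K" using L B by (intro mult_nonneg_nonneg add_nonneg_nonneg) auto
  have chain: "prob {\<omega> \<in> space M. \<exists>j\<le>2 ^ J. C0 / 2 < \<bar>P j \<omega> - P 0 \<omega>\<bar>} \<le> 30000 * ?K / (C0 / 2) ^ 4"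
    using C0 by (intro dyadic_chaining[OF mP inc K]) auto
  have zero: "prob {\<omega> \<in> space M. C0 / 2 < \<bar>P 0 \<omega>\<bar>} \<le> (3 * B\<^sup>2 + 4 * B) / (C0 / 2) ^ 4"
  proof -
    have "prob {\<omega> \<in> space M. C0 / 2 < \<bar>P 0 \<omega>\<bar>} \<le> (3 * (\<Sum>i=1..n. (w i)\<^sup>2)\<^sup>2 + 4 * (\<Sum>i=1..n. w i ^ 4)) / n\<^sup>2 / (C0 / 2) ^ 4"
      unfolding P_def using C0 by (intro emp_diff_tail(2)[OF ind F _ n]) auto
    also have "\<dots> \<le> (3 * (n * B)\<^sup>2 + 4 * (n * (n * B))) / n\<^sup>2 / (C0 / 2) ^ 4"
    proof -
      have "\<gamma> * sqrt n \<le> 1 * sqrt n" using \<gamma> sn by (intro mult_right_mono) auto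
      also have "\<dots> \<le> sqrt n * sqrt n" using sn by (intro mult_right_mono) auto
      finally have "\<gamma> * sqrt n * (n * B) \<le> n * (n * B)" using B sn by (intro mult_right_mono) auto
      then have "(\<Sum>i=1..n. w i ^ 4) \<le> n * (n * B)" using W4 by linarith
      then show ?thesis
        using w(2) C0 by (intro divide_right_mono add_mono mult_left_mono power_mono sum_nonneg) auto
    qed
    also have "\<dots> = (3 * B\<^sup>2 + 4 * B) / (C0 / 2) ^ 4"
      using n by (simp add: power2_eq_square add_divide_distrib)
    finally show ?thesis .
  qed
  have "{\<omega> \<in> space M. \<exists>j\<le>2 ^ J. C0 < \<bar>P j \<omega>\<bar>}
    \<subseteq> {\<omega> \<in> space M. \<exists>j\<le>2 ^ J. C0 / 2 < \<bar>P j \<omega> - P 0 \<omega>\<bar>} \<union> {\<omega> \<in> space M. C0 / 2 < \<bar>P 0 \<omega>\<bar>}"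
  proof
    fix \<omega> assume "\<omega> \<in> {\<omega> \<in> space M. \<exists>j\<le>2 ^ J. C0 < \<bar>P j \<omega>\<bar>}"
    then obtain j where j: "\<omega> \<in> space M" "j \<le> 2 ^ J" "C0 < \<bar>P j \<omega>\<bar>" by blast
    then have "C0 / 2 < \<bar>P j \<omega> - P 0 \<omega>\<bar> \<or> C0 / 2 < \<bar>P 0 \<omega>\<bar>" by linarith
    then show "\<omega> \<in> {\<omega> \<in> space M. \<exists>j\<le>2 ^ J. C0 / 2 < \<bar>P j \<omega> - P 0 \<omega>\<bar>} \<union> {\<omega> \<in> space M. C0 / 2 < \<bar>P 0 \<omega>\<bar>}"
      using j by blast
  qed
  then have "prob {\<omega> \<in> space M. \<exists>j\<le>2 ^ J. C0 < \<bar>P j \<omega>\<bar>}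
    \<le> prob ({\<omega> \<in> space M. \<exists>j\<le>2 ^ J. C0 / 2 < \<bar>P j \<omega> - P 0 \<omega>\<bar>} \<union> {\<omega> \<in> space M. C0 / 2 < \<bar>P 0 \<omega>\<bar>})"
    by (intro finite_measure_mono) auto
  also have "\<dots> \<le> prob {\<omega> \<in> space M. \<exists>j\<le>2 ^ J. C0 / 2 < \<bar>P j \<omega> - P 0 \<omega>\<bar>} + prob {\<omega> \<in> space M. C0 / 2 < \<bar>P 0 \<omega>\<bar>}"
    by (intro measure_Un_le) auto
  also have "\<dots> \<le> (30000 * ?K + (3 * B\<^sup>2 + 4 * B)) / (C0 / 2) ^ 4"
    using chain zero by (simp add: add_divide_distrib)
  finally show ?thesis unfolding P_def .
qed

text \<open>There are two kinds of failure: large values at base points, made rare by a large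
  \<open>C0\<close>, and large shift increments, whose total probability is proportional to
  \<gamma>.\<close>

lemma (in prob_space) grid_good_prob:
  fixes X :: "nat \<Rightarrow> 'a \<Rightarrow> real" and d :: "nat \<Rightarrow> 'b::euclidean_space" and a0 b0 B C \<gamma> \<rho> L C0 \<tau> :: real
  assumes ind: "indep_vars (\<lambda>_. borel) X {1..n}"
    and F: "\<And>i s. i \<in> {1..n} \<Longrightarrow> prob {\<omega> \<in> space M. X i \<omega> \<le> s} = F s"
    and n: "1 \<le> n"
    and d: "\<And>i. i \<in> {1..n} \<Longrightarrow> (norm (d i))\<^sup>2 \<le> \<gamma> * sqrt n" "(\<Sum>i=1..n. (norm (d i))\<^sup>2) \<le> n * B"
    and \<gamma>: "0 < \<gamma>" "\<gamma> \<le> 1" "\<gamma> \<le> \<rho>" "(C + 2 * \<rho>)\<^sup>2 * \<gamma> \<le> 1" and ab: "a0 < b0"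
    and L: "0 < L" "\<And>s t. s \<in> {a0 - 1..b0 + 1} \<Longrightarrow> t \<in> {a0 - 1..b0 + 1} \<Longrightarrow> \<bar>F s - F t\<bar> \<le> L * \<bar>s - t\<bar>"
    and J: "2 ^ J \<le> 2 * ((b0 - a0) * sqrt n / \<rho>)" and C0: "0 < C0" and \<tau>: "0 < \<tau>"
    and \<Theta>: "finite \<Theta>" "\<And>\<theta>. \<theta> \<in> \<Theta> \<Longrightarrow> norm \<theta> \<le> C" and C: "0 \<le> C"
  shows "prob {\<omega> \<in> space M. \<not> grid_good n F (dyadic a0 b0 J) (2 ^ J) \<rho> \<Theta> C0 \<tau> d (\<lambda>i. X i \<omega>)}
    \<le> DIM('b) * (2 * ((30000 * ((3 * L\<^sup>2 * B\<^sup>2 + 8 * L * B) * (b0 - a0)\<^sup>2) + (3 * B\<^sup>2 + 4 * B)) / (C0 / 2) ^ 4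
      + card \<Theta> * (8 * ((b0 - a0) / \<rho>)) * (\<gamma> * (3 * (L * (C + 2 * \<rho>))\<^sup>2 * B\<^sup>2 + 4 * (L * (C + 2 * \<rho>)) * B)) / \<tau> ^ 4))"
proof -
  let ?z = "dyadic a0 b0 J" and ?w = "\<lambda>\<sigma> b. part_weight \<sigma> b d"
  let ?c = "\<gamma> * (3 * (L * (C + 2 * \<rho>))\<^sup>2 * B\<^sup>2 + 4 * (L * (C + 2 * \<rho>)) * B)"
  let ?e = "(30000 * ((3 * L\<^sup>2 * B\<^sup>2 + 8 * L * B) * (b0 - a0)\<^sup>2) + (3 * B\<^sup>2 + 4 * B)) / (C0 / 2) ^ 4"
  have mX [measurable]: "X i \<in> borel_measurable M" if "i \<in> {1..n}" for i
    using ind that by (auto simp: indep_vars_def)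
  have sn: "1 \<le> sqrt n" "sqrt n * sqrt n = n" using n by auto
  have \<rho>: "0 < \<rho>" using \<gamma> by linarith
  have "0 \<le> (\<Sum>i=1..n. (norm (d i))\<^sup>2)" by (intro sum_nonneg) auto
  then have "0 \<le> n * B" using d(2) by linarith
  then have B: "0 \<le> B" using n by (simp add: zero_le_mult_iff)
  have me [measurable]: "(\<lambda>\<omega>. emp n F w s (\<lambda>i. X i \<omega>)) \<in> borel_measurable M" for w s
    unfolding emp_def of_bool_def by measurable
  have z: "?z j \<in> {a0..b0}" if "j \<le> 2 ^ J" for j
    by (rule dyadic_mem[OF ab that])
  define A where "A \<sigma> b = {\<omega> \<in> space M. \<exists>j\<le>2 ^ J. C0 < \<bar>emp n F (?w \<sigma> b) (\<lambda>_. ?z j) (\<lambda>i. X i \<omega>)\<bar>}" for \<sigma> b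
  define D where "D \<sigma> b j \<theta> \<nu> = {\<omega> \<in> space M. \<tau> < \<bar>emp n F (?w \<sigma> b) (shifted n \<rho> (?z j) d \<theta> \<nu>) (\<lambda>i. X i \<omega>)
        - emp n F (?w \<sigma> b) (\<lambda>_. ?z j) (\<lambda>i. X i \<omega>)\<bar>}" for \<sigma> b j \<theta> \<nu>
  have [measurable]: "A \<sigma> b \<in> sets M" "D \<sigma> b j \<theta> \<nu> \<in> sets M" for \<sigma> b j \<theta> \<nu>
    unfolding A_def D_def by measurable
  have PA: "prob (A \<sigma> b) \<le> ?e" if b: "b \<in> Basis" "\<sigma> \<in> {1, -1}" for \<sigma> b
    unfolding A_def
  proof (rule emp_chaining[OF ind F n _ _ \<gamma>(1-3) ab L(1) _ J C0])
    have sq: "(?w \<sigma> b i)\<^sup>2 \<le> (norm (d i))\<^sup>2" for i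
      using part_weight_bounds[OF b, of d i] by (intro power_mono) auto
    show "(?w \<sigma> b i)\<^sup>2 \<le> \<gamma> * sqrt n" if "i \<in> {1..n}" for i using sq[of i] d(1)[OF that] by linarith
    have "(\<Sum>i=1..n. (?w \<sigma> b i)\<^sup>2) \<le> (\<Sum>i=1..n. (norm (d i))\<^sup>2)" using sq by (intro sum_mono)
    then show "(\<Sum>i=1..n. (?w \<sigma> b i)\<^sup>2) \<le> n * B" using d(2) by linarith
    show "\<bar>F s - F t\<bar> \<le> L * \<bar>s - t\<bar>" if "s \<in> {a0..b0}" "t \<in> {a0..b0}" for s t
      using that by (intro L(2)) auto
  qed
  have PD: "prob (D \<sigma> b j \<theta> \<nu>) \<le> ?c / sqrt n / \<tau> ^ 4"
    if b: "b \<in> Basis" "\<sigma> \<in> {1, -1}" and j: "j \<le> 2 ^ J" and \<theta>: "\<theta> \<in> \<Theta>" and \<nu>: "\<nu> \<in> {1, -1}" for \<sigma> b j \<theta> \<nu>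
    unfolding D_def
  proof (rule emp_shift_tail[where \<delta> = "\<lambda>i. norm (d i)", OF ind F \<tau> n _ _ d \<gamma>(1,2)])
    show "0 \<le> ?w \<sigma> b i" "?w \<sigma> b i \<le> norm (d i)" for i using part_weight_bounds[OF b] by auto
    show "0 \<le> L * (C + 2 * \<rho>)" using L C \<rho> by auto
    fix i assume i: "i \<in> {1..n}"
    have "\<bar>d i \<bullet> \<theta>\<bar> \<le> C * norm (d i)"
      using Cauchy_Schwarz_ineq2[of "d i" \<theta>] mult_left_mono[OF \<Theta>(2)[OF \<theta>], of "norm (d i)"] by (simp add: mult.commute)
    moreover have "\<bar>\<nu> * (2 * \<rho> * norm (d i))\<bar> = 2 * \<rho> * norm (d i)" using \<nu> \<rho> by (auto simp: abs_mult)
    ultimately have num: "\<bar>d i \<bullet> \<theta> + \<nu> * (2 * \<rho> * norm (d i))\<bar> \<le> (C + 2 * \<rho>) * norm (d i)"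
      unfolding distrib_right by linarith
    have sh: "\<bar>shifted n \<rho> (?z j) d \<theta> \<nu> i - ?z j\<bar> \<le> (C + 2 * \<rho>) * norm (d i) / sqrt n"
      using num sn by (simp add: shifted_def abs_divide divide_right_mono)
    \<comment> \<open>Shifted thresholds stay within distance 1 of the base interval, where the
      Lipschitz bound for \<open>F\<close> is available. This is the role of
      \<open>(C + 2 * \<rho>)\<^sup>2 * \<gamma> \<le> 1\<close>.\<close>
    also have "\<dots> \<le> 1"
    proof -
      have "((C + 2 * \<rho>) * norm (d i))\<^sup>2 \<le> (C + 2 * \<rho>)\<^sup>2 * (\<gamma> * sqrt n)"
        unfolding power_mult_distrib using d(1)[OF i] by (intro mult_left_mono) auto
      also have "\<dots> = ((C + 2 * \<rho>)\<^sup>2 * \<gamma>) * sqrt n" by simp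
      also have "\<dots> \<le> 1 * sqrt n" using \<gamma>(4) sn by (intro mult_right_mono) auto
      also have "\<dots> \<le> sqrt n * sqrt n" using sn by (intro mult_right_mono) auto
      finally have "((C + 2 * \<rho>) * norm (d i))\<^sup>2 \<le> (sqrt n)\<^sup>2" by (simp only: power2_eq_square)
      then have "(C + 2 * \<rho>) * norm (d i) \<le> sqrt n" by (rule power2_le_imp_le) simp
      then show ?thesis using sn by (simp add: pos_divide_le_eq)
    qed
    finally have "\<bar>F (shifted n \<rho> (?z j) d \<theta> \<nu> i) - F (?z j)\<bar> \<le> L * \<bar>shifted n \<rho> (?z j) d \<theta> \<nu> i - ?z j\<bar>"
      using z[OF j] by (intro L(2)) auto
    also have "\<dots> \<le> L * ((C + 2 * \<rho>) * norm (d i) / sqrt n)" using sh L by (intro mult_left_mono) auto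
    finally show "\<bar>F (shifted n \<rho> (?z j) d \<theta> \<nu> i) - F (?z j)\<bar> \<le> L * (C + 2 * \<rho>) * norm (d i) / sqrt n" by (simp add: mult_ac)
  qed
  define U where "U \<sigma> b = A \<sigma> b \<union> (\<Union>j\<in>{..2 ^ J}. \<Union>\<theta>\<in>\<Theta>. \<Union>\<nu>\<in>{1, -1}. D \<sigma> b j \<theta> \<nu>)" for \<sigma> b
  have mU [measurable]: "U \<sigma> b \<in> sets M" for \<sigma> b
    unfolding U_def using \<Theta>(1) by (intro sets.Un sets.finite_UN) auto
  have c0: "0 \<le> ?c" using \<gamma> L C \<rho> B by (intro mult_nonneg_nonneg add_nonneg_nonneg) auto
  have PU: "prob (U \<sigma> b) \<le> ?e + card \<Theta> * (8 * ((b0 - a0) / \<rho>)) * ?c / \<tau> ^ 4" if b: "b \<in> Basis" "\<sigma> \<in> {1, -1}" for \<sigma> b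
  proof -
    have "prob (U \<sigma> b) \<le> prob (A \<sigma> b) + prob (\<Union>j\<in>{..2 ^ J}. \<Union>\<theta>\<in>\<Theta>. \<Union>\<nu>\<in>{1, -1}. D \<sigma> b j \<theta> \<nu>)"
      unfolding U_def using \<Theta>(1) by (intro measure_Un_le sets.finite_UN) auto
    also have "prob (\<Union>j\<in>{..2 ^ J}. \<Union>\<theta>\<in>\<Theta>. \<Union>\<nu>\<in>{1, -1}. D \<sigma> b j \<theta> \<nu>)
      \<le> card {..(2::nat) ^ J} * (card \<Theta> * (card {1, -1 :: real} * (?c / sqrt n / \<tau> ^ 4)))"
      using \<Theta>(1) PD[OF b] by (intro measure_UN_le_const sets.finite_UN) auto
    also have "\<dots> = (real (2 ^ J) + 1) * (card \<Theta> * (2 * (?c / sqrt n / \<tau> ^ 4)))" by (simp add: add.commute)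
    \<comment> \<open>The number of grid points, at most \<open>2 * 2 ^ J\<close>, is of order
      \<open>sqrt n\<close> and cancels the \<open>1 / sqrt n\<close> in the probability of each
      shift.\<close>
    also have "\<dots> \<le> (4 * ((b0 - a0) * sqrt n / \<rho>)) * (card \<Theta> * (2 * (?c / sqrt n / \<tau> ^ 4)))"
    proof (rule mult_right_mono)
      have "(1::real) \<le> 2 ^ J" by simp
      then show "real (2 ^ J) + 1 \<le> 4 * ((b0 - a0) * sqrt n / \<rho>)"
        using J unfolding of_nat_power of_nat_numeral by linarith
    qed (use c0 \<tau> in auto)
    also have "\<dots> = card \<Theta> * (8 * ((b0 - a0) / \<rho>)) * ?c / \<tau> ^ 4"
    proof -
      have "(4 * (x * q / \<rho>)) * (y * (2 * (c / q / s))) = y * (8 * (x / \<rho>)) * c / s" if "q \<noteq> 0" for x q y c s :: real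
        using that by simp
      from this[of "sqrt n"] n show ?thesis by simp
    qed
    finally show ?thesis using PA[OF b] by linarith
  qed
  have "{\<omega> \<in> space M. \<not> grid_good n F ?z (2 ^ J) \<rho> \<Theta> C0 \<tau> d (\<lambda>i. X i \<omega>)} \<subseteq> (\<Union>b\<in>Basis. \<Union>\<sigma>\<in>{1, -1}. U \<sigma> b)"
  proof
    fix \<omega> assume "\<omega> \<in> {\<omega> \<in> space M. \<not> grid_good n F ?z (2 ^ J) \<rho> \<Theta> C0 \<tau> d (\<lambda>i. X i \<omega>)}"
    then have w: "\<omega> \<in> space M" and ng: "\<not> grid_good n F ?z (2 ^ J) \<rho> \<Theta> C0 \<tau> d (\<lambda>i. X i \<omega>)" by auto
    from ng obtain b \<sigma> j where b: "b \<in> Basis" "\<sigma> \<in> {1, -1}" "j \<le> 2 ^ J"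
      and alt: "C0 < \<bar>emp n F (?w \<sigma> b) (\<lambda>_. ?z j) (\<lambda>i. X i \<omega>)\<bar> \<or> (\<exists>\<theta>\<in>\<Theta>. \<exists>\<nu>\<in>{1, -1}. \<tau> < \<bar>emp n F (?w \<sigma> b) (shifted n \<rho> (?z j) d \<theta> \<nu>) (\<lambda>i. X i \<omega>)
        - emp n F (?w \<sigma> b) (\<lambda>_. ?z j) (\<lambda>i. X i \<omega>)\<bar>)"
      unfolding grid_good_def not_le[symmetric] by blast
    from alt have "\<omega> \<in> U \<sigma> b"
    proof
      assume "C0 < \<bar>emp n F (?w \<sigma> b) (\<lambda>_. ?z j) (\<lambda>i. X i \<omega>)\<bar>"
      then have "\<omega> \<in> A \<sigma> b" using w b(3) unfolding A_def by blast
      then show ?thesis unfolding U_def by blast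
    next
      assume "\<exists>\<theta>\<in>\<Theta>. \<exists>\<nu>\<in>{1, -1}. \<tau> < \<bar>emp n F (?w \<sigma> b) (shifted n \<rho> (?z j) d \<theta> \<nu>) (\<lambda>i. X i \<omega>)
        - emp n F (?w \<sigma> b) (\<lambda>_. ?z j) (\<lambda>i. X i \<omega>)\<bar>"
      then obtain \<theta> \<nu> where "\<theta> \<in> \<Theta>" "\<nu> \<in> {1, -1}" "\<omega> \<in> D \<sigma> b j \<theta> \<nu>" unfolding D_def using w by blast
      then show ?thesis using b(3) unfolding U_def by blast
    qed
    then show "\<omega> \<in> (\<Union>b\<in>Basis. \<Union>\<sigma>\<in>{1, -1}. U \<sigma> b)" using b by blast
  qed
  then have "prob {\<omega> \<in> space M. \<not> grid_good n F ?z (2 ^ J) \<rho> \<Theta> C0 \<tau> d (\<lambda>i. X i \<omega>)} \<le> prob (\<Union>b\<in>Basis. \<Union>\<sigma>\<in>{1, -1}. U \<sigma> b)"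
    by (intro finite_measure_mono sets.finite_UN) auto
  also have "\<dots> \<le> card (Basis :: 'b set) * (card {1, -1 :: real} * (?e + card \<Theta> * (8 * ((b0 - a0) / \<rho>)) * ?c / \<tau> ^ 4))"
    using PU by (intro measure_UN_le_const sets.finite_UN) auto
  finally show ?thesis by simp
qed

lemma dyadic_scale_exists: "1 \<le> x \<Longrightarrow> \<exists>J. x \<le> 2 ^ J \<and> 2 ^ J \<le> 2 * (x::real)"
proof -
  assume x: "1 \<le> x"
  define J where "J = (LEAST J. x \<le> 2 ^ J)"
  obtain k where "x < 2 ^ k" using real_arch_pow[of 2 x] by auto
  then have "x \<le> 2 ^ k" by simp
  then have J: "x \<le> 2 ^ J" unfolding J_def by (rule LeastI[where P = "\<lambda>J. x \<le> 2 ^ J"])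
  have "2 ^ J \<le> 2 * x"
  proof (cases J)
    case (Suc i)
    then have "i < (LEAST J. x \<le> 2 ^ J)" unfolding J_def by simp
    then have "\<not> x \<le> 2 ^ i" by (rule not_less_Least)
    then show ?thesis using Suc by simp
  qed (use x in auto)
  then show ?thesis using J by blast
qed

text \<open>The predicate \<open>G\<close> is separated into a measurability clause, a probability
  bound for each fixed design, and a purely deterministic consequence. The bound for fixed designs
  extends to a random design by conditioning, and the consequence is then used pointwise.\<close>

definition (in prob_space) linearizing ::
    "nat \<Rightarrow> (real \<Rightarrow> real) \<Rightarrow> (real \<Rightarrow> real) \<Rightarrow> real set \<Rightarrow> real \<Rightarrow> real \<Rightarrow> real \<Rightarrow> real \<Rightarrow> real \<Rightarrow> real \<Rightarrow>
      ((nat \<Rightarrow> 'b::euclidean_space) \<Rightarrow> (nat \<Rightarrow> real) \<Rightarrow> bool) \<Rightarrow> bool" where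
  "linearizing n F f I B \<gamma> \<eta> C0 C \<tau> G \<longleftrightarrow>
     {p \<in> space (PiM {1..n} (\<lambda>_. borel) \<Otimes>\<^sub>M PiM {1..n} (\<lambda>_. borel)). G (fst p) (snd p)}
       \<in> sets (PiM {1..n} (\<lambda>_. borel) \<Otimes>\<^sub>M PiM {1..n} (\<lambda>_. borel)) \<and>
     (\<forall>d. (\<forall>i\<in>{1..n}. 1 \<le> norm (d i) \<and> (norm (d i))\<^sup>2 \<le> \<gamma> * sqrt n) \<longrightarrow> (\<Sum>i=1..n. (norm (d i))\<^sup>2) \<le> n * B \<longrightarrow>
       (\<forall>X. indep_vars (\<lambda>_. borel) X {1..n} \<longrightarrow>
         (\<forall>i\<in>{1..n}. \<forall>s. prob {\<omega> \<in> space M. X i \<omega> \<le> s} = F s) \<longrightarrow>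
         prob {\<omega> \<in> space M. \<not> G d (\<lambda>i. X i \<omega>)} \<le> \<eta>) \<and>
       (\<forall>e. G d e \<longrightarrow> (\<forall>t\<in>I. \<exists>T. norm T \<le> C0 \<and> linear_at n d e (F t) (f t) t T C \<tau>)))"

text \<open>The constant \<open>C0\<close> does not depend on \<open>C\<close>: it is chosen first, and \<open>C\<close> is later taken large compared with it.\<close>

lemma (in prob_space) asymptotic_linearity:
  fixes F f :: "real \<Rightarrow> real" and a0 b0 B \<eta> :: real
  assumes F': "\<And>t. (F has_real_derivative f t) (at t)" and f: "continuous_on UNIV f" "\<And>t. 0 \<le> f t"
    and ab: "a0 < b0" and B: "0 < B" and \<eta>: "0 < \<eta>"
  obtains C0 :: real where "0 < C0"
    and "\<And>C \<tau> :: real. 0 < C \<Longrightarrow> 0 < \<tau> \<Longrightarrow> \<exists>\<gamma>>0. \<exists>N. \<forall>n\<ge>N.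
      \<exists>G :: (nat \<Rightarrow> 'b::euclidean_space) \<Rightarrow> _. linearizing n F f {a0..<b0} B \<gamma> \<eta> C0 C \<tau> G"
proof -
  define D where "D = real DIM('b)"
  have D: "1 \<le> D" unfolding D_def using DIM_positive[where 'a = 'b] by linarith
  obtain L where L: "0 < L" "\<And>t. t \<in> {a0 - 1..b0 + 1} \<Longrightarrow> \<bar>f t\<bar> \<le> L"
    "\<And>s t. s \<in> {a0 - 1..b0 + 1} \<Longrightarrow> t \<in> {a0 - 1..b0 + 1} \<Longrightarrow> \<bar>F s - F t\<bar> \<le> L * \<bar>s - t\<bar>"
    using derivative_lipschitz_compact[OF F' f(1), of "a0 - 1" "b0 + 1"] by blast
  define A where "A = 30000 * ((3 * L\<^sup>2 * B\<^sup>2 + 8 * L * B) * (b0 - a0)\<^sup>2) + (3 * B\<^sup>2 + 4 * B)"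
  have A: "0 \<le> A" unfolding A_def using L B by (intro add_nonneg_nonneg mult_nonneg_nonneg) auto
  \<comment> \<open>Since \<open>y \<ge> 1\<close>, also \<open>y ^ 4 \<ge> y\<close>, and
    \<open>y \<ge> 4 * D * A / \<eta>\<close> makes the chaining part of the failure probability at
    most \<open>\<eta> / 2\<close>. The tail bound involves half of \<open>c\<close>, hence
    \<open>c = 2 * y\<close>.\<close>
  define y where "y = 1 + 4 * D * A / \<eta>"
  have y: "1 \<le> y" "4 * D * A / \<eta> \<le> y" unfolding y_def using D A \<eta> by auto
  define c where "c = 2 * y"
  have c: "0 < c" "c / 2 = y" using y by (auto simp: c_def)
  have Ay: "D * (2 * (A / (c / 2) ^ 4)) \<le> \<eta> / 2"
  proof -
    have "y ^ 1 \<le> y ^ 4" using y(1) by (intro power_increasing) auto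
    then have "A / y ^ 4 \<le> A / y" using A y by (intro divide_left_mono) auto
    then have "D * (2 * (A / y ^ 4)) \<le> D * (2 * (A / y))" using D by (intro mult_left_mono) auto
    also have "\<dots> \<le> \<eta> / 2" using y \<eta> by (simp add: field_simps)
    finally show ?thesis by (simp add: c)
  qed
  show thesis
  proof (rule that[of "2 * D * c"])
    show "0 < 2 * D * c" using D c by simp
    fix C \<tau> :: real assume C: "0 < C" and \<tau>: "0 < \<tau>"
    \<comment> \<open>The error of the expansion is shared out: one half of \<tau> for the shifts on
      the grid, one quarter for the margin \<rho>, and one quarter for the linearization error
      \<omega> of \<open>F\<close>.\<close>
    define \<tau>1 where "\<tau>1 = \<tau> / (4 * D)"
    define \<rho> where "\<rho> = min 1 (\<tau> / (32 * D * L * B))"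
    define \<omega> where "\<omega> = \<tau> / (8 * D * B * (C + 4))"
    have \<tau>1: "0 < \<tau>1" and \<rho>: "0 < \<rho>" "\<rho> \<le> 1" and \<omega>: "0 < \<omega>"
      using \<tau> D L B C by (auto simp: \<tau>1_def \<rho>_def \<omega>_def)
    have err: "D * (2 * (\<tau>1 + (4 * \<rho> * L + \<omega> * (C + 4 * \<rho>)) * B)) \<le> \<tau>"
    proof -
      have "\<rho> \<le> \<tau> / (32 * D * L * B)" by (simp add: \<rho>_def)
      then have 1: "4 * \<rho> * L * B \<le> \<tau> / (8 * D)" using D L B by (simp add: field_simps)
      have "\<omega> * (C + 4 * \<rho>) * B \<le> \<omega> * (C + 4) * B" using \<rho> \<omega> B by (intro mult_right_mono mult_left_mono) auto
      also have "\<dots> = \<tau> / (8 * D)"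
      proof -
        have "x / (8 * D * B * y) * y * B = x / (8 * D)" if "y \<noteq> 0" for x y using D B that by simp
        from this[of "C + 4" \<tau>] C show ?thesis by (simp add: \<omega>_def)
      qed
      finally have "(4 * \<rho> * L + \<omega> * (C + 4 * \<rho>)) * B \<le> \<tau> / (8 * D) + \<tau> / (8 * D)"
        using 1 by (simp add: distrib_right)
      then have "\<tau>1 + (4 * \<rho> * L + \<omega> * (C + 4 * \<rho>)) * B \<le> \<tau> / (4 * D) + (\<tau> / (8 * D) + \<tau> / (8 * D))"
        unfolding \<tau>1_def by simp
      also have "\<dots> = \<tau> / (2 * D)" by simp
      finally have "\<tau>1 + (4 * \<rho> * L + \<omega> * (C + 4 * \<rho>)) * B \<le> \<tau> / (2 * D)" .
      then have "D * (2 * (\<tau>1 + (4 * \<rho> * L + \<omega> * (C + 4 * \<rho>)) * B)) \<le> D * (2 * (\<tau> / (2 * D)))"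
        using D by (intro mult_left_mono) auto
      then show ?thesis using D by simp
    qed
    obtain \<kappa> where \<kappa>: "0 < \<kappa>" "\<And>t s. t \<in> {a0..b0} \<Longrightarrow> \<bar>s - t\<bar> \<le> \<kappa> \<Longrightarrow> \<bar>F s - F t - f t * (s - t)\<bar> \<le> \<omega> * \<bar>s - t\<bar>"
      using derivative_uniform_linearization[OF F' f(1) \<omega>, of a0 b0] by blast
    have cover: "cball (0::'b) C \<subseteq> (\<Union>x\<in>cball 0 C. ball x \<rho>)" using \<rho>(1) by force
    obtain \<Theta> where \<Theta>: "finite \<Theta>" "\<Theta> \<subseteq> cball (0::'b) C" "cball 0 C \<subseteq> (\<Union>x\<in>\<Theta>. ball x \<rho>)"
      using compactE_image[OF compact_cball open_ball cover] by metis
    have net: "\<exists>\<theta>'\<in>\<Theta>. norm (\<theta> - \<theta>') \<le> \<rho>" if \<theta>: "norm \<theta> \<le> C" for \<theta> :: 'b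
    proof -
      have "\<theta> \<in> cball 0 C" using \<theta> by simp
      then obtain \<theta>' where "\<theta>' \<in> \<Theta>" "\<theta> \<in> ball \<theta>' \<rho>" using \<Theta>(3) by blast
      then show ?thesis by (auto simp: dist_norm norm_minus_commute intro!: bexI[of _ \<theta>'])
    qed
    define K where "K = D * (2 * (card \<Theta> * (8 * ((b0 - a0) / \<rho>)) * (3 * (L * (C + 2 * \<rho>))\<^sup>2 * B\<^sup>2 + 4 * (L * (C + 2 * \<rho>)) * B) / \<tau>1 ^ 4))"
    have K: "0 \<le> K"
      unfolding K_def using D ab \<rho> L C B \<tau>1 by (intro mult_nonneg_nonneg add_nonneg_nonneg divide_nonneg_nonneg) auto
    \<comment> \<open>The entry \<rho> serves the chaining,
      \<open>1 / (C + 2 * \<rho>)\<^sup>2\<close> keeps shifted thresholds near the base interval,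
      the entry with \<kappa> keeps them where \<open>F\<close> is linearized, and the last one
      makes \<open>\<gamma> * K\<close> at most \<open>\<eta> / 2\<close>; adding 1 to
      \<open>K\<close> covers \<open>K = 0\<close>.\<close>
    define \<gamma> where "\<gamma> = Min {1, \<rho>, 1 / (C + 2 * \<rho>)\<^sup>2, (\<kappa> / (C + 4 * \<rho>))\<^sup>2, \<eta> / 2 / (K + 1)}"
    have pos: "0 < C + 2 * \<rho>" "0 < C + 4 * \<rho>" using C \<rho> by auto
    have \<gamma>0: "0 < \<gamma>" unfolding \<gamma>_def using \<rho> pos \<kappa>(1) \<eta> K by (subst Min_gr_iff) auto
    have "\<gamma> \<le> 1" "\<gamma> \<le> \<rho>" "\<gamma> \<le> 1 / (C + 2 * \<rho>)\<^sup>2" and \<gamma>\<kappa>: "\<gamma> \<le> (\<kappa> / (C + 4 * \<rho>))\<^sup>2" and \<gamma>K: "\<gamma> \<le> \<eta> / 2 / (K + 1)"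
      unfolding \<gamma>_def by (intro Min_le; simp)+
    then have \<gamma>: "0 < \<gamma>" "\<gamma> \<le> 1" "\<gamma> \<le> \<rho>" "(C + 2 * \<rho>)\<^sup>2 * \<gamma> \<le> 1"
      using \<gamma>0 pos by (auto simp: pos_le_divide_eq mult.commute)
    have K\<gamma>: "\<gamma> * K \<le> \<eta> / 2"
    proof -
      have "\<gamma> * (K + 1) \<le> \<eta> / 2" using \<gamma>K K pos_le_divide_eq[of "K + 1" \<gamma> "\<eta> / 2"] by simp
      then show ?thesis using \<gamma> by (simp add: distrib_left)
    qed
    obtain N where N: "\<And>n. N \<le> n \<Longrightarrow> max 1 ((\<rho> / (b0 - a0))\<^sup>2) \<le> real n"
      using eventually_real_ge[of "max 1 ((\<rho> / (b0 - a0))\<^sup>2)"] unfolding eventually_sequentially by blast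
    show "\<exists>\<gamma>>0. \<exists>N. \<forall>n\<ge>N. \<exists>G :: (nat \<Rightarrow> 'b) \<Rightarrow> _. linearizing n F f {a0..<b0} B \<gamma> \<eta> (2 * D * c) C \<tau> G"
    proof (rule exI[of _ \<gamma>], intro conjI, rule \<gamma>(1), rule exI[of _ N], intro allI impI)
      fix n assume "N \<le> n"
      from N[OF this] have n: "1 \<le> n" "(\<rho> / (b0 - a0))\<^sup>2 \<le> n" by auto
      have sn: "1 \<le> sqrt n" "sqrt n * sqrt n = n" using n by auto
      have "1 \<le> (b0 - a0) * sqrt n / \<rho>"
      proof -
        have "\<rho> / (b0 - a0) \<le> sqrt n" using n(2) by (intro real_le_rsqrt)
        then show ?thesis using ab \<rho> by (simp add: field_simps)
      qed
      then obtain J where J: "(b0 - a0) * sqrt n / \<rho> \<le> 2 ^ J" "2 ^ J \<le> 2 * ((b0 - a0) * sqrt n / \<rho>)"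
        using dyadic_scale_exists by blast
      have mesh: "(b0 - a0) / 2 ^ J \<le> \<rho> / sqrt n" using J(1) \<rho> sn by (simp add: field_simps)
      have mF: "F \<in> borel_measurable borel"
        using F' by (intro borel_measurable_continuous_onI continuous_at_imp_continuous_on ballI DERIV_isCont) auto
      let ?G = "grid_good n F (dyadic a0 b0 J) (2 ^ J) \<rho> \<Theta> c \<tau>1"
      show "\<exists>G :: (nat \<Rightarrow> 'b) \<Rightarrow> _. linearizing n F f {a0..<b0} B \<gamma> \<eta> (2 * D * c) C \<tau> G"
        unfolding linearizing_def
      proof (rule exI[of _ ?G], intro conjI allI impI ballI)
        show "{p \<in> space (PiM {1..n} (\<lambda>_. borel) \<Otimes>\<^sub>M PiM {1..n} (\<lambda>_. borel)). ?G (fst p) (snd p)}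
          \<in> sets (PiM {1..n} (\<lambda>_. borel :: 'b::euclidean_space measure) \<Otimes>\<^sub>M PiM {1..n} (\<lambda>_. borel :: real measure))"
          by (rule measurable_grid_good[OF mF \<Theta>(1)])
      next
        fix d :: "nat \<Rightarrow> 'b" and X
        assume d: "\<forall>i\<in>{1..n}. 1 \<le> norm (d i) \<and> (norm (d i))\<^sup>2 \<le> \<gamma> * sqrt n" "(\<Sum>i=1..n. (norm (d i))\<^sup>2) \<le> n * B"
          and X: "indep_vars (\<lambda>_. borel) X {1..n}" "\<forall>i\<in>{1..n}. \<forall>s. prob {\<omega> \<in> space M. X i \<omega> \<le> s} = F s"
        have "prob {\<omega> \<in> space M. \<not> ?G d (\<lambda>i. X i \<omega>)}
          \<le> DIM('b) * (2 * ((30000 * ((3 * L\<^sup>2 * B\<^sup>2 + 8 * L * B) * (b0 - a0)\<^sup>2) + (3 * B\<^sup>2 + 4 * B)) / (c / 2) ^ 4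
            + card \<Theta> * (8 * ((b0 - a0) / \<rho>)) * (\<gamma> * (3 * (L * (C + 2 * \<rho>))\<^sup>2 * B\<^sup>2 + 4 * (L * (C + 2 * \<rho>)) * B)) / \<tau>1 ^ 4))"
          by (rule grid_good_prob[OF X(1) _ n(1) _ d(2) \<gamma> ab L(1) L(3) J(2) c(1) \<tau>1 \<Theta>(1)])
            (use X(2) d(1) \<Theta>(2) C in auto)
        also have "\<dots> = D * (2 * (A / (c / 2) ^ 4)) + \<gamma> * K"
          unfolding D_def[symmetric] A_def[symmetric] K_def by (simp add: distrib_left mult_ac)
        also have "\<dots> \<le> \<eta>" using Ay K\<gamma> by linarith
        finally show "prob {\<omega> \<in> space M. \<not> ?G d (\<lambda>i. X i \<omega>)} \<le> \<eta>" .
      next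
        fix d :: "nat \<Rightarrow> 'b" and e t
        assume d: "\<forall>i\<in>{1..n}. 1 \<le> norm (d i) \<and> (norm (d i))\<^sup>2 \<le> \<gamma> * sqrt n" "(\<Sum>i=1..n. (norm (d i))\<^sup>2) \<le> n * B"
          and G: "?G d e" and t: "t \<in> {a0..<b0}"
        have d1: "1 \<le> norm (d i)" if "i \<in> {1..n}" for i using d that by blast
        have k: "(C + 4 * \<rho>) * norm (d i) / sqrt n \<le> \<kappa>" if "i \<in> {1..n}" for i
        proof -
          have "(norm (d i))\<^sup>2 \<le> \<gamma> * sqrt n" using d(1) that by blast
          also have "\<dots> \<le> (\<kappa> / (C + 4 * \<rho>))\<^sup>2 * (sqrt n)\<^sup>2"
            using \<gamma>\<kappa> sn mult_right_mono[OF sn(1), of "sqrt n"] by (intro mult_mono) auto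
          finally have "(norm (d i))\<^sup>2 \<le> (\<kappa> / (C + 4 * \<rho>) * sqrt n)\<^sup>2" by (simp only: power_mult_distrib)
          then have "norm (d i) \<le> \<kappa> / (C + 4 * \<rho>) * sqrt n"
            using \<kappa>(1) pos by (intro power2_le_imp_le[of "norm (d i)"]) auto
          then show ?thesis using pos sn by (simp add: field_simps)
        qed
        have t1: "t \<in> {a0..b0}" "a0 \<le> t" "t < b0" using t by auto
        have fL: "f t \<le> L" using L(2)[of t] t1 by auto
        obtain T where T: "norm T \<le> 2 * DIM('b) * c"
          "linear_at n d e (F t) (f t) t T C (DIM('b) * (2 * (\<tau>1 + (4 * \<rho> * L + \<omega> * (C + 4 * \<rho>)) * B)))"
          using grid_good_linear_at[where F = F and f = f and t = t, OF n(1) ab mesh d1 d(2) k \<kappa>(2)[OF t1(1)] f(2)[of t] fL less_imp_le[OF \<omega>] \<rho>(1) net G t1(2,3)]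
          by blast
        have "linear_at n d e (F t) (f t) t T C \<tau>"
          using T(2) err unfolding linear_at_def D_def[symmetric] by (meson order.trans)
        then show "\<exists>T. norm T \<le> 2 * D * c \<and> linear_at n d e (F t) (f t) t T C \<tau>"
          using T(1) unfolding D_def by (intro exI[of _ T]) simp
      qed
    qed
  qed
qed

subsection \<open>Comparison of the two averaged quantiles\<close>

text \<open>The deterministic heart of the comparison. The expansion is used at two kinds of levels:
  at \<open>k / n\<close> for all central ranks, to confine the R-estimator, and at \<alpha> itself,
  to locate the three quantiles. Each of these solves the same linear equation up to
  \<open>2 * \<tau>\<close>, so any two differ by at most \<open>4 * \<tau> / \<phi>0\<close> at
  scale \<open>sqrt n\<close>.\<close>

lemma two_step_representation:
  fixes x :: "nat \<Rightarrow> 'a::euclidean_space" and Y e :: "nat \<Rightarrow> real" and A :: "nat \<Rightarrow> nat \<Rightarrow> real"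
    and C C' C0 \<tau> \<phi>0 \<eta> \<epsilon> q B m :: real
  assumes model: "\<And>i. i \<in> {1..n} \<Longrightarrow> Y i = \<beta>0 + x i \<bullet> \<beta> + e i"
    and c: "\<And>i. c i = x i - sample_mean n x"
    and lin: "\<And>\<alpha>. \<eta> \<le> \<alpha> \<Longrightarrow> \<alpha> \<le> 1 - \<eta> \<Longrightarrow>
      \<exists>\<phi> t T. linear_at n (\<lambda>i. (1::real, c i)) e \<alpha> \<phi> t T C' \<tau> \<and> norm T \<le> C0 \<and> \<phi>0 \<le> \<phi>"
    and \<phi>0: "0 < \<phi>0" and \<tau>: "1 < \<tau> * sqrt n" "0 < \<tau>" and C0: "0 \<le> C0"
    and q: "0 \<le> q" "q \<le> 1" and Q: "\<And>v. n * q * (norm v)\<^sup>2 \<le> (\<Sum>i=1..n. (c i \<bullet> v)\<^sup>2)"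
    and B: "(\<Sum>i=1..n. norm (c i)) \<le> n * B" "0 \<le> B" and m: "0 \<le> m"
    and A: "central_scores n \<eta>' (A n)" "norm (sample_mean n x) * \<bar>\<Sum>i=1..n. A n i\<bar> \<le> m * sqrt n"
    and \<eta>: "\<eta> \<le> \<eta>'" "\<eta> \<le> \<epsilon>" "0 < \<epsilon>" and n: "1 \<le> n * \<epsilon>"
    and C: "0 < C" "C + (C0 + 2 * \<tau>) / \<phi>0 \<le> C'" "2 * C + 1 \<le> C'" and big: "2 * (m + B) + C0 + \<tau> < \<phi>0 * C * q"
    and R: "\<And>b. is_arg_min (rank_dispersion A n Y x) (\<lambda>_. True) b \<Longrightarrow> is_arg_min (rank_dispersion A n Y x) (\<lambda>_. True) bR"
    and rq: "is_arg_min (rq_loss n \<alpha> Y x) (\<lambda>_. True) bh"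
    and \<alpha>: "\<epsilon> < \<alpha>" "\<alpha> < 1 - \<epsilon>"
  shows "\<bar>sqrt n * ((two_step_arq n \<alpha> Y x bR - \<beta>0 - sample_mean n x \<bullet> \<beta>) - order_stat n e (nat \<lfloor>n * \<alpha>\<rfloor>))\<bar> \<le> 4 * \<tau> / \<phi>0"
    and "\<bar>sqrt n * \<bar>two_step_arq n \<alpha> Y x bR - averaged_rq n x bh\<bar>\<bar> \<le> 4 * \<tau> / \<phi>0"
proof -
  define xm where "xm = sample_mean n x"
  have n1: "1 \<le> n" using n by (cases n) auto
  have sn: "0 < sqrt n" using n1 by simp
  have c0: "(\<Sum>i=1..n. c i) = 0"
    unfolding c sample_mean_def using n1 by (simp add: sum_subtractf sum_constant_scaleR)
  have xc: "x i = xm + c i" for i by (simp add: c xm_def)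
  have xc': "\<And>i. i \<in> {1..n} \<Longrightarrow> x i = xm + c i" by (simp add: xc)
  have res: "Y i - x i \<bullet> b = e i - c i \<bullet> (b - \<beta>) + (\<beta>0 - xm \<bullet> (b - \<beta>))" if "i \<in> {1..n}" for i b
    using model[OF that] by (simp add: xc inner_add_left inner_diff_right)
  have bR: "norm (bR - \<beta>) \<le> C / sqrt n"
  proof -
    obtain lo hi :: nat where lohi: "1 \<le> lo" "lo \<le> hi" "hi \<le> n" "n * \<eta>' \<le> lo" "hi \<le> n * (1 - \<eta>')"
      and s: "1 / 2 \<le> A n hi - A n lo" "sqrt n * ((A n lo - A n 1) + (A n n - A n hi)) \<le> 1"
      and mono: "\<And>k. 1 \<le> k \<Longrightarrow> k < n \<Longrightarrow> A n k \<le> A n (k + 1)"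
      using A(1) unfolding central_scores_def by blast
    have pos: "0 < - (\<Sum>i=1..n. A n (sample_rank n (\<lambda>j. Y j - x j \<bullet> (\<beta> + (C / sqrt n) *\<^sub>R u)) i) *\<^sub>R x i) \<bullet> u"
      if u: "norm u = 1" for u
    proof -
      have "0 < - (\<Sum>i=1..n. A n (sample_rank n (\<lambda>j. e j - c j \<bullet> (C *\<^sub>R u) / sqrt n) i) *\<^sub>R x i) \<bullet> u"
      proof (rule rank_gradient_positive[where lo = lo and hi = hi and C' = C' and \<tau> = \<tau> and q = q and B = B and m = m
            and ?\<phi>0.0 = \<phi>0 and ?C0.0 = C0 and xm = xm])
        fix k :: nat assume k: "lo \<le> k" "k < hi"
        have "n * \<eta> \<le> n * \<eta>'" using \<eta> by (intro mult_left_mono) auto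
        then have "n * \<eta> \<le> k" using k lohi(4) by linarith
        then have 1: "\<eta> \<le> k / n" using n1 by (simp add: pos_le_divide_eq mult.commute)
        have "n * (1 - \<eta>') \<le> n * (1 - \<eta>)" using \<eta> by (intro mult_left_mono) auto
        then have "k \<le> n * (1 - \<eta>)" using k lohi(5) by linarith
        then have 2: "k / n \<le> 1 - \<eta>" using n1 by (simp add: pos_divide_le_eq mult.commute)
        show "\<exists>\<phi> t T. linear_at n (\<lambda>i. (1::real, c i)) e (k / n) \<phi> t T C' \<tau> \<and> norm T \<le> C0 \<and> \<phi>0 \<le> \<phi>"
          by (rule lin[OF 1 2])
      qed (fact xc' c0 lohi \<phi>0 \<tau> C0 q Q B mono s A(2)[folded xm_def] less_imp_le[OF C(1)] C big u)+
      moreover have "sample_rank n (\<lambda>j. Y j - x j \<bullet> (\<beta> + (C / sqrt n) *\<^sub>R u)) i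
        = sample_rank n (\<lambda>j. e j - c j \<bullet> (C *\<^sub>R u) / sqrt n) i" if "i \<in> {1..n}" for i
        by (rule sample_rank_shift[where c = "\<beta>0 - xm \<bullet> ((C / sqrt n) *\<^sub>R u)"]) (use that in \<open>simp_all add: res\<close>)
      ultimately show ?thesis by simp
    qed
    note rb = rank_minimizer_bounded[where A = A and Y = Y and x = x and \<beta> = \<beta> and r = "C / sqrt n", OF mono _ pos]
    have "0 \<le> C / sqrt n" using C sn by simp
    \<comment> \<open>The hypothesis on \<open>bR\<close> takes effect only once some minimizer is
      known to exist; it is produced here.\<close>
    with rb(1) obtain b where "is_arg_min (rank_dispersion A n Y x) (\<lambda>_. True) b" by blast
    from rb(2)[OF _ _ _ _ R[OF this]] \<open>0 \<le> C / sqrt n\<close> show ?thesis by simp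
  qed
  define k where "k = nat \<lfloor>n * \<alpha>\<rfloor>"
  have na: "n * \<epsilon> \<le> n * \<alpha>" "n * \<alpha> \<le> n * 1" 
    using \<alpha> \<eta>(3) mult_left_mono[of \<epsilon> \<alpha> "real n"] mult_left_mono[of \<alpha> 1 "real n"] by linarith+
  have k: "1 \<le> k" "k \<le> n" "\<bar>k - n * \<alpha>\<bar> \<le> 1"
    unfolding k_def using na n by linarith+
  obtain \<phi> t T where l: "linear_at n (\<lambda>i. (1::real, c i)) e \<alpha> \<phi> t T C' \<tau>" and T: "norm T \<le> C0" and \<phi>: "\<phi>0 \<le> \<phi>"
    using lin[of \<alpha>] \<alpha> \<eta> by auto
  have \<phi>p: "0 < \<phi>" using \<phi> \<phi>0 by linarith
  have le: "(norm T + 2 * \<tau>) / \<phi> \<le> (C0 + 2 * \<tau>) / \<phi>0"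
    using T \<phi> \<phi>0 \<tau> C0 by (intro frac_le) auto
  \<comment> \<open>\<open>os 0\<close> belongs to the errors themselves, and \<open>os\<close> at
    the rescaled error of the R-estimator to the two-step residuals.\<close>
  define os where "os \<delta> = sqrt n * (order_stat n (\<lambda>i. e i - c i \<bullet> \<delta> / sqrt n) k - t)" for \<delta>
  have os: "\<bar>fst T + \<phi> * os \<delta>\<bar> \<le> 2 * \<tau>" if "norm \<delta> \<le> C" for \<delta>
    unfolding os_def using le that C by (intro order_stat_linear[OF l c0 k \<phi>p \<tau>(1)]) auto
  have close: "\<bar>a - b\<bar> \<le> 4 * \<tau> / \<phi>0" if "\<bar>fst T + \<phi> * a\<bar> \<le> 2 * \<tau>" "\<bar>fst T + \<phi> * b\<bar> \<le> 2 * \<tau>" for a b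
  proof -
    have "\<phi> * \<bar>a - b\<bar> = \<bar>(fst T + \<phi> * a) - (fst T + \<phi> * b)\<bar>"
      using \<phi>p by (simp add: abs_mult flip: right_diff_distrib)
    also have "\<dots> \<le> 4 * \<tau>" using that by linarith
    finally have "\<phi> * \<bar>a - b\<bar> \<le> 4 * \<tau>" .
    moreover have "\<phi>0 * \<bar>a - b\<bar> \<le> \<phi> * \<bar>a - b\<bar>" using \<phi> by (intro mult_right_mono) auto
    ultimately show ?thesis using \<phi>0 by (simp add: pos_le_divide_eq mult.commute)
  qed
  define \<delta> where "\<delta> = sqrt n *\<^sub>R (bR - \<beta>)"
  have \<delta>: "norm \<delta> \<le> C" unfolding \<delta>_def using bR sn by (simp add: pos_le_divide_eq mult.commute)
  have "two_step_arq n \<alpha> Y x bR = order_stat n (\<lambda>i. (e i - c i \<bullet> \<delta> / sqrt n) + (\<beta>0 + xm \<bullet> \<beta>)) k"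
    unfolding two_step_arq_def k_def[symmetric]
  proof (rule order_stat_cong)
    fix i assume "i \<in> {1..n}"
    then show "Y i - (x i - sample_mean n x) \<bullet> bR = e i - c i \<bullet> \<delta> / sqrt n + (\<beta>0 + xm \<bullet> \<beta>)"
      using model sn by (simp add: \<delta>_def c xm_def inner_diff_left inner_diff_right)
  qed
  also have "\<dots> = order_stat n (\<lambda>i. e i - c i \<bullet> \<delta> / sqrt n) k + (\<beta>0 + xm \<bullet> \<beta>)"
    by (rule order_stat_shift[OF k(1,2)])
  finally have ts: "two_step_arq n \<alpha> Y x bR - \<beta>0 - xm \<bullet> \<beta> - t = os \<delta> / sqrt n"
    unfolding os_def using sn by simp
  have "sqrt n * ((two_step_arq n \<alpha> Y x bR - \<beta>0 - sample_mean n x \<bullet> \<beta>) - order_stat n e (nat \<lfloor>n * \<alpha>\<rfloor>)) = os \<delta> - os 0"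
  proof -
    have "os 0 = sqrt n * (order_stat n e k - t)" by (simp add: os_def)
    moreover have "os \<delta> = sqrt n * (two_step_arq n \<alpha> Y x bR - \<beta>0 - xm \<bullet> \<beta> - t)" unfolding ts using sn by simp
    ultimately show ?thesis by (simp add: k_def xm_def algebra_simps)
  qed
  then show "\<bar>sqrt n * ((two_step_arq n \<alpha> Y x bR - \<beta>0 - sample_mean n x \<bullet> \<beta>) - order_stat n e (nat \<lfloor>n * \<alpha>\<rfloor>))\<bar> \<le> 4 * \<tau> / \<phi>0"
    using close[OF os[OF \<delta>] os[of 0]] C by simp
  let ?L = "local_loss n (\<lambda>i. (1::real, c i)) e \<alpha> t"
  \<comment> \<open>The regression quantile in local coordinates. Moving the mean \<open>xm\<close>
    from the regressors into the intercept makes the first coordinate equal to \<open>sqrt n\<close>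
    times the averaged quantile minus \<open>\<beta>0 + xm \<bullet> \<beta> + t\<close>.\<close>
  define \<theta> where "\<theta> = (sqrt n * (fst bh - \<beta>0 + xm \<bullet> (snd bh - \<beta>) - t), sqrt n *\<^sub>R (snd bh - \<beta>))"
  have loss: "rq_loss n \<alpha> Y x b = ?L (sqrt n * (fst b - \<beta>0 + xm \<bullet> (snd b - \<beta>) - t), sqrt n *\<^sub>R (snd b - \<beta>))" for b
    unfolding rq_loss_def local_loss_def check_loss_def
  proof (intro sum.cong refl)
    fix i assume i: "i \<in> {1..n}"
    have "Y i - with_intercept (x i) \<bullet> b = Y i - x i \<bullet> snd b - fst b"
      by (simp add: with_intercept_def inner_prod_def)
    also have "\<dots> = e i - (t + (1, c i) \<bullet> (sqrt n * (fst b - \<beta>0 + xm \<bullet> (snd b - \<beta>) - t), sqrt n *\<^sub>R (snd b - \<beta>)) / sqrt n)"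
      using res[OF i, of "snd b"] sn by (simp add: add_divide_distrib)
    finally show "\<alpha> * max (Y i - with_intercept (x i) \<bullet> b) 0 + (1 - \<alpha>) * max (- (Y i - with_intercept (x i) \<bullet> b)) 0
      = \<alpha> * max (e i - (t + (1, c i) \<bullet> (sqrt n * (fst b - \<beta>0 + xm \<bullet> (snd b - \<beta>) - t), sqrt n *\<^sub>R (snd b - \<beta>)) / sqrt n)) 0
       + (1 - \<alpha>) * max (- (e i - (t + (1, c i) \<bullet> (sqrt n * (fst b - \<beta>0 + xm \<bullet> (snd b - \<beta>) - t), sqrt n *\<^sub>R (snd b - \<beta>)) / sqrt n))) 0"
      by (simp only:)
  qed
  have min: "?L \<theta> \<le> ?L \<theta>'" for \<theta>'
  proof -
    define b where "b = (\<beta>0 + t + fst \<theta>' / sqrt n - xm \<bullet> snd \<theta>' / sqrt n, \<beta> + (1 / sqrt n) *\<^sub>R snd \<theta>')"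
    have "(sqrt n * (fst b - \<beta>0 + xm \<bullet> (snd b - \<beta>) - t), sqrt n *\<^sub>R (snd b - \<beta>)) = \<theta>'"
      unfolding b_def using sn by (simp add: prod_eq_iff)
    then have "?L \<theta>' = rq_loss n \<alpha> Y x b" using loss[of b] by simp
    moreover have "?L \<theta> = rq_loss n \<alpha> Y x bh" using loss[of bh] by (simp add: \<theta>_def)
    moreover have "rq_loss n \<alpha> Y x bh \<le> rq_loss n \<alpha> Y x b"
      using rq unfolding is_arg_min_def by (meson not_le)
    ultimately show ?thesis by simp
  qed
  have a01: "0 \<le> \<alpha>" "\<alpha> \<le> 1" using \<alpha> \<eta>(3) by linarith+
  have "norm \<theta> \<le> C"
  proof (rule local_loss_minimizer_bounded[OF l c0 n1 a01 \<phi>p q(2) Q C(1) _ _ min])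
    show "C \<le> C'" using C by linarith
    have "\<phi>0 * C * q \<le> \<phi> * C * q" using \<phi> C q by (intro mult_right_mono) auto
    moreover have "norm T + \<tau> < p'" if "p \<le> p'" "2 * (m + B) + C0 + \<tau> < p" for p p'
      using that T m B(2) by argo
    ultimately show "norm T + \<tau> < \<phi> * C * q" using big by blast
  qed
  then have "\<bar>fst \<theta>\<bar> + norm (snd \<theta>) + 1 \<le> C'"
    using norm_fst_le[of "fst \<theta>" "snd \<theta>"] norm_snd_le[of "snd \<theta>" "fst \<theta>"] C by simp
  from local_loss_intercept[OF l c0 n1 a01 \<phi>p \<tau>(2) this min]
  have "\<bar>os \<delta> - fst \<theta>\<bar> \<le> 4 * \<tau> / \<phi>0" by (intro close os \<delta>)
  moreover have "averaged_rq n x bh = fst bh + xm \<bullet> snd bh"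
  proof -
    have "sample_mean n (\<lambda>i. with_intercept (x i)) = (1, xm)"
      unfolding sample_mean_def with_intercept_def xm_def using n1
      by (simp add: prod_eq_iff fst_sum snd_sum)
    then show ?thesis by (simp add: averaged_rq_def inner_prod_def)
  qed
  moreover have "os \<delta> = sqrt n * (two_step_arq n \<alpha> Y x bR - \<beta>0 - xm \<bullet> \<beta> - t)" unfolding ts using sn by simp
  ultimately have "\<bar>sqrt n * (two_step_arq n \<alpha> Y x bR - averaged_rq n x bh)\<bar> \<le> 4 * \<tau> / \<phi>0"
    by (simp add: \<theta>_def inner_diff_right algebra_simps)
  then show "\<bar>sqrt n * \<bar>two_step_arq n \<alpha> Y x bR - averaged_rq n x bh\<bar>\<bar> \<le> 4 * \<tau> / \<phi>0" by (simp add: abs_mult)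
qed

section \<open>Conditioning on the design, and covering sets for outer probability\<close>

lemma (in prob_space) independent_conditional_bound:
  assumes X [measurable]: "X \<in> measurable M S" and Z [measurable]: "Z \<in> measurable M T"
    and ind: "\<And>A B. A \<in> sets S \<Longrightarrow> B \<in> sets T \<Longrightarrow>
      prob ((X -` A \<inter> space M) \<inter> (Z -` B \<inter> space M)) = prob (X -` A \<inter> space M) * prob (Z -` B \<inter> space M)"
    and W: "W \<in> sets (S \<Otimes>\<^sub>M T)" and \<eta>: "0 \<le> \<eta>"
    and le: "\<And>x. x \<in> space S \<Longrightarrow> prob {\<omega> \<in> space M. (x, Z \<omega>) \<in> W} \<le> \<eta>"
  shows "prob {\<omega> \<in> space M. (X \<omega>, Z \<omega>) \<in> W} \<le> \<eta>"
proof -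
  interpret PX: prob_space "distr M S X" by (rule prob_space_distr) fact
  interpret PZ: prob_space "distr M T Z" by (rule prob_space_distr) fact
  \<comment> \<open>Independence makes the joint law a product, so the bound for each frozen value
    of \<open>X\<close> can be integrated over the law of \<open>X\<close>.\<close>
  have eq: "distr M S X \<Otimes>\<^sub>M distr M T Z = distr M (S \<Otimes>\<^sub>M T) (\<lambda>\<omega>. (X \<omega>, Z \<omega>))"
  proof (rule pair_measure_eqI)
    fix A B assume A: "A \<in> sets (distr M S X)" and B: "B \<in> sets (distr M T Z)"
    then have [measurable]: "A \<in> sets S" "B \<in> sets T" by auto
    have "(\<lambda>\<omega>. (X \<omega>, Z \<omega>)) -` (A \<times> B) \<inter> space M = (X -` A \<inter> space M) \<inter> (Z -` B \<inter> space M)" by auto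
    then show "emeasure (distr M S X) A * emeasure (distr M T Z) B = emeasure (distr M (S \<Otimes>\<^sub>M T) (\<lambda>\<omega>. (X \<omega>, Z \<omega>))) (A \<times> B)"
      using ind[of A B] by (simp add: emeasure_distr emeasure_eq_measure ennreal_mult)
  qed (auto intro: PX.sigma_finite_measure PZ.sigma_finite_measure
      simp: PX.sigma_finite_measure_axioms PZ.sigma_finite_measure_axioms cong: sets_pair_measure_cong)
  note W [measurable]
  have W': "W \<in> sets (distr M S X \<Otimes>\<^sub>M distr M T Z)" using W by (simp cong: sets_pair_measure_cong)
  have "emeasure M {\<omega> \<in> space M. (X \<omega>, Z \<omega>) \<in> W} = emeasure (distr M (S \<Otimes>\<^sub>M T) (\<lambda>\<omega>. (X \<omega>, Z \<omega>))) W"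
    by (subst emeasure_distr) (auto intro!: arg_cong[where f = "emeasure M"])
  also have "\<dots> = (\<integral>\<^sup>+x. emeasure (distr M T Z) (Pair x -` W) \<partial>distr M S X)"
    unfolding eq[symmetric] by (rule PZ.emeasure_pair_measure_alt[OF W'])
  also have "\<dots> \<le> (\<integral>\<^sup>+x. ennreal \<eta> \<partial>distr M S X)"
  proof (rule nn_integral_mono)
    fix x assume "x \<in> space (distr M S X)"
    then have x: "x \<in> space S" by simp
    have "Pair x -` W \<in> sets T" using W by (rule sets_Pair1)
    then have "emeasure (distr M T Z) (Pair x -` W) = emeasure M {\<omega> \<in> space M. (x, Z \<omega>) \<in> W}"
      by (subst emeasure_distr) (auto intro!: arg_cong[where f = "emeasure M"])
    then show "emeasure (distr M T Z) (Pair x -` W) \<le> ennreal \<eta>"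
      using le[OF x] by (simp add: emeasure_eq_measure ennreal_leI)
  qed
  also have "\<dots> = ennreal \<eta>" using PX.emeasure_space_1 by simp
  finally show ?thesis using \<eta> by (simp add: emeasure_eq_measure)
qed

text \<open>By dominated convergence, almost sure conditions on the design become events of
  probability close to 1.\<close>

lemma (in prob_space) AE_eventually_prob_tendsto_0:
  assumes ae: "AE \<omega> in M. eventually (\<lambda>n. P n \<omega>) sequentially"
    and [measurable]: "\<And>n. {\<omega> \<in> space M. P n \<omega>} \<in> sets M"
  shows "(\<lambda>n. prob {\<omega> \<in> space M. \<not> P n \<omega>}) \<longlonglongrightarrow> 0"
proof -
  have m [measurable]: "{\<omega> \<in> space M. \<not> P n \<omega>} \<in> sets M" for n by measurable
  have "(\<lambda>n. expectation (indicat_real {\<omega> \<in> space M. \<not> P n \<omega>})) \<longlonglongrightarrow> expectation (\<lambda>_. 0)"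
  proof (rule integral_dominated_convergence[where w = "\<lambda>_. 1"])
    show "AE \<omega> in M. (\<lambda>n. indicat_real {\<omega> \<in> space M. \<not> P n \<omega>} \<omega>) \<longlonglongrightarrow> 0"
      using ae
    proof eventually_elim
      case (elim \<omega>)
      then have "\<forall>\<^sub>F n in sequentially. indicat_real {\<omega> \<in> space M. \<not> P n \<omega>} \<omega> = 0"
        by eventually_elim auto
      then show ?case by (rule tendsto_eventually)
    qed
  qed (auto simp: indicator_def)
  then show ?thesis by simp
qed

text \<open>The hypothesis yields covering sets that depend on \<eta>, while the definition asks for
  one sequence of them. Sets whose probability is within \<open>1 / (n + 1)\<close> of the infimum
  over all measurable covers serve every \<eta> at once.\<close>

lemma (in prob_space) uniformly_op_1I:
  assumes "\<And>\<delta> \<eta>. 0 < \<delta> \<Longrightarrow> 0 < \<eta> \<Longrightarrow> \<exists>N. \<forall>n\<ge>N. \<exists>B\<in>sets M. prob B \<le> \<eta> \<and>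
    (\<forall>\<omega>\<in>space M - B. \<forall>a\<in>S. \<bar>Z n a \<omega>\<bar> \<le> \<delta>)"
  shows "uniformly_op_1 M S Z"
  unfolding uniformly_op_1_def
proof (intro allI impI)
  fix \<delta> :: real assume \<delta>: "0 < \<delta>"
  define bad where "bad n = {\<omega> \<in> space M. \<exists>a\<in>S. \<delta> < \<bar>Z n a \<omega>\<bar>}" for n
  define V where "V n = {prob B |B. B \<in> sets M \<and> bad n \<subseteq> B}" for n
  have ne: "V n \<noteq> {}" and bdd: "bdd_below (V n)" for n
    unfolding V_def by (auto simp: bad_def intro!: exI[of _ "space M"] bdd_belowI[of _ 0])
  have "\<exists>B\<in>sets M. bad n \<subseteq> B \<and> prob B < Inf (V n) + 1 / real (Suc n)" for n
    using cInf_lessD[OF ne, of n "Inf (V n) + 1 / real (Suc n)"] by (auto simp: V_def)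
  then obtain B where B: "\<And>n. B n \<in> sets M" "\<And>n. bad n \<subseteq> B n" "\<And>n. prob (B n) < Inf (V n) + 1 / real (Suc n)"
    by metis
  have "(\<lambda>n. prob (B n)) \<longlonglongrightarrow> 0"
  proof (rule LIMSEQ_I)
    fix r :: real assume r: "0 < r"
    then obtain N where N: "\<forall>n\<ge>N. \<exists>B\<in>sets M. prob B \<le> r / 2 \<and> (\<forall>\<omega>\<in>space M - B. \<forall>a\<in>S. \<bar>Z n a \<omega>\<bar> \<le> \<delta>)"
      using assms[OF \<delta>, of "r / 2"] by auto
    obtain N' where N': "1 / real (Suc N') < r / 2" using r nat_approx_posE[of "r / 2"] by auto
    have "norm (prob (B n) - 0) < r" if n: "max N N' \<le> n" for n
    proof -
      obtain B' where B': "B' \<in> sets M" "prob B' \<le> r / 2" "\<forall>\<omega>\<in>space M - B'. \<forall>a\<in>S. \<bar>Z n a \<omega>\<bar> \<le> \<delta>"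
        using N n by auto
      then have "bad n \<subseteq> B'" by (force simp: bad_def)
      then have "Inf (V n) \<le> prob B'" using B' bdd by (intro cInf_lower) (auto simp: V_def)
      moreover have "1 / real (Suc n) \<le> 1 / real (Suc N')" using n by (simp add: frac_le)
      ultimately show ?thesis using B(3)[of n] B'(2) N' by simp
    qed
    then show "\<exists>no. \<forall>n\<ge>no. norm (prob (B n) - 0) < r" by blast
  qed
  then show "\<exists>B. (\<forall>n. B n \<in> events \<and> {\<omega> \<in> space M. \<exists>a\<in>S. \<delta> < \<bar>Z n a \<omega>\<bar>} \<subseteq> B n) \<and> (\<lambda>n. prob (B n)) \<longlonglongrightarrow> 0"
    using B(1,2) unfolding bad_def by blast
qed

lemma absolutely_continuous_on_imp_continuous:
  assumes "\<And>a b. absolutely_continuous_on a b f"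
  shows "continuous_on UNIV f"
  unfolding continuous_on_iff
proof (intro ballI allI impI)
  fix x \<epsilon> :: real assume "0 < \<epsilon>"
  then obtain \<delta> where \<delta>: "0 < \<delta>" "\<And>I. finite I \<Longrightarrow> (\<forall>(u, v)\<in>I. x - 1 \<le> u \<and> u \<le> v \<and> v \<le> x + 1) \<Longrightarrow>
        disjoint_family_on (\<lambda>(u, v). {u<..<v}) I \<Longrightarrow>
        (\<Sum>(u, v)\<in>I. v - u) < \<delta> \<Longrightarrow> (\<Sum>(u, v)\<in>I. \<bar>f v - f u\<bar>) < \<epsilon>"
    using assms[of "x - 1" "x + 1"] unfolding absolutely_continuous_on_def by blast
  have "dist (f y) (f x) < \<epsilon>" if "dist y x < min 1 \<delta>" for y
  proof (cases "x \<le> y")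
    case True
    then show ?thesis using \<delta>(2)[of "{(x, y)}"] that by (simp add: dist_real_def disjoint_family_on_def)
  next
    case False
    then show ?thesis using \<delta>(2)[of "{(y, x)}"] that by (simp add: dist_real_def disjoint_family_on_def)
  qed
  then show "\<exists>d>0. \<forall>x'\<in>UNIV. dist x' x < d \<longrightarrow> dist (f x') (f x) < \<epsilon>"
    using \<delta>(1) by (intro exI[of _ "min 1 \<delta>"]) auto
qed

subsection \<open>Error quantiles and design matrix\<close>

text \<open>To the right of \<open>t - 1\<close> the distribution function is a constant plus an
  integral of a continuous function over a compact interval, so the fundamental theorem of calculus
  applies at \<open>t\<close>.\<close>

lemma cdf_density_has_derivative:
  fixes f :: "real \<Rightarrow> real"
  assumes f: "continuous_on UNIV f" "\<And>z. 0 \<le> f z" and D: "prob_space (density lborel (\<lambda>z. ennreal (f z)))"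
  shows "(cdf (density lborel (\<lambda>z. ennreal (f z))) has_real_derivative f t) (at t)"
proof -
  let ?D = "density lborel (\<lambda>z. ennreal (f z))"
  interpret prob_space ?D by fact
  interpret real_distribution ?D by unfold_locales auto
  have mf [measurable]: "f \<in> borel_measurable borel" using f(1) by (rule borel_measurable_continuous_onI)
  have cont: "continuous_on S f" for S using f(1) by (rule continuous_on_subset) auto
  have diff: "cdf ?D x = cdf ?D a + integral {a..x} f" if "a \<le> x" for a x
  proof (cases "a = x")
    case False
    then have "cdf ?D x - cdf ?D a = measure ?D {a<..x}" using that by (intro cdf_diff_eq) auto
    moreover have "emeasure ?D {a<..x} = ennreal (integral {a..x} f)"
    proof -
      have "emeasure ?D {a<..x} = (\<integral>\<^sup>+z. ennreal (f z) * indicator {a<..x} z \<partial>lborel)"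
        by (intro emeasure_density) auto
      also have "\<dots> = (\<integral>\<^sup>+z. ennreal (f z) * indicator {a..x} z \<partial>lborel)"
        using AE_lborel_singleton[of a] by (intro nn_integral_cong_AE) (auto simp: indicator_def)
      also have "\<dots> = ennreal (integral {a..x} f)"
        using f(2) by (intro nn_integral_has_integral_lebesgue' integrable_integral integrable_continuous_real cont)
      finally show ?thesis .
    qed
    moreover have "0 \<le> integral {a..x} f"
      using f(2) by (intro integral_nonneg integrable_continuous_real cont) auto
    ultimately show ?thesis by (simp add: measure_def)
  qed simp
  have "((\<lambda>x. integral {t - 1..x} f) has_real_derivative f t) (at t within {t - 1..t + 1})"
    by (intro integral_has_real_derivative cont) auto
  moreover have "at t within {t - 1..t + 1} = at t" by (intro at_within_interior) auto
  ultimately have "((\<lambda>x. cdf ?D (t - 1) + integral {t - 1..x} f) has_real_derivative 0 + f t) (at t)"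
    by (intro DERIV_add DERIV_const) simp
  then have "((\<lambda>x. cdf ?D (t - 1) + integral {t - 1..x} f) has_real_derivative f t) (at t)" by simp
  then show ?thesis
    by (rule has_field_derivative_transform_within_open[where S = "{t - 1<..}"]) (auto intro!: diff[symmetric])
qed

text \<open>The central quantiles form a compact set on which \<open>f\<close> is positive, so its
  minimum there is a divisor that works for all levels together. The interval is half-open because
  the grid argument rounds \<open>t\<close> down from strictly below the right end.\<close>

lemma positive_density_quantiles:
  fixes F f :: "real \<Rightarrow> real"
  assumes F': "\<And>t. (F has_real_derivative f t) (at t)" and f: "continuous_on UNIV f"
    and lim: "(F \<longlongrightarrow> 0) at_bot" "(F \<longlongrightarrow> 1) at_top" and mono: "mono F"
    and pos: "\<And>z. 0 < F z \<Longrightarrow> F z < 1 \<Longrightarrow> 0 < f z" and \<kappa>: "0 < \<kappa>" "\<kappa> < 1 / 2"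
  shows "\<exists>a0 b0 \<phi>0. a0 < b0 \<and> 0 < \<phi>0 \<and> (\<forall>\<alpha>\<in>{\<kappa>..1 - \<kappa>}. \<exists>t\<in>{a0..<b0}. F t = \<alpha> \<and> \<phi>0 \<le> f t)"
proof -
  have cF: "continuous_on S F" for S
    using F' by (intro continuous_at_imp_continuous_on ballI DERIV_isCont) auto
  obtain a0 where a0: "F a0 < \<kappa>"
    using order_tendstoD(2)[OF lim(1) \<kappa>(1)] eventually_at_bot_linorder[of "\<lambda>x. F x < \<kappa>"] by auto
  obtain b0 where b0: "1 - \<kappa> < F b0"
    using order_tendstoD(1)[OF lim(2), of "1 - \<kappa>"] eventually_at_top_linorder[of "\<lambda>x. 1 - \<kappa> < F x"] \<kappa> by auto
  have ab: "a0 < b0" using a0 b0 \<kappa> monoD[OF mono, of b0 a0] by linarith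
  have q: "\<exists>t\<in>{a0..<b0}. F t = \<alpha>" if "\<alpha> \<in> {\<kappa>..1 - \<kappa>}" for \<alpha>
  proof -
    have "\<exists>t. a0 \<le> t \<and> t \<le> b0 \<and> F t = \<alpha>"
      using a0 b0 ab that cF by (intro IVT') auto
    then obtain t where t: "a0 \<le> t" "t \<le> b0" "F t = \<alpha>" by blast
    moreover have "t \<noteq> b0" using t b0 that by auto
    ultimately show ?thesis by (intro bexI[of _ t]) auto
  qed
  define S where "S = {a0..b0} \<inter> F -` {\<kappa>..1 - \<kappa>}"
  have "closed S" unfolding S_def by (rule continuous_closed_preimage[OF cF]) auto
  moreover have "bounded S" unfolding S_def by (rule bounded_subset[of "{a0..b0}"]) auto
  ultimately have "compact S" by (simp add: compact_eq_bounded_closed)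
  moreover have "S \<noteq> {}"
  proof -
    obtain t where "t \<in> {a0..<b0}" "F t = 1 / 2" using q[of "1 / 2"] \<kappa> by auto
    then have "t \<in> S" using \<kappa> by (simp add: S_def)
    then show ?thesis by blast
  qed
  ultimately obtain s where s: "s \<in> S" "\<And>t. t \<in> S \<Longrightarrow> f s \<le> f t"
    using continuous_attains_inf[of S f] continuous_on_subset[OF f, of S] by auto
  have "0 < f s" using s(1) \<kappa> pos[of s] by (auto simp: S_def)
  moreover have "\<exists>t\<in>{a0..<b0}. F t = \<alpha> \<and> f s \<le> f t" if "\<alpha> \<in> {\<kappa>..1 - \<kappa>}" for \<alpha>
    using q[OF that] s(2) that by (force simp: S_def)
  ultimately show ?thesis using ab by blast
qed

lemma design_cov_nth:
  "design_cov n x $ a $ b = (\<Sum>i=1..n. (x i - sample_mean n x) $ a * (x i - sample_mean n x) $ b) / n"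
  by (simp add: design_cov_def columnvector_def rowvector_def matrix_matrix_mult_def sum_component)

text \<open>The squared norms sum to \<open>n\<close> times the trace. In the quadratic form each of
  the \<open>CARD('p)\<^sup>2\<close> entries is off by at most \<zeta> and multiplies a product of
  two coordinates, which is at most \<open>(norm v)\<^sup>2\<close>.\<close>

lemma design_cov_bounds:
  fixes n :: nat and x :: "nat \<Rightarrow> real ^ 'p" and Q :: "real ^ 'p ^ 'p" and \<zeta> q0 :: real
  defines "c \<equiv> \<lambda>i. x i - sample_mean n x"
  assumes close: "\<And>a b. \<bar>design_cov n x $ a $ b - Q $ a $ b\<bar> \<le> \<zeta>" and n: "1 \<le> n"
  shows "(\<Sum>i=1..n. (norm (c i))\<^sup>2) \<le> n * ((\<Sum>a\<in>UNIV. Q $ a $ a) + CARD('p) * \<zeta>)"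
    and "(\<And>v. q0 * (norm v)\<^sup>2 \<le> v \<bullet> (Q *v v)) \<Longrightarrow>
      n * (q0 - (real CARD('p))\<^sup>2 * \<zeta>) * (norm v)\<^sup>2 \<le> (\<Sum>i=1..n. (c i \<bullet> v)\<^sup>2)"
proof -
  let ?D = "design_cov n x"
  have D: "(\<Sum>i=1..n. c i $ a * c i $ b) = n * ?D $ a $ b" for a b
    using n by (simp add: design_cov_nth c_def)
  have "(\<Sum>i=1..n. (norm (c i))\<^sup>2) = (\<Sum>i=1..n. \<Sum>a\<in>UNIV. c i $ a * c i $ a)"
    by (simp add: power2_norm_eq_inner inner_vec_def)
  also have "\<dots> = (\<Sum>a\<in>UNIV. n * ?D $ a $ a)" by (subst sum.swap) (simp only: D)
  also have "\<dots> \<le> (\<Sum>a\<in>UNIV. n * (Q $ a $ a + \<zeta>))"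
  proof (intro sum_mono mult_left_mono)
    show "?D $ a $ a \<le> Q $ a $ a + \<zeta>" for a using close[of a a] by linarith
  qed auto
  also have "\<dots> = n * ((\<Sum>a\<in>UNIV. Q $ a $ a) + CARD('p) * \<zeta>)"
    by (simp add: sum.distrib flip: sum_distrib_left)
  finally show "(\<Sum>i=1..n. (norm (c i))\<^sup>2) \<le> n * ((\<Sum>a\<in>UNIV. Q $ a $ a) + CARD('p) * \<zeta>)" .
  assume q0: "\<And>v. q0 * (norm v)\<^sup>2 \<le> v \<bullet> (Q *v v)"
  have vQ: "v \<bullet> (Q *v v) = (\<Sum>a\<in>UNIV. \<Sum>b\<in>UNIV. v $ a * v $ b * Q $ a $ b)"
    by (simp add: inner_vec_def matrix_vector_mult_def sum_distrib_left mult_ac)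
  have "(\<Sum>i=1..n. (c i \<bullet> v)\<^sup>2) = (\<Sum>i=1..n. \<Sum>a\<in>UNIV. \<Sum>b\<in>UNIV. v $ a * v $ b * (c i $ a * c i $ b))"
    by (simp add: power2_eq_square inner_vec_def sum_product mult_ac)
  also have "\<dots> = (\<Sum>a\<in>UNIV. \<Sum>b\<in>UNIV. \<Sum>i=1..n. v $ a * v $ b * (c i $ a * c i $ b))"
    by (subst sum.swap, intro sum.cong refl, rule sum.swap)
  also have "\<dots> = n * (\<Sum>a\<in>UNIV. \<Sum>b\<in>UNIV. v $ a * v $ b * ?D $ a $ b)"
    unfolding sum_distrib_left[symmetric] D by (simp add: sum_distrib_left mult_ac)
  finally have cv: "(\<Sum>i=1..n. (c i \<bullet> v)\<^sup>2) = n * (\<Sum>a\<in>UNIV. \<Sum>b\<in>UNIV. v $ a * v $ b * ?D $ a $ b)" .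
  have "\<bar>(\<Sum>a\<in>UNIV. \<Sum>b\<in>UNIV. v $ a * v $ b * ?D $ a $ b) - v \<bullet> (Q *v v)\<bar>
    = \<bar>\<Sum>a\<in>UNIV. \<Sum>b\<in>UNIV. v $ a * v $ b * (?D $ a $ b - Q $ a $ b)\<bar>"
    unfolding vQ by (simp add: right_diff_distrib sum_subtractf)
  also have "\<dots> \<le> (\<Sum>a\<in>(UNIV :: 'p set). \<Sum>b\<in>(UNIV :: 'p set). (norm v)\<^sup>2 * \<zeta>)"
  proof (intro order.trans[OF sum_abs] sum_mono)
    fix a b
    have "\<bar>v $ a\<bar> * \<bar>v $ b\<bar> \<le> norm v * norm v" by (intro mult_mono component_le_norm_cart) auto
    then show "\<bar>v $ a * v $ b * (?D $ a $ b - Q $ a $ b)\<bar> \<le> (norm v)\<^sup>2 * \<zeta>"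
      unfolding abs_mult power2_eq_square using close[of a b] by (rule mult_mono) auto
  qed
  also have "\<dots> = (real CARD('p))\<^sup>2 * \<zeta> * (norm v)\<^sup>2" by (simp add: power2_eq_square)
  finally have "(q0 - (real CARD('p))\<^sup>2 * \<zeta>) * (norm v)\<^sup>2 \<le> (\<Sum>a\<in>UNIV. \<Sum>b\<in>UNIV. v $ a * v $ b * ?D $ a $ b)"
    using q0[of v] unfolding left_diff_distrib by linarith
  from mult_left_mono[OF this, of n]
  show "n * (q0 - (real CARD('p))\<^sup>2 * \<zeta>) * (norm v)\<^sup>2 \<le> (\<Sum>i=1..n. (c i \<bullet> v)\<^sup>2)"
    unfolding cv by (simp add: mult.assoc)
qed

text \<open>The quadratic form attains a positive minimum on the compact unit sphere and is
  homogeneous of degree 2. The constant is capped at 1 because the intercept coordinate contributes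
  with weight exactly 1.\<close>

lemma positive_definite_coercive:
  fixes Q :: "real ^ 'p ^ 'p"
  assumes "positive_definite Q"
  shows "\<exists>q>0. q \<le> 1 \<and> (\<forall>v. q * (norm v)\<^sup>2 \<le> v \<bullet> (Q *v v))"
proof -
  let ?h = "\<lambda>v. v \<bullet> (Q *v v)"
  have "sphere (0 :: real ^ 'p) 1 \<noteq> {}" by simp
  moreover have "continuous_on (sphere 0 1) ?h"
    by (intro continuous_intros linear_continuous_on matrix_vector_mul_linear) 
  ultimately obtain w where w: "w \<in> sphere 0 1" "\<And>v. v \<in> sphere 0 1 \<Longrightarrow> ?h w \<le> ?h v"
    using continuous_attains_inf[OF compact_sphere, of 0 1 ?h] by blast
  define q where "q = min 1 (?h w)"
  have "w \<noteq> 0" using w(1) by auto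
  then have "0 < q" using assms unfolding positive_definite_def q_def by simp
  moreover have "q * (norm v)\<^sup>2 \<le> ?h v" for v
  proof (cases "v = 0")
    case False
    let ?u = "(1 / norm v) *\<^sub>R v"
    have "q \<le> ?h ?u" using w(2)[of ?u] False by (simp add: q_def)
    also have "?h ?u = ?h v / (norm v)\<^sup>2"
      by (simp add: matrix_vector_mult_scaleR power2_eq_square)
    finally show ?thesis using False by (simp add: pos_le_divide_eq)
  qed simp
  ultimately show ?thesis unfolding q_def by (intro exI[of _ q]) (auto simp: q_def)
qed

text \<open>The constant and the starting index hidden in the Landau symbol depend on \<omega>. In
  \<open>P\<close> the single number \<open>k\<close> plays both parts, so that \<open>P k\<close>
  eventually holds along almost every \<omega>.\<close>

lemma (in prob_space) AE_bigo_sqrt_bounded: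
  fixes X :: "nat \<Rightarrow> 'a \<Rightarrow> real"
  assumes mX [measurable]: "\<And>n. X n \<in> borel_measurable M"
    and O: "AE \<omega> in M. (\<lambda>n. X n \<omega>) \<in> O(\<lambda>n. sqrt (real n))" and \<eta>: "0 < \<eta>"
  shows "\<exists>m\<ge>0. \<exists>N. \<forall>n\<ge>N. prob {\<omega> \<in> space M. \<not> X n \<omega> \<le> m * sqrt n} \<le> \<eta>"
proof -
  define P where "P k \<omega> \<longleftrightarrow> (\<forall>n\<ge>k. X n \<omega> \<le> real k * sqrt n)" for k :: nat and \<omega>
  have [measurable]: "{\<omega> \<in> space M. P k \<omega>} \<in> sets M" for k unfolding P_def by measurable
  have "(\<lambda>k. prob {\<omega> \<in> space M. \<not> P k \<omega>}) \<longlonglongrightarrow> 0"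
  proof (rule AE_eventually_prob_tendsto_0)
    show "AE \<omega> in M. eventually (\<lambda>k. P k \<omega>) sequentially"
      using O
    proof eventually_elim
      case (elim \<omega>)
      then obtain c where "\<forall>\<^sub>F n in sequentially. norm (X n \<omega>) \<le> c * norm (sqrt (real n))"
        by (elim landau_o.bigE)
      then obtain N0 where N0: "\<And>n. N0 \<le> n \<Longrightarrow> \<bar>X n \<omega>\<bar> \<le> c * sqrt n"
        by (auto simp: eventually_sequentially)
      have "P k \<omega>" if k: "max N0 (nat \<lceil>c\<rceil>) \<le> k" for k
        unfolding P_def
      proof (intro allI impI)
        fix n assume "k \<le> n"
        then have "\<bar>X n \<omega>\<bar> \<le> c * sqrt n" using N0 k by auto
        also have "\<dots> \<le> real k * sqrt n" using k by (intro mult_right_mono) (auto simp: nat_le_iff ceiling_le_iff)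
        finally show "X n \<omega> \<le> real k * sqrt n" by simp
      qed
      then show ?case unfolding eventually_sequentially by blast
    qed
  qed simp
  from order_tendstoD(2)[OF this \<eta>] obtain k where k: "prob {\<omega> \<in> space M. \<not> P k \<omega>} < \<eta>"
    by (auto simp: eventually_sequentially)
  have "prob {\<omega> \<in> space M. \<not> X n \<omega> \<le> real k * sqrt n} \<le> \<eta>" if "k \<le> n" for n
  proof -
    have "prob {\<omega> \<in> space M. \<not> X n \<omega> \<le> real k * sqrt n} \<le> prob {\<omega> \<in> space M. \<not> P k \<omega>}"
      using that by (intro finite_measure_mono) (auto simp: P_def)
    then show ?thesis using k by linarith
  qed
  then show ?thesis by (intro exI[of _ "real k"]) auto
qed

lemma linear_at_cong:
  assumes "\<And>i. i \<in> {1..n} \<Longrightarrow> d i = d' i" "\<And>i. i \<in> {1..n} \<Longrightarrow> e i = e' i"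
  shows "linear_at n d e \<alpha> \<phi> t T C \<tau> \<longleftrightarrow> linear_at n d' e' \<alpha> \<phi> t T C \<tau>"
proof -
  have "bracket n e (\<lambda>i. t + d i \<bullet> \<theta> / sqrt n) a \<longleftrightarrow> bracket n e' (\<lambda>i. t + d' i \<bullet> \<theta> / sqrt n) a" for \<theta> a
    unfolding bracket_def using assms by simp
  moreover have "(\<Sum>i=1..n. (a i - \<alpha>) *\<^sub>R d i) = (\<Sum>i=1..n. (a i - \<alpha>) *\<^sub>R d' i)"
    "(\<Sum>i=1..n. (d i \<bullet> \<theta>) *\<^sub>R d i) = (\<Sum>i=1..n. (d' i \<bullet> \<theta>) *\<^sub>R d' i)" for \<theta> a
    using assms by (auto intro!: sum.cong)
  ultimately show ?thesis unfolding linear_at_def by simp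
qed

subsection \<open>The theorem\<close>

text \<open>A nonrandom design is the case of constant \<open>x n i\<close>.
  \<open>R_estimator\<close> is conditional because the existence of a minimizer of the dispersion
  is part of what is proved, on the good event. \<open>f_pos\<close> bounds away from zero the
  density by which the expansion is divided, and \<open>point_scores_mean\<close> controls the drift
  left by scores whose sum is not zero.\<close>

theorem theorem2:
  fixes M :: "'w measure"
    and x :: "nat \<Rightarrow> nat \<Rightarrow> 'w \<Rightarrow> real ^ 'p"
    and e Y :: "nat \<Rightarrow> nat \<Rightarrow> 'w \<Rightarrow> real"
    and \<beta>0 :: real and \<beta> :: "real ^ 'p"
    and f F :: "real \<Rightarrow> real"
    and Q :: "real ^ 'p ^ 'p"
    and lam :: real
    and A :: "nat \<Rightarrow> nat \<Rightarrow> real"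
    and \<beta>R :: "nat \<Rightarrow> 'w \<Rightarrow> real ^ 'p"
    and \<beta>hat :: "nat \<Rightarrow> real \<Rightarrow> 'w \<Rightarrow> real \<times> (real ^ 'p)"
  assumes "prob_space M"
    and model: "\<And>n i \<omega>. i \<in> {1..n} \<Longrightarrow> \<omega> \<in> space M \<Longrightarrow>
                  Y n i \<omega> = \<beta>0 + x n i \<omega> \<bullet> \<beta> + e n i \<omega>"
    and covariates_measurable: "\<And>n i. i \<in> {1..n} \<Longrightarrow> x n i \<in> borel_measurable M"
    and covariates_indep: "\<And>n. prob_space.indep_set M
                  (sample_events M n (x n)) (sample_events M n (e n))"
    and errors_indep: "\<And>n. prob_space.indep_vars M (\<lambda>_. borel) (e n) {1..n}"
    and errors_density: "\<And>n i. i \<in> {1..n} \<Longrightarrow> distributed M lborel (e n i) (\<lambda>z. ennreal (f z))"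
    and f_nonneg: "\<And>z. 0 \<le> f z"
    and f_abs_cont: "\<And>a b. absolutely_continuous_on a b f"
    and F_cdf: "F = cdf (density lborel (\<lambda>z. ennreal (f z)))"
    and f_pos: "\<And>z. 0 < F z \<Longrightarrow> F z < 1 \<Longrightarrow> 0 < f z"
    and fisher: "0 < fisher_information f" "fisher_information f < \<infinity>"
    and Q_posdef: "positive_definite Q"
    and design_limit: "AE \<omega> in M. (\<lambda>n. design_cov n (\<lambda>i. x n i \<omega>)) \<longlonglongrightarrow> Q"
    and leverage_limit: "AE \<omega> in M. (\<lambda>n. max_leverage n (\<lambda>i. x n i \<omega>)) \<longlonglongrightarrow> 0"
    and deviation: "AE \<omega> in M. (\<lambda>n. max_deviation n (\<lambda>i. x n i \<omega>)) \<in> o(\<lambda>n. real n powr (1/4))"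
    and lam: "0 < lam" "lam < 1"
    and scores: "A \<in> {exact_scores (quantile_score lam), integral_scores (quantile_score lam),
                     point_scores (quantile_score lam)}"
    and point_scores_mean: "A = point_scores (quantile_score lam) \<Longrightarrow>
                  AE \<omega> in M. (\<lambda>n. norm (sample_mean n (\<lambda>i. x n i \<omega>))) \<in> O(\<lambda>n. sqrt (real n))"
    and R_estimator: "\<And>n \<omega> b. \<omega> \<in> space M \<Longrightarrow>
                  is_arg_min (rank_dispersion A n (\<lambda>i. Y n i \<omega>) (\<lambda>i. x n i \<omega>)) (\<lambda>_. True) b \<Longrightarrow>
                  is_arg_min (rank_dispersion A n (\<lambda>i. Y n i \<omega>) (\<lambda>i. x n i \<omega>)) (\<lambda>_. True) (\<beta>R n \<omega>)"
    and regression_quantile: "\<And>n \<alpha> \<omega>. 0 < \<alpha> \<Longrightarrow> \<alpha> < 1 \<Longrightarrow> \<omega> \<in> space M \<Longrightarrow>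
                  is_arg_min (rq_loss n \<alpha> (\<lambda>i. Y n i \<omega>) (\<lambda>i. x n i \<omega>)) (\<lambda>_. True) (\<beta>hat n \<alpha> \<omega>)"
  shows "\<forall>\<epsilon>. 0 < \<epsilon> \<and> \<epsilon> < 1/2 \<longrightarrow>
           uniformly_op_1 M {\<epsilon><..<1 - \<epsilon>} (\<lambda>n \<alpha> \<omega>. sqrt (real n) *
              ((two_step_arq n \<alpha> (\<lambda>i. Y n i \<omega>) (\<lambda>i. x n i \<omega>) (\<beta>R n \<omega>)
                  - \<beta>0 - sample_mean n (\<lambda>i. x n i \<omega>) \<bullet> \<beta>)
               - order_stat n (\<lambda>i. e n i \<omega>) (nat \<lfloor>real n * \<alpha>\<rfloor>))) \<and>
           uniformly_op_1 M {\<epsilon><..<1 - \<epsilon>} (\<lambda>n \<alpha> \<omega>. sqrt (real n) *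
              \<bar>two_step_arq n \<alpha> (\<lambda>i. Y n i \<omega>) (\<lambda>i. x n i \<omega>) (\<beta>R n \<omega>)
                - averaged_rq n (\<lambda>i. x n i \<omega>) (\<beta>hat n \<alpha> \<omega>)\<bar>)"
proof -
  interpret prob_space M by fact
  let ?D = "density lborel (\<lambda>z. ennreal (f z))"
  have e_meas [measurable]: "e n i \<in> borel_measurable M" if "i \<in> {1..n}" for n i
    using errors_density[OF that] by (auto simp: distributed_def)
  have e_distr: "distr M lborel (e n i) = ?D" if "i \<in> {1..n}" for n i
    using errors_density[OF that] by (simp add: distributed_def)
  have "prob_space (distr M lborel (e 1 1))" using e_meas[of 1 1] by (intro prob_space_distr) simp
  then have D: "prob_space ?D" using e_distr[of 1 1] by simp
  interpret D: prob_space ?D by (rule D)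
  interpret D: real_distribution ?D by unfold_locales auto
  have f_cont: "continuous_on UNIV f" by (rule absolutely_continuous_on_imp_continuous[OF f_abs_cont])
  have F': "(F has_real_derivative f t) (at t)" for t
    unfolding F_cdf by (rule cdf_density_has_derivative[OF f_cont f_nonneg D])
  have F_mono: "mono F" unfolding F_cdf by (intro monoI D.cdf_nondecreasing)
  have F_lim: "(F \<longlongrightarrow> 0) at_bot" "(F \<longlongrightarrow> 1) at_top"
    unfolding F_cdf by (rule D.cdf_lim_at_bot D.cdf_lim_at_top_prob)+
  have e_cdf: "prob {\<omega> \<in> space M. e n i \<omega> \<le> s} = F s" if "i \<in> {1..n}" for n i s
  proof -
    have "measure (distr M lborel (e n i)) {..s} = prob (e n i -` {..s} \<inter> space M)"
      using e_meas[OF that] by (intro measure_distr) auto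
    also have "e n i -` {..s} \<inter> space M = {\<omega> \<in> space M. e n i \<omega> \<le> s}" by auto
    finally show ?thesis unfolding e_distr[OF that] F_cdf cdf_def by simp
  qed
  obtain q0 where q0: "0 < q0" "q0 \<le> 1" "\<And>v. q0 * (norm v)\<^sup>2 \<le> v \<bullet> (Q *v v)"
    using positive_definite_coercive[OF Q_posdef] by blast
  define P where "P = real CARD('p)"
  have P: "1 \<le> P" unfolding P_def using zero_less_card_finite[where 'a = 'p] by linarith
  \<comment> \<open>Entrywise errors up to \<zeta> change the quadratic form by at most
    \<open>P\<^sup>2 * \<zeta>\<close>, so half of \<open>q0\<close> survives.\<close>
  define \<zeta> where "\<zeta> = q0 / (2 * P\<^sup>2)"
  have \<zeta>: "0 < \<zeta>" "q0 - P\<^sup>2 * \<zeta> = q0 / 2" using q0(1) P by (auto simp: \<zeta>_def)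
  define B where "B = 1 + \<bar>(\<Sum>a\<in>UNIV. Q $ a $ a) + P * \<zeta>\<bar>"
  have B: "0 < B" by (simp add: B_def)
  let ?xm = "\<lambda>n \<omega>. sample_mean n (\<lambda>i. x n i \<omega>)"
  let ?Z1 = "\<lambda>n \<alpha> \<omega>. sqrt (real n) * ((two_step_arq n \<alpha> (\<lambda>i. Y n i \<omega>) (\<lambda>i. x n i \<omega>) (\<beta>R n \<omega>)
      - \<beta>0 - ?xm n \<omega> \<bullet> \<beta>) - order_stat n (\<lambda>i. e n i \<omega>) (nat \<lfloor>real n * \<alpha>\<rfloor>))"
  let ?Z2 = "\<lambda>n \<alpha> \<omega>. sqrt (real n) * \<bar>two_step_arq n \<alpha> (\<lambda>i. Y n i \<omega>) (\<lambda>i. x n i \<omega>) (\<beta>R n \<omega>)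
      - averaged_rq n (\<lambda>i. x n i \<omega>) (\<beta>hat n \<alpha> \<omega>)\<bar>"
  define c where "c n i \<omega> = x n i \<omega> - ?xm n \<omega>" for n i \<omega>
  define d where "d n \<omega> i = (1::real, c n i \<omega>)" for n \<omega> i
  have d_norm: "(norm (d n \<omega> i))\<^sup>2 = 1 + (norm (c n i \<omega>))\<^sup>2" for n \<omega> i by (simp add: d_def norm_prod_def)
  have d_ge: "1 \<le> norm (d n \<omega> i)" for n \<omega> i
    by (rule power2_le_imp_le) (simp_all add: d_norm)
  have xm_meas [measurable]: "?xm n \<in> borel_measurable M" for n
    unfolding sample_mean_def using covariates_measurable by measurable
  have c_meas [measurable]: "c n i \<in> borel_measurable M" if "i \<in> {1..n}" for n i
    unfolding c_def using covariates_measurable[OF that] by measurable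
  have c_nth [measurable]: "(\<lambda>\<omega>. c n i \<omega> $ a) \<in> borel_measurable M" if "i \<in> {1..n}" for n i a
  proof -
    have "(\<lambda>\<omega>. c n i \<omega> \<bullet> axis a 1) \<in> borel_measurable M" using that by measurable
    then show ?thesis by (simp add: inner_axis)
  qed
  have cov_meas [measurable]: "(\<lambda>\<omega>. design_cov n (\<lambda>i. x n i \<omega>) $ a $ b) \<in> borel_measurable M" for n a b
    unfolding design_cov_nth c_def[symmetric] by measurable
  \<comment> \<open>The subtracted 1 makes room for the intercept coordinate, since
    \<open>(norm (d n \<omega> i))\<^sup>2\<close> is
    \<open>1 + (norm (c n i \<omega>))\<^sup>2\<close>.\<close>
  define Des where "Des \<gamma> n \<omega> \<longleftrightarrow> (\<forall>i\<in>{1..n}. (norm (c n i \<omega>))\<^sup>2 \<le> \<gamma> * sqrt n - 1) \<and>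
    (\<forall>a\<in>UNIV. \<forall>b\<in>UNIV. \<bar>design_cov n (\<lambda>i. x n i \<omega>) $ a $ b - Q $ a $ b\<bar> \<le> \<zeta>)" for \<gamma> n \<omega>
  have Des_meas [measurable]: "{\<omega> \<in> space M. Des \<gamma> n \<omega>} \<in> sets M" for \<gamma> n
    unfolding Des_def by measurable
  have Des_lim: "(\<lambda>n. prob {\<omega> \<in> space M. \<not> Des \<gamma> n \<omega>}) \<longlonglongrightarrow> 0" if \<gamma>: "0 < \<gamma>" for \<gamma>
  proof (rule AE_eventually_prob_tendsto_0[OF _ Des_meas])
    show "AE \<omega> in M. eventually (\<lambda>n. Des \<gamma> n \<omega>) sequentially"
      using design_limit deviation
    proof eventually_elim
      case (elim \<omega>)
      have 1: "\<forall>\<^sub>F n in sequentially. \<bar>design_cov n (\<lambda>i. x n i \<omega>) $ a $ b - Q $ a $ b\<bar> \<le> \<zeta>" for a b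
      proof -
        have "(\<lambda>n. design_cov n (\<lambda>i. x n i \<omega>) $ a $ b) \<longlonglongrightarrow> Q $ a $ b"
          using elim(1) by (intro tendsto_vec_nth)
        from tendstoD[OF this \<zeta>(1)] show ?thesis by eventually_elim (simp add: dist_real_def)
      qed
      \<comment> \<open>Half of \<gamma> is used for the deviations of the covariates; the other
        half absorbs the subtracted 1 as soon as
        \<open>\<gamma> / 2 * sqrt n \<ge> 1\<close>.\<close>
      have "0 < sqrt (\<gamma> / 2)" using \<gamma> by simp
      from landau_o.smallD[OF elim(2) this]
      have 2: "\<forall>\<^sub>F n in sequentially. \<bar>max_deviation n (\<lambda>i. x n i \<omega>)\<bar> \<le> sqrt (\<gamma> / 2) * n powr (1 / 4)"
        by simp
      have "\<forall>\<^sub>F n in sequentially. \<forall>a\<in>UNIV. \<forall>b\<in>UNIV. \<bar>design_cov n (\<lambda>i. x n i \<omega>) $ a $ b - Q $ a $ b\<bar> \<le> \<zeta>"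
        by (intro eventually_ball_finite ballI 1) auto
      with 2 eventually_real_ge[of "(2 / \<gamma>)\<^sup>2"] show ?case
      proof eventually_elim
        case (elim n)
        have "2 / \<gamma> \<le> sqrt n" using elim(2) by (rule real_le_rsqrt)
        then have s: "1 \<le> \<gamma> / 2 * sqrt n" using \<gamma> by (simp add: field_simps)
        have "(norm (c n i \<omega>))\<^sup>2 \<le> \<gamma> * sqrt n - 1" if i: "i \<in> {1..n}" for i
        proof -
          have "norm (c n i \<omega>) \<le> max_deviation n (\<lambda>i. x n i \<omega>)"
            unfolding max_deviation_def c_def using i by (intro Max_ge) auto
          then have "norm (c n i \<omega>) \<le> sqrt (\<gamma> / 2) * n powr (1 / 4)" using elim(1) by linarith
          then have "(norm (c n i \<omega>))\<^sup>2 \<le> (sqrt (\<gamma> / 2) * n powr (1 / 4))\<^sup>2" by (intro power_mono) auto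
          also have "\<dots> = \<gamma> / 2 * (n powr (1 / 4) * n powr (1 / 4))"
          proof -
            have "(sqrt (\<gamma> / 2))\<^sup>2 = \<gamma> / 2" using \<gamma> by (intro real_sqrt_pow2) simp
            then show ?thesis by (simp only: power_mult_distrib) (simp only: power2_eq_square)
          qed
          also have "n powr (1 / 4) * n powr (1 / 4) = sqrt n" by (simp flip: powr_add add: powr_half_sqrt)
          finally show ?thesis using s by linarith
        qed
        then show ?case using elim(3) by (simp add: Des_def)
      qed
    qed
  qed
  have design: "(\<Sum>i=1..n. (norm (d n \<omega> i))\<^sup>2) \<le> n * B" "(\<Sum>i=1..n. norm (c n i \<omega>)) \<le> n * B"
    "n * (q0 / 2) * (norm v)\<^sup>2 \<le> (\<Sum>i=1..n. (c n i \<omega> \<bullet> v)\<^sup>2)"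
    if Des: "Des \<gamma> n \<omega>" and n: "1 \<le> n" for \<gamma> n \<omega> v
  proof -
    have close: "\<bar>design_cov n (\<lambda>i. x n i \<omega>) $ a $ b - Q $ a $ b\<bar> \<le> \<zeta>" for a b
      using Des by (simp add: Des_def)
    have "(\<Sum>i=1..n. (norm (c n i \<omega>))\<^sup>2) \<le> n * ((\<Sum>a\<in>UNIV. Q $ a $ a) + P * \<zeta>)"
      unfolding c_def P_def by (rule design_cov_bounds(1)[OF close n])
    also have "\<dots> \<le> n * (B - 1)" unfolding B_def by (intro mult_left_mono) auto
    finally have "(\<Sum>i=1..n. (norm (c n i \<omega>))\<^sup>2) \<le> n * (B - 1)" .
    then show 1: "(\<Sum>i=1..n. (norm (d n \<omega> i))\<^sup>2) \<le> n * B"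
      by (simp add: d_norm sum.distrib right_diff_distrib)
    have "(\<Sum>i=1..n. norm (c n i \<omega>)) \<le> (\<Sum>i=1..n. (norm (d n \<omega> i))\<^sup>2)"
    proof (intro sum_mono)
      fix i
      have "0 \<le> (norm (c n i \<omega>) - 1)\<^sup>2" by simp
      then show "norm (c n i \<omega>) \<le> (norm (d n \<omega> i))\<^sup>2" 
        unfolding d_norm power2_diff using norm_ge_zero[of "c n i \<omega>"] by (smt (verit) power_one zero_le_power2)
    qed
    then show "(\<Sum>i=1..n. norm (c n i \<omega>)) \<le> n * B" using 1 by linarith
    show "n * (q0 / 2) * (norm v)\<^sup>2 \<le> (\<Sum>i=1..n. (c n i \<omega> \<bullet> v)\<^sup>2)"
      using design_cov_bounds(2)[OF close n q0(3), of v] unfolding c_def P_def[symmetric] \<zeta>(2) .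
  qed
  let ?Xd = "\<lambda>n \<omega>. \<lambda>i\<in>{1..n}. d n \<omega> i" and ?Xe = "\<lambda>n \<omega>. \<lambda>i\<in>{1..n}. e n i \<omega>"
  have Xd_meas: "?Xd n \<in> measurable M (PiM {1..n} (\<lambda>_. borel))" for n
    unfolding d_def by (intro measurable_restrict borel_measurable_Pair) auto
  have Xe_meas: "?Xe n \<in> measurable M (PiM {1..n} (\<lambda>_. borel))" for n
    by (intro measurable_restrict) auto
  have indep: "prob ((?Xd n -` H \<inter> space M) \<inter> (?Xe n -` K \<inter> space M)) = prob (?Xd n -` H \<inter> space M) * prob (?Xe n -` K \<inter> space M)"
    if H: "H \<in> sets (PiM {1..n} (\<lambda>_. borel))" and K: "K \<in> sets (PiM {1..n} (\<lambda>_. borel))" for n H K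
  proof -
    let ?X = "\<lambda>\<omega>. \<lambda>i\<in>{1..n}. x n i \<omega>"
    \<comment> \<open>The centred design is a measurable function of the covariates, so its events
      inherit their independence of the errors.\<close>
    define h where "h \<xi> = (\<lambda>i\<in>{1..n}. (1::real, \<xi> i - sample_mean n \<xi>))" for \<xi> :: "nat \<Rightarrow> real ^ 'p"
    have mh: "h \<in> measurable (PiM {1..n} (\<lambda>_. borel)) (PiM {1..n} (\<lambda>_. borel))"
      unfolding h_def sample_mean_def by measurable
    have "sample_mean n (?X \<omega>) = ?xm n \<omega>" for \<omega> by (simp add: sample_mean_def)
    then have h: "h (?X \<omega>) = ?Xd n \<omega>" for \<omega> by (auto simp: h_def d_def c_def fun_eq_iff)
    have "?X -` (h -` H \<inter> space (PiM {1..n} (\<lambda>_. borel))) \<inter> space M \<in> sample_events M n (x n)"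
      unfolding sample_events_def by (intro in_vimage_algebra measurable_sets[OF mh H])
    also have "?X -` (h -` H \<inter> space (PiM {1..n} (\<lambda>_. borel))) \<inter> space M = ?Xd n -` H \<inter> space M"
      using h by (auto simp: space_PiM)
    finally have 1: "?Xd n -` H \<inter> space M \<in> sample_events M n (x n)" .
    have "?Xe n -` K \<inter> space M \<in> sample_events M n (e n)"
      unfolding sample_events_def using K by (rule in_vimage_algebra)
    with 1 show ?thesis by (rule indep_setD[OF covariates_indep])
  qed
  define \<mu> where "\<mu> = min lam (1 - lam) / 2"
  have A_ev: "\<forall>\<^sub>F n in sequentially. central_scores n \<mu> (A n) \<and> \<bar>\<Sum>i=1..n. A n i\<bar> \<le> 1 \<and>
    (A \<noteq> point_scores (quantile_score lam) \<longrightarrow> (\<Sum>i=1..n. A n i) = 0)"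
  proof -
    note sc = point_scores_central[OF lam \<mu>_def] integral_scores_central[OF lam \<mu>_def] exact_scores_central[OF lam \<mu>_def]
    from scores consider "A = exact_scores (quantile_score lam)" | "A = integral_scores (quantile_score lam)"
      | "A = point_scores (quantile_score lam)" by blast
    then show ?thesis
    proof cases
      case 1
      from sc(3) show ?thesis unfolding 1 by eventually_elim simp
    next
      case 2
      from sc(2) show ?thesis unfolding 2 by eventually_elim simp
    next
      case 3
      from sc(1) show ?thesis unfolding 3 by eventually_elim simp
    qed
  qed
  have mean: "\<exists>m\<ge>0. \<exists>N. \<forall>n\<ge>N. prob {\<omega> \<in> space M. \<not> norm (?xm n \<omega>) * \<bar>\<Sum>i=1..n. A n i\<bar> \<le> m * sqrt n} \<le> \<eta>"
    if \<eta>: "0 < \<eta>" for \<eta>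
  proof (cases "A = point_scores (quantile_score lam)")
    case True
    obtain m N where m: "0 \<le> m" "\<And>n. N \<le> n \<Longrightarrow> prob {\<omega> \<in> space M. \<not> norm (?xm n \<omega>) \<le> m * sqrt n} \<le> \<eta>"
      using AE_bigo_sqrt_bounded[OF _ point_scores_mean[OF True] \<eta>] by auto
    obtain N' where N': "\<And>n. N' \<le> n \<Longrightarrow> \<bar>\<Sum>i=1..n. A n i\<bar> \<le> 1"
      using A_ev unfolding eventually_sequentially by blast
    have "prob {\<omega> \<in> space M. \<not> norm (?xm n \<omega>) * \<bar>\<Sum>i=1..n. A n i\<bar> \<le> m * sqrt n} \<le> \<eta>" if n: "max N N' \<le> n" for n
    proof -
      have "norm (?xm n \<omega>) * \<bar>\<Sum>i=1..n. A n i\<bar> \<le> norm (?xm n \<omega>)" for \<omega>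
        using N'[of n] n mult_left_mono[of "\<bar>\<Sum>i=1..n. A n i\<bar>" 1 "norm (?xm n \<omega>)"] by simp
      then have "prob {\<omega> \<in> space M. \<not> norm (?xm n \<omega>) * \<bar>\<Sum>i=1..n. A n i\<bar> \<le> m * sqrt n}
        \<le> prob {\<omega> \<in> space M. \<not> norm (?xm n \<omega>) \<le> m * sqrt n}"
        by (intro finite_measure_mono) (auto intro: order.trans)
      then show ?thesis using m(2)[of n] n by linarith
    qed
    then show ?thesis using m(1) by blast
  next
    case False
    obtain N where N: "\<And>n. N \<le> n \<Longrightarrow> (\<Sum>i=1..n. A n i) = 0"
      using A_ev False unfolding eventually_sequentially by blast
    have "prob {\<omega> \<in> space M. \<not> norm (?xm n \<omega>) * \<bar>\<Sum>i=1..n. A n i\<bar> \<le> 0 * sqrt n} \<le> \<eta>" if "N \<le> n" for n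
      using N[OF that] \<eta> by simp
    then show ?thesis by (intro exI[of _ 0]) auto
  qed
  have core: "\<exists>N. \<forall>n\<ge>N. \<exists>S\<in>sets M. prob S \<le> \<eta> \<and> (\<forall>\<omega>\<in>space M - S. \<forall>\<alpha>\<in>{\<epsilon><..<1 - \<epsilon>}.
      \<bar>?Z1 n \<alpha> \<omega>\<bar> \<le> \<delta> \<and>
      \<bar>?Z2 n \<alpha> \<omega>\<bar> \<le> \<delta>)"
    if \<epsilon>: "0 < \<epsilon>" "\<epsilon> < 1 / 2" and \<delta>: "0 < \<delta>" and \<eta>: "0 < \<eta>" for \<epsilon> \<delta> \<eta> :: real
  proof -
    \<comment> \<open>Three exceptional events share \<eta>: an irregular design, a large mean of
      the covariates, and a failure of the expansion.\<close>
    have \<eta>3: "0 < \<eta> / 3" using \<eta> by simp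
    define \<kappa> where "\<kappa> = min \<epsilon> \<mu>"
    have \<kappa>: "0 < \<kappa>" "\<kappa> < 1 / 2" "\<kappa> \<le> \<mu>" "\<kappa> \<le> \<epsilon>" 
    proof -
      have "0 < \<mu>" using lam by (simp add: \<mu>_def)
      then show "0 < \<kappa>" "\<kappa> < 1 / 2" "\<kappa> \<le> \<mu>" "\<kappa> \<le> \<epsilon>" using \<epsilon> by (auto simp: \<kappa>_def)
    qed
    obtain a0 b0 \<phi>0 where ab: "a0 < b0" and \<phi>0: "0 < \<phi>0"
      and quant: "\<And>\<alpha>. \<alpha> \<in> {\<kappa>..1 - \<kappa>} \<Longrightarrow> \<exists>t\<in>{a0..<b0}. F t = \<alpha> \<and> \<phi>0 \<le> f t"
      using positive_density_quantiles[OF F' f_cont F_lim F_mono f_pos \<kappa>(1,2)] by blast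
    obtain m N1 where m: "0 \<le> m" and N1: "\<And>n. N1 \<le> n \<Longrightarrow>
        prob {\<omega> \<in> space M. \<not> norm (?xm n \<omega>) * \<bar>\<Sum>i=1..n. A n i\<bar> \<le> m * sqrt n} \<le> \<eta> / 3"
      using mean[OF \<eta>3] by blast
    obtain C0 :: real where C0: "0 < C0" and AL: "\<And>C \<tau> :: real. 0 < C \<Longrightarrow> 0 < \<tau> \<Longrightarrow> \<exists>\<gamma>>0. \<exists>N. \<forall>n\<ge>N.
        \<exists>G :: (nat \<Rightarrow> real \<times> (real ^ 'p)) \<Rightarrow> _. linearizing n F f {a0..<b0} B \<gamma> (\<eta> / 3) C0 C \<tau> G"
      by (rule asymptotic_linearity[OF F' f_cont f_nonneg ab B \<eta>3, where 'b = "real \<times> (real ^ 'p)"]) (rule that)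
    define \<tau> where "\<tau> = min 1 (\<phi>0 * \<delta> / 4)"
    have \<tau>: "0 < \<tau>" "\<tau> \<le> 1" "4 * \<tau> / \<phi>0 \<le> \<delta>" using \<phi>0 \<delta> by (auto simp: \<tau>_def min_def field_simps)
    define q where "q = q0 / 2"
    have q: "0 < q" "q \<le> 1" using q0 by (auto simp: q_def)
    \<comment> \<open>This choice makes \<open>\<phi>0 * C * q\<close> equal to
      \<open>2 * (m + B) + C0 + 2\<close>, which exceeds the requirement because
      \<open>\<tau> \<le> 1\<close>. The 2 in front of \<open>m + B\<close> stems from the score
      rise 1/2.\<close>
    define C where "C = (2 * (m + B) + C0 + 2) / (\<phi>0 * q)"
    have C: "0 < C" unfolding C_def using m B C0 \<phi>0 q by (intro divide_pos_pos mult_pos_pos add_nonneg_pos) auto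
    have big: "2 * (m + B) + C0 + \<tau> < \<phi>0 * C * q" unfolding C_def using \<phi>0 q \<tau>(2) by simp
    \<comment> \<open>The expansion must hold on a larger ball than the one confining the slopes:
      \<open>(C0 + 2 * \<tau>) / \<phi>0\<close> is for the intercepts of the order statistics, and
      \<open>2 * C + 1\<close> for the intercept and slope of the regression quantile together with
      the perturbation of its intercept.\<close>
    define C' where "C' = (2 * C + 1) + (C0 + 2 * \<tau>) / \<phi>0"
    have C0\<tau>: "0 \<le> (C0 + 2 * \<tau>) / \<phi>0" using C0 \<tau> \<phi>0 by auto
    have C': "0 < C'" "C + (C0 + 2 * \<tau>) / \<phi>0 \<le> C'" "2 * C + 1 \<le> C'" unfolding C'_def using C C0\<tau> by linarith+
    obtain \<gamma> N2 where \<gamma>: "0 < \<gamma>" and N2: "\<And>n. N2 \<le> n \<Longrightarrow>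
        \<exists>G :: (nat \<Rightarrow> real \<times> (real ^ 'p)) \<Rightarrow> _. linearizing n F f {a0..<b0} B \<gamma> (\<eta> / 3) C0 C' \<tau> G"
      using AL[OF C'(1) \<tau>(1)] by blast
    obtain N3 where N3: "\<And>n. N3 \<le> n \<Longrightarrow> prob {\<omega> \<in> space M. \<not> Des \<gamma> n \<omega>} \<le> \<eta> / 3"
      using order_tendstoD(2)[OF Des_lim[OF \<gamma>] \<eta>3] unfolding eventually_sequentially by (meson less_imp_le)
    obtain N4 where N4: "\<And>n. N4 \<le> n \<Longrightarrow> central_scores n \<mu> (A n)"
      using A_ev unfolding eventually_sequentially by blast
    obtain N5 where N5: "\<And>n. N5 \<le> n \<Longrightarrow> max (1 / \<epsilon>) ((2 / \<tau>)\<^sup>2) \<le> real n"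
      using eventually_real_ge[of "max (1 / \<epsilon>) ((2 / \<tau>)\<^sup>2)"] unfolding eventually_sequentially by blast
    show ?thesis
    proof (intro exI[of _ "Max {N1, N2, N3, N4, N5}"] allI impI)
      fix n assume "Max {N1, N2, N3, N4, N5} \<le> n"
      then have n: "N1 \<le> n" "N2 \<le> n" "N3 \<le> n" "N4 \<le> n" "N5 \<le> n" by simp_all
      have n\<epsilon>: "1 \<le> n * \<epsilon>" using N5[OF n(5)] \<epsilon> by (simp add: pos_divide_le_eq)
      then have n1: "1 \<le> n" by (cases n) auto
      have "2 / \<tau> \<le> sqrt n" using N5[OF n(5)] by (intro real_le_rsqrt) simp
      then have "2 \<le> \<tau> * sqrt n" using \<tau>(1) by (simp add: pos_divide_le_eq mult.commute)
      then have \<tau>n: "1 < \<tau> * sqrt n" by linarith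
      obtain G where G_meas: "{p \<in> space (PiM {1..n} (\<lambda>_. borel) \<Otimes>\<^sub>M PiM {1..n} (\<lambda>_. borel)). G (fst p) (snd p)}
          \<in> sets (PiM {1..n} (\<lambda>_. borel :: (real \<times> (real ^ 'p)) measure) \<Otimes>\<^sub>M PiM {1..n} (\<lambda>_. borel :: real measure))"
        and G_prob: "\<And>d X. (\<And>i. i \<in> {1..n} \<Longrightarrow> 1 \<le> norm (d i) \<and> (norm (d i))\<^sup>2 \<le> \<gamma> * sqrt n) \<Longrightarrow> (\<Sum>i=1..n. (norm (d i))\<^sup>2) \<le> n * B \<Longrightarrow>
          indep_vars (\<lambda>_. borel) X {1..n} \<Longrightarrow> (\<And>i s. i \<in> {1..n} \<Longrightarrow> prob {\<omega> \<in> space M. X i \<omega> \<le> s} = F s) \<Longrightarrow>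
          prob {\<omega> \<in> space M. \<not> G d (\<lambda>i. X i \<omega>)} \<le> \<eta> / 3"
        and G_lin: "\<And>d e t. (\<And>i. i \<in> {1..n} \<Longrightarrow> 1 \<le> norm (d i) \<and> (norm (d i))\<^sup>2 \<le> \<gamma> * sqrt n) \<Longrightarrow> (\<Sum>i=1..n. (norm (d i))\<^sup>2) \<le> n * B \<Longrightarrow>
          G d e \<Longrightarrow> t \<in> {a0..<b0} \<Longrightarrow> \<exists>T. norm T \<le> C0 \<and> linear_at n d e (F t) (f t) t T C' \<tau>"
        using N2[OF n(2)] unfolding linearizing_def by blast
      let ?Pd = "PiM {1..n} (\<lambda>_. borel :: (real \<times> (real ^ 'p)) measure)" and ?Pe = "PiM {1..n} (\<lambda>_. borel :: real measure)"
      \<comment> \<open>The design conditions are built into the bad set. For a frozen design that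
        violates them its section is empty, so the bound holds for every frozen design.\<close>
      define W where "W = {p \<in> space (?Pd \<Otimes>\<^sub>M ?Pe). (\<forall>i\<in>{1..n}. 1 \<le> norm (fst p i) \<and> (norm (fst p i))\<^sup>2 \<le> \<gamma> * sqrt n) \<and>
        (\<Sum>i=1..n. (norm (fst p i))\<^sup>2) \<le> n * B \<and> \<not> G (fst p) (snd p)}"
      have W: "W \<in> sets (?Pd \<Otimes>\<^sub>M ?Pe)"
        unfolding W_def using G_meas by measurable
      have W_prob: "prob {\<omega> \<in> space M. (?Xd n \<omega>, ?Xe n \<omega>) \<in> W} \<le> \<eta> / 3"
      proof (rule independent_conditional_bound[OF Xd_meas Xe_meas indep W less_imp_le[OF \<eta>3]])
        fix \<xi> assume \<xi>: "\<xi> \<in> space ?Pd"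
        show "prob {\<omega> \<in> space M. (\<xi>, ?Xe n \<omega>) \<in> W} \<le> \<eta> / 3"
        proof (cases "(\<forall>i\<in>{1..n}. 1 \<le> norm (\<xi> i) \<and> (norm (\<xi> i))\<^sup>2 \<le> \<gamma> * sqrt n) \<and> (\<Sum>i=1..n. (norm (\<xi> i))\<^sup>2) \<le> n * B")
          case True
          \<comment> \<open>Outside \<open>{1..n}\<close> the restricted sample is
            \<open>undefined\<close>; \<open>X\<close> copies this, so that \<open>G\<close> is
            evaluated at exactly the restricted function.\<close>
          define X where "X i \<omega> = ?Xe n \<omega> i" for i \<omega>
          have X: "X i = e n i" if "i \<in> {1..n}" for i using that by (simp add: X_def fun_eq_iff)
          have "indep_vars (\<lambda>_. borel) X {1..n}" 
            using indep_vars_cong[where X = X and Y = "e n" and M' = "\<lambda>_. borel" and N' = "\<lambda>_. borel", OF refl X refl] errors_indep[of n] by blast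
          then have "prob {\<omega> \<in> space M. \<not> G \<xi> (\<lambda>i. X i \<omega>)} \<le> \<eta> / 3"
            using True X e_cdf by (intro G_prob) auto
          moreover have "{\<omega> \<in> space M. (\<xi>, ?Xe n \<omega>) \<in> W} = {\<omega> \<in> space M. \<not> G \<xi> (\<lambda>i. X i \<omega>)}"
          proof -
            have "(\<lambda>i. X i \<omega>) = ?Xe n \<omega>" for \<omega> unfolding X_def ..
            then show ?thesis using True \<xi> by (auto simp: W_def space_pair_measure space_PiM)
          qed
          ultimately show ?thesis by simp
        next
          case False
          then have empty: "{\<omega> \<in> space M. (\<xi>, ?Xe n \<omega>) \<in> W} = {}" unfolding W_def by auto
          show ?thesis unfolding empty using \<eta> by simp
        qed
      qed
      define S1 where "S1 = {\<omega> \<in> space M. \<not> Des \<gamma> n \<omega>}"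
      define S2 where "S2 = {\<omega> \<in> space M. \<not> norm (?xm n \<omega>) * \<bar>\<Sum>i=1..n. A n i\<bar> \<le> m * sqrt n}"
      define S3 where "S3 = {\<omega> \<in> space M. (?Xd n \<omega>, ?Xe n \<omega>) \<in> W}"
      have S1: "S1 \<in> sets M" unfolding S1_def by measurable
      have S2: "S2 \<in> sets M" unfolding S2_def by measurable
      have S3: "S3 \<in> sets M"
        unfolding S3_def using Xd_meas[of n] Xe_meas[of n] W by measurable
      show "\<exists>S\<in>sets M. prob S \<le> \<eta> \<and> (\<forall>\<omega>\<in>space M - S. \<forall>\<alpha>\<in>{\<epsilon><..<1 - \<epsilon>}.
          \<bar>?Z1 n \<alpha> \<omega>\<bar> \<le> \<delta> \<and>
          \<bar>?Z2 n \<alpha> \<omega>\<bar> \<le> \<delta>)"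
      proof (intro bexI[of _ "S1 \<union> S2 \<union> S3"] conjI ballI)
        have "prob (S1 \<union> S2 \<union> S3) \<le> prob (S1 \<union> S2) + prob S3" by (intro measure_Un_le sets.Un S1 S2 S3)
        moreover have "prob (S1 \<union> S2) \<le> prob S1 + prob S2" by (intro measure_Un_le S1 S2)
        ultimately show "prob (S1 \<union> S2 \<union> S3) \<le> \<eta>"
          using N3[OF n(3)] N1[OF n(1)] W_prob unfolding S1_def S2_def S3_def by linarith
        show "S1 \<union> S2 \<union> S3 \<in> sets M" using S1 S2 S3 by auto
        fix \<omega> \<alpha> assume \<omega>: "\<omega> \<in> space M - (S1 \<union> S2 \<union> S3)" and \<alpha>: "\<alpha> \<in> {\<epsilon><..<1 - \<epsilon>}"
        then have w: "\<omega> \<in> space M" and Des: "Des \<gamma> n \<omega>" and xm: "norm (?xm n \<omega>) * \<bar>\<Sum>i=1..n. A n i\<bar> \<le> m * sqrt n"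
          and nW: "(?Xd n \<omega>, ?Xe n \<omega>) \<notin> W" by (auto simp: S1_def S2_def S3_def)
        have d1: "1 \<le> norm (?Xd n \<omega> i) \<and> (norm (?Xd n \<omega> i))\<^sup>2 \<le> \<gamma> * sqrt n" if "i \<in> {1..n}" for i
        proof -
          have "(norm (c n i \<omega>))\<^sup>2 \<le> \<gamma> * sqrt n - 1" using Des that unfolding Des_def by blast
          then show ?thesis using that d_ge[of n \<omega> i] by (simp add: d_norm)
        qed
        have d2: "(\<Sum>i=1..n. (norm (?Xd n \<omega> i))\<^sup>2) \<le> n * B" using design(1)[OF Des n1] by simp
        have "(?Xd n \<omega>, ?Xe n \<omega>) \<in> space (?Pd \<Otimes>\<^sub>M ?Pe)" by (simp add: space_pair_measure space_PiM)
        then have G: "G (?Xd n \<omega>) (?Xe n \<omega>)" using nW d1 d2 unfolding W_def by simp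
        have lin: "\<exists>\<phi> t T. linear_at n (\<lambda>i. (1::real, c n i \<omega>)) (\<lambda>i. e n i \<omega>) a \<phi> t T C' \<tau> \<and> norm T \<le> C0 \<and> \<phi>0 \<le> \<phi>"
          if a: "\<kappa> \<le> a" "a \<le> 1 - \<kappa>" for a
        proof -
          obtain t where t: "t \<in> {a0..<b0}" "F t = a" "\<phi>0 \<le> f t" using quant[of a] a by auto
          obtain T where T: "norm T \<le> C0" "linear_at n (?Xd n \<omega>) (?Xe n \<omega>) (F t) (f t) t T C' \<tau>"
            using G_lin[OF d1 d2 G t(1)] by blast
          have "linear_at n (\<lambda>i. (1::real, c n i \<omega>)) (\<lambda>i. e n i \<omega>) a (f t) t T C' \<tau>"
            using T(2) t(2) linear_at_cong[of n "?Xd n \<omega>" "\<lambda>i. (1::real, c n i \<omega>)" "?Xe n \<omega>" "\<lambda>i. e n i \<omega>"]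
            by (simp add: d_def)
          then show ?thesis using T(1) t(3) by blast
        qed
        have \<alpha>': "\<epsilon> < \<alpha>" "\<alpha> < 1 - \<epsilon>" "0 < \<alpha>" "\<alpha> < 1" using \<alpha> \<epsilon> by auto
        have mod: "\<And>i. i \<in> {1..n} \<Longrightarrow> Y n i \<omega> = \<beta>0 + x n i \<omega> \<bullet> \<beta> + e n i \<omega>" using model w by blast
        note rep = two_step_representation[where x = "\<lambda>i. x n i \<omega>" and Y = "\<lambda>i. Y n i \<omega>" and e = "\<lambda>i. e n i \<omega>" and c = "\<lambda>i. c n i \<omega>"
          and n = n and B = B and q = q and m = m and C = C and C' = C' and A = A and bR = "\<beta>R n \<omega>" and bh = "\<beta>hat n \<alpha> \<omega>",
          OF mod c_def lin \<phi>0 \<tau>n \<tau>(1) less_imp_le[OF C0] less_imp_le[OF q(1)] q(2) _ design(2)[OF Des n1] less_imp_le[OF B] m N4[OF n(4)] xm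
            \<kappa>(3,4) \<epsilon>(1) n\<epsilon> C C'(2,3) big R_estimator[OF w] regression_quantile[OF \<alpha>'(3,4) w] \<alpha>'(1,2)]
        have Qb: "n * q * (norm v)\<^sup>2 \<le> (\<Sum>i=1..n. (c n i \<omega> \<bullet> v)\<^sup>2)" for v
          unfolding q_def by (rule design(3)[OF Des n1])
        show "\<bar>?Z1 n \<alpha> \<omega>\<bar> \<le> \<delta>"
          by (rule order.trans[OF rep(1)[OF _ _ _ Qb] \<tau>(3)])
        show "\<bar>?Z2 n \<alpha> \<omega>\<bar> \<le> \<delta>"
          by (rule order.trans[OF rep(2)[OF _ _ _ Qb] \<tau>(3)])
      qed
    qed
  qed
  show ?thesis
  proof (intro allI impI conjI)
    fix \<epsilon> :: real assume \<epsilon>: "0 < \<epsilon> \<and> \<epsilon> < 1 / 2"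
    note core' = core[OF conjunct1[OF \<epsilon>] conjunct2[OF \<epsilon>]]
    show "uniformly_op_1 M {\<epsilon><..<1 - \<epsilon>} ?Z1"
    proof (rule uniformly_op_1I)
      fix \<delta> \<eta> :: real assume "0 < \<delta>" "0 < \<eta>"
      from core'[OF this]
      show "\<exists>N. \<forall>n\<ge>N. \<exists>S\<in>sets M. prob S \<le> \<eta> \<and> (\<forall>\<omega>\<in>space M - S. \<forall>\<alpha>\<in>{\<epsilon><..<1 - \<epsilon>}. \<bar>?Z1 n \<alpha> \<omega>\<bar> \<le> \<delta>)" by meson
    qed
    show "uniformly_op_1 M {\<epsilon><..<1 - \<epsilon>} ?Z2"
    proof (rule uniformly_op_1I)
      fix \<delta> \<eta> :: real assume "0 < \<delta>" "0 < \<eta>"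
      from core'[OF this]
      show "\<exists>N. \<forall>n\<ge>N. \<exists>S\<in>sets M. prob S \<le> \<eta> \<and> (\<forall>\<omega>\<in>space M - S. \<forall>\<alpha>\<in>{\<epsilon><..<1 - \<epsilon>}. \<bar>?Z2 n \<alpha> \<omega>\<bar> \<le> \<delta>)" by meson
    qed
  qed
qed

end
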